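(* Let $\Lambda$ be a string algebra whose underlying quiver is acyclic. Let $\mathfrak b_1,\dots,\mathfrak b_k$ be bands for $\Lambda$, $l_1,\dots,l_k\in\mathbb N^+$ and $\lambda_1,\dots,\lambda_k\in\mathcal K^\times$. Assume that $B(\mathfrak b_i,l_i,\lambda_i)\not\cong B(\mathfrak b_j,l_j,\lambda_j)$ for all $i\ne j$. Then the module $S:=B(\mathfrak b_1,l_1,\lambda_1)\oplus\cdots\oplus B(\mathfrak b_k,l_k,\lambda_k)$ is a band semibrick if and only if $l_i=1$ for every $i\in\{1,\dots,k\}$, and $(\mathcal W_{\mathsf{Ba}}(\mathfrak b_i),\mathcal W_{\mathsf{Ba}}(\mathfrak b_j))$ and $(\mathcal W_{\mathsf{Ba}}(\mathfrak b_i),\mathcal W_{\mathsf{Ba}}(\mathfrak b_j^{-1}))$ are weakly perfectly clustering pairs of crowns for all $i,j\in\{1,\dots,k\}$.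
   Context: $\mathcal K$ is an algebraically closed field. Paths are composed right to left ($\alpha\beta$ means first $\beta$, then $\alpha$). A brick is a (finite-dimensional) module whose endomorphism algebra is isomorphic to $\mathcal K$. A semibrick is a direct sum of finitely many bricks $B_1,\dots,B_k$ such that there is no non-zero morphism $B_i\to B_j$ for $i\ne j$. It is a band semibrick if each $B_i$ is a band module (which is a brick). String algebra. $\Lambda=\mathcal KQ/\langle\rho\rangle$, where $Q=(Q_0,Q_1,s,t)$ is a finite quiver and $\rho$ a set of paths of length $\ge 2$ such that: (I) every vertex is the source of at most two arrows and the target of at most two arrows; (II) for every $\alpha\in Q_1$ there is at most one arrow $\beta$ with $s(\alpha)=t(\beta)$ and $\alpha\beta\notin\rho$, and at most one arrow $\beta'$ with $s(\beta')=t(\alpha)$ and $\beta'\alpha\notin\rho$; (III) there is a bound on the lengths of paths having no subpath in $\rho$. $Q$ is acyclic if it has no directed cycle. Signs. Fix maps $\varsigma,\varepsilon:Q_1\to\{-1,1\}$ such that: distinct arrows $\alpha,\beta$ with the same source have $\varsigma(\alpha)=-\varsigma(\beta)$; distinct arrows with the same target have $\varepsilon(\alpha)=-\varepsilon(\beta)$; if $s(\alpha)=t(\beta)$ and $\alpha\beta\notin\rho$ then $\varsigma(\alpha)=-\varepsilon(\beta)$. For formal inverses put $s(\alpha^{-1})=t(\alpha)$, $t(\alpha^{-1})=s(\alpha)$, $\varsigma(\alpha^{-1})=\varepsilon(\alpha)$, $\varepsilon(\alpha^{-1})=\varsigma(\alpha)$. Elements of $Q_1$ (direct) and $Q_1^{-1}$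 (inverse) are called syllables. Strings and bands. A positive-length string is a sequence of syllables $\alpha_k\cdots\alpha_1$ with $t(\alpha_i)=s(\alpha_{i+1})$, $\alpha_i\ne\alpha_{i+1}^{-1}$, and such that no consecutive subsequence $\alpha_{i+j}\cdots\alpha_i$ nor its inverse $\alpha_i^{-1}\cdots\alpha_{i+j}^{-1}$ lies in $\rho$. Its inverse is $\alpha_1^{-1}\cdots\alpha_k^{-1}$. A band is a positive-length string $\mathfrak b$ with $s(\mathfrak b)=t(\mathfrak b)$, all powers $\mathfrak b^m$ ($m\ge1$) strings, $\mathfrak b$ not of the form $\mathfrak u^m$ with $m\ge2$, first (rightmost) syllable inverse and last (leftmost) syllable direct. If $\mathfrak b$ is a band so is $\mathfrak b^{-1}$. Band module. For a band $\mathfrak b=\alpha_k\cdots\alpha_1$ let $u_0=s(\alpha_1)$, $u_j=t(\alpha_j)$ (so $u_k=u_0$). $B(\mathfrak b,l,\lambda)$ is the usual band module: place a copy $V_j$ of $\mathcal K^l$ at $u_j$ for each $j\in\mathbb Z/k$; if $\alpha_j$ is direct it maps $V_{j-1}\to V_j$, if $\alpha_j=\beta^{-1}$ then $\beta$ maps $V_j\to V_{j-1}$; one of these maps is the $l\times l$ Jordan block with eigenvalue $\lambda$, the others are identities, all other components of arrows are zero. Ordered alphabet. Let $A=Q_0\times\{-1,1\}$. For a syllable $\alpha$ put $\overline s(\alpha)=(s(\alpha),-\varsigma(\alpha))$ and $\overline t(\alpha)=(t(\alpha),\varepsilon(\alpha))$. Let $<$ be the transitive closure of the relation: $p<q$ if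 there is $\alpha\in Q_1$ with ($\overline s(\alpha)=q$ and $\overline t(\alpha)=p$) or ($\overline s(\alpha^{-1})=p$ and $\overline t(\alpha^{-1})=q$). As $Q$ is acyclic, $<$ is a strict partial order on $A$. Traces. For $p,q\in A$ there is at most one positive-length string $\mathfrak z=\alpha_k\cdots\alpha_1$ with all syllables direct or all syllables inverse such that $\overline s(\alpha_1)=p$ and $\overline t(\alpha_k)=q$. If it exists, $T_{(p,q)}$ is the sequence $\langle p,\overline s(\alpha_2),\dots,\overline s(\alpha_k),q\rangle$; otherwise $T_{(p,q)}$ is empty. Intersections of traces are intersections of their sets of terms. The word of a band. Write a band uniquely as $\mathfrak b=\mathfrak x_{k}\cdots\mathfrak x_1$, where each $\mathfrak x_i$ is a positive-length string whose syllables are all direct or all inverse, and $\mathfrak x_i,\mathfrak x_{i+1}$ have opposite types. Then $\mathcal W_{\mathsf{Ba}}(\mathfrak b):=n_1n_2\cdots n_k$, where $n_i=\overline s(\text{first (rightmost) syllable of }\mathfrak x_i)\in A$. Words over $A$ are read left to right; $\mathcal W_{\mathsf{Ba}}(\mathfrak b)$ is a crown, i.e. it and all its cyclic permutations are zigzags (consecutive letters alternately strictly increase and decrease). Weakly perfectly clustering pair. A pair $(\mathsf w_1,\mathsf w_2)$ of crowns is weakly perfectly clustering if neither of the following happens. (1) There are cyclic permutations $\mathsf w'=n'\mathsf z m'\mathsf z'$ of $\mathsf w_1^{2|\mathsf w_2|}$ and $\mathsf w''=n''\mathsf z m''\mathsf z''$ of $\mathsf w_2^{2|\mathsf w_1|}$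 ($n',m',n'',m''$ letters; $\mathsf z,\mathsf z',\mathsf z''$ words) with $n'<n''$, $m'<m''$, $|\mathsf z|\ge1$. (2) There are cyclic permutations $\mathsf w'=n'm'\mathsf z'$ of $\mathsf w_1^{2|\mathsf w_2|}$ and $\mathsf w''=n''m''\mathsf z''$ of $\mathsf w_2^{2|\mathsf w_1|}$ with $n'<n''$, $m'<m''$, ($n'<m'$ if and only if $n''<m''$), and $T_{(n',m')}\cap T_{(n'',m'')}\ne\emptyset$. *)

theory Defs
  imports
    "HOL-Library.FuncSet"
    "HOL-Library.Sublist"
    "HOL-Computational_Algebra.Polynomial"
    "HOL-Algebra.QuotRing"
    "HOL-Algebra.Module"
    "Graph_Theory.Digraph"
    "Graph_Theory.Arc_Walk"
    "Jordan_Normal_Form.Matrix"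
    "Jordan_Normal_Form.Jordan_Normal_Form"
begin

text \<open>
  Convention. Paths and strings are composed right to left in the mathematical notation, and a
  path or string \<open>\<alpha>\<^sub>k \<cdots> \<alpha>\<^sub>1\<close> is represented by the list \<open>[\<alpha>\<^sub>1, \<dots>, \<alpha>\<^sub>k]\<close>, in the order in which it
  is traversed (the order of \<open>awalk\<close>). So the first (rightmost) syllable is the \<open>hd\<close> and the last
  (leftmost) syllable is the \<open>last\<close> of the list, and the composite \<open>\<alpha> \<beta>\<close> is \<open>[\<beta>, \<alpha>]\<close>.
\<close>

section \<open>String algebras\<close>

definition acyclic_quiver :: "('v, 'a) pre_digraph \<Rightarrow> bool" where
  "acyclic_quiver Q \<longleftrightarrow> (\<nexists>p. pre_digraph.cycle Q p)"

text \<open>A presentation \<open>(Q, \<rho>)\<close> of a string algebra \<open>KQ / \<langle>\<rho>\<rangle>\<close>.\<close>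

locale string_algebra = fin_digraph Q
  for Q :: "('v, 'a) pre_digraph" (structure) +
  fixes \<rho> :: "'a list set"
  assumes relation_path: "r \<in> \<rho> \<Longrightarrow> 2 \<le> length r \<and> (\<exists>u v. pre_digraph.awalk Q u r v)"
    and at_most_two_out: "v \<in> verts Q \<Longrightarrow> card {a \<in> arcs Q. tail Q a = v} \<le> 2"
    and at_most_two_in: "v \<in> verts Q \<Longrightarrow> card {a \<in> arcs Q. head Q a = v} \<le> 2"
    and at_most_one_before: "\<lbrakk>a \<in> arcs Q; b \<in> arcs Q; b' \<in> arcs Q;
      head Q b = tail Q a; [b, a] \<notin> \<rho>; head Q b' = tail Q a; [b', a] \<notin> \<rho>\<rbrakk> \<Longrightarrow> b = b'"
    and at_most_one_after: "\<lbrakk>a \<in> arcs Q; b \<in> arcs Q; b' \<in> arcs Q;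
      tail Q b = head Q a; [a, b] \<notin> \<rho>; tail Q b' = head Q a; [a, b'] \<notin> \<rho>\<rbrakk> \<Longrightarrow> b = b'"
    and bounded_paths: "\<exists>N. \<forall>u p v. pre_digraph.awalk Q u p v \<and> (\<forall>r\<in>\<rho>. \<not> sublist r p)
      \<longrightarrow> length p \<le> N"

locale signed_string_algebra = string_algebra Q \<rho>
  for Q :: "('v, 'a) pre_digraph" (structure) and \<rho> :: "'a list set" +
  fixes \<sigma> \<epsilon> :: "'a \<Rightarrow> int"
  assumes sign_values: "a \<in> arcs Q \<Longrightarrow> \<sigma> a \<in> {-1, 1} \<and> \<epsilon> a \<in> {-1, 1}"
    and sign_source: "\<lbrakk>a \<in> arcs Q; b \<in> arcs Q; a \<noteq> b; tail Q a = tail Q b\<rbrakk> \<Longrightarrow> \<sigma> a = - \<sigma> b"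
    and sign_target: "\<lbrakk>a \<in> arcs Q; b \<in> arcs Q; a \<noteq> b; head Q a = head Q b\<rbrakk> \<Longrightarrow> \<epsilon> a = - \<epsilon> b"
    and sign_composable: "\<lbrakk>a \<in> arcs Q; b \<in> arcs Q; tail Q a = head Q b; [b, a] \<notin> \<rho>\<rbrakk>
      \<Longrightarrow> \<sigma> a = - \<epsilon> b"

section \<open>Strings and bands\<close>

datatype 'a syllable = Dir 'a | Inv 'a

primrec syl_arc :: "'a syllable \<Rightarrow> 'a" where
  "syl_arc (Dir a) = a"
| "syl_arc (Inv a) = a"

primrec is_direct :: "'a syllable \<Rightarrow> bool" where
  "is_direct (Dir a) = True"
| "is_direct (Inv a) = False"

primrec syl_inv :: "'a syllable \<Rightarrow> 'a syllable" where
  "syl_inv (Dir a) = Inv a"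
| "syl_inv (Inv a) = Dir a"

primrec syl_src :: "('v, 'a) pre_digraph \<Rightarrow> 'a syllable \<Rightarrow> 'v" where
  "syl_src Q (Dir a) = tail Q a"
| "syl_src Q (Inv a) = head Q a"

primrec syl_tgt :: "('v, 'a) pre_digraph \<Rightarrow> 'a syllable \<Rightarrow> 'v" where
  "syl_tgt Q (Dir a) = head Q a"
| "syl_tgt Q (Inv a) = tail Q a"

definition str_inv :: "'a syllable list \<Rightarrow> 'a syllable list" where
  "str_inv w = rev (map syl_inv w)"

text \<open>Strings of positive length.\<close>

definition is_string :: "('v, 'a) pre_digraph \<Rightarrow> 'a list set \<Rightarrow> 'a syllable list \<Rightarrow> bool" where
  "is_string Q \<rho> w \<longleftrightarrow> w \<noteq> [] \<and> syl_arc ` set w \<subseteq> arcs Q \<and>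
     (\<forall>i. Suc i < length w \<longrightarrow>
        syl_tgt Q (w ! i) = syl_src Q (w ! Suc i) \<and> w ! i \<noteq> syl_inv (w ! Suc i)) \<and>
     (\<forall>u. sublist u w \<longrightarrow> u \<notin> map Dir ` \<rho> \<and> str_inv u \<notin> map Dir ` \<rho>)"

definition list_power :: "'b list \<Rightarrow> nat \<Rightarrow> 'b list" where
  "list_power w m = concat (replicate m w)"

definition is_band :: "('v, 'a) pre_digraph \<Rightarrow> 'a list set \<Rightarrow> 'a syllable list \<Rightarrow> bool" where
  "is_band Q \<rho> b \<longleftrightarrow> is_string Q \<rho> b \<and> syl_src Q (hd b) = syl_tgt Q (last b) \<and>
     (\<forall>m\<ge>1. is_string Q \<rho> (list_power b m)) \<and>
     (\<nexists>u m. m \<ge> 2 \<and> b = list_power u m) \<and>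
     \<not> is_direct (hd b) \<and> is_direct (last b)"

section \<open>Finite-dimensional modules as representations of the bound quiver\<close>

text \<open>
  A finite-dimensional module over \<open>KQ / \<langle>\<rho>\<rangle>\<close> is given by a dimension for each vertex and, for
  each arrow \<open>a\<close>, the matrix of the linear map from the space at \<open>tail Q a\<close> to the space at
  \<open>head Q a\<close> (acting on column vectors), such that the paths in \<open>\<rho>\<close> act as zero. Values at
  elements outside \<open>verts Q\<close> and \<open>arcs Q\<close> are irrelevant.
\<close>

record ('v, 'a, 'k) rep =
  rdim :: "'v \<Rightarrow> nat"
  rmat :: "'a \<Rightarrow> 'k mat"

primrec path_mat ::
  "('v, 'a) pre_digraph \<Rightarrow> ('v, 'a, 'k :: field) rep \<Rightarrow> 'v \<Rightarrow> 'a list \<Rightarrow> 'k mat" where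
  "path_mat Q M u [] = 1\<^sub>m (rdim M u)"
| "path_mat Q M u (a # p) = path_mat Q M (head Q a) p * rmat M a"

definition is_module ::
  "('v, 'a) pre_digraph \<Rightarrow> 'a list set \<Rightarrow> ('v, 'a, 'k :: field) rep \<Rightarrow> bool" where
  "is_module Q \<rho> M \<longleftrightarrow>
     (\<forall>a\<in>arcs Q. rmat M a \<in> carrier_mat (rdim M (head Q a)) (rdim M (tail Q a))) \<and>
     (\<forall>r\<in>\<rho>. path_mat Q M (tail Q (hd r)) r =
        0\<^sub>m (rdim M (head Q (last r))) (rdim M (tail Q (hd r))))"

text \<open>Morphisms are extensional functions on \<open>verts Q\<close>, so that they can be compared by equality.\<close>

definition rep_hom ::
  "('v, 'a) pre_digraph \<Rightarrow> ('v, 'a, 'k :: field) rep \<Rightarrow> ('v, 'a, 'k) rep \<Rightarrow> ('v \<Rightarrow> 'k mat) set"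
where
  "rep_hom Q M N = {f \<in> (\<Pi>\<^sub>E v\<in>verts Q. carrier_mat (rdim N v) (rdim M v)).
     \<forall>a\<in>arcs Q. f (head Q a) * rmat M a = rmat N a * f (tail Q a)}"

definition rep_comp :: "('v, 'a) pre_digraph \<Rightarrow> ('v \<Rightarrow> 'k :: field mat) \<Rightarrow> ('v \<Rightarrow> 'k mat) \<Rightarrow> 'v \<Rightarrow> 'k mat"
where
  "rep_comp Q g f = (\<lambda>v\<in>verts Q. g v * f v)"

definition rep_id :: "('v, 'a) pre_digraph \<Rightarrow> ('v, 'a, 'k :: field) rep \<Rightarrow> 'v \<Rightarrow> 'k mat" where
  "rep_id Q M = (\<lambda>v\<in>verts Q. 1\<^sub>m (rdim M v))"

definition rep_zero ::
  "('v, 'a) pre_digraph \<Rightarrow> ('v, 'a, 'k :: field) rep \<Rightarrow> ('v, 'a, 'k) rep \<Rightarrow> 'v \<Rightarrow> 'k mat" where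
  "rep_zero Q M N = (\<lambda>v\<in>verts Q. 0\<^sub>m (rdim N v) (rdim M v))"

definition rep_iso ::
  "('v, 'a) pre_digraph \<Rightarrow> ('v, 'a, 'k :: field) rep \<Rightarrow> ('v, 'a, 'k) rep \<Rightarrow> bool" where
  "rep_iso Q M N \<longleftrightarrow> (\<exists>f\<in>rep_hom Q M N. \<exists>g\<in>rep_hom Q N M.
     rep_comp Q g f = rep_id Q M \<and> rep_comp Q f g = rep_id Q N)"

definition rep_sum :: "('v, 'a, 'k :: field) rep list \<Rightarrow> ('v, 'a, 'k) rep" where
  "rep_sum Ms = \<lparr>rdim = (\<lambda>v. \<Sum>M\<leftarrow>Ms. rdim M v),
     rmat = (\<lambda>a. diag_block_mat (map (\<lambda>M. rmat M a) Ms))\<rparr>"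

section \<open>Bricks\<close>

text \<open>Algebras over the field \<open>'k\<close> as records; the scalars are elements of the type \<open>'k\<close>.\<close>

definition ground_algebra :: "('k :: field, 'k) module" where
  "ground_algebra = \<lparr>carrier = UNIV, monoid.mult = (*), one = 1, zero = 0, add = (+), smult = (*)\<rparr>"

definition end_algebra ::
  "('v, 'a) pre_digraph \<Rightarrow> ('v, 'a, 'k :: field) rep \<Rightarrow> ('k, 'v \<Rightarrow> 'k mat) module" where
  "end_algebra Q M = \<lparr>carrier = rep_hom Q M M, monoid.mult = rep_comp Q, one = rep_id Q M,
     zero = rep_zero Q M M, add = (\<lambda>f g. \<lambda>v\<in>verts Q. f v + g v),
     smult = (\<lambda>c f. \<lambda>v\<in>verts Q. c \<cdot>\<^sub>m f v)\<rparr>"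

definition is_alg_iso :: "('k, 'x) module \<Rightarrow> ('k, 'y) module \<Rightarrow> bool" where
  "is_alg_iso A B \<longleftrightarrow> (\<exists>h\<in>ring_iso A B. \<forall>c. \<forall>x\<in>carrier A. h (c \<odot>\<^bsub>A\<^esub> x) = c \<odot>\<^bsub>B\<^esub> h x)"

definition is_brick ::
  "('v, 'a) pre_digraph \<Rightarrow> 'a list set \<Rightarrow> ('v, 'a, 'k :: field) rep \<Rightarrow> bool" where
  "is_brick Q \<rho> M \<longleftrightarrow> is_module Q \<rho> M \<and> is_alg_iso (end_algebra Q M) ground_algebra"

section \<open>Band modules\<close>

text \<open>
  For a band of length \<open>k\<close>, the syllable \<open>b ! i\<close> relates the copies \<open>V\<^sub>i\<close> and \<open>V\<^bsub>i+1\<^esub>\<close> of \<open>K\<^sup>l\<close>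
  (indices modulo \<open>k\<close>), where \<open>V\<^sub>i\<close> is placed at the source of \<open>b ! i\<close>. The Jordan block
  is put on the last syllable, which is direct. Another choice of the syllable yields an isomorphic
  module, except that \<open>lam\<close> becomes its inverse if an inverse syllable is chosen.
\<close>

definition band_matrix :: "'a syllable list \<Rightarrow> nat \<Rightarrow> 'k :: field \<Rightarrow> nat \<Rightarrow> 'k mat" where
  "band_matrix b l lam i = (if Suc i = length b then jordan_block l lam else 1\<^sub>m l)"

text \<open>The component \<open>V\<^sub>q \<rightarrow> V\<^sub>p\<close> of the arrow \<open>a\<close>.\<close>

definition band_component ::
  "'a syllable list \<Rightarrow> nat \<Rightarrow> 'k :: field \<Rightarrow> 'a \<Rightarrow> nat \<Rightarrow> nat \<Rightarrow> 'k mat" where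
  "band_component b l lam a q p =
     (if b ! q = Dir a \<and> p = Suc q mod length b then band_matrix b l lam q
      else if b ! p = Inv a \<and> q = Suc p mod length b then band_matrix b l lam p
      else 0\<^sub>m l l)"

text \<open>The space at \<open>v\<close> is the direct sum of the \<open>V\<^sub>j\<close> with \<open>j\<close> in the following list.\<close>

definition band_positions :: "('v, 'a) pre_digraph \<Rightarrow> 'a syllable list \<Rightarrow> 'v \<Rightarrow> nat list" where
  "band_positions Q b v = filter (\<lambda>j. syl_src Q (b ! j) = v) [0..<length b]"

definition band_module ::
  "('v, 'a) pre_digraph \<Rightarrow> 'a syllable list \<Rightarrow> nat \<Rightarrow> 'k :: field \<Rightarrow> ('v, 'a, 'k) rep" where
  "band_module Q b l lam =
     \<lparr>rdim = (\<lambda>v. length (band_positions Q b v) * l),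
      rmat = (\<lambda>a. let qs = band_positions Q b (tail Q a); ps = band_positions Q b (head Q a) in
        mat (length ps * l) (length qs * l)
          (\<lambda>(x, y). band_component b l lam a (qs ! (y div l)) (ps ! (x div l)) $$ (x mod l, y mod l)))\<rparr>"

definition is_band_module ::
  "('v, 'a) pre_digraph \<Rightarrow> 'a list set \<Rightarrow> ('v, 'a, 'k :: field) rep \<Rightarrow> bool" where
  "is_band_module Q \<rho> M \<longleftrightarrow>
     (\<exists>b l lam. is_band Q \<rho> b \<and> l > 0 \<and> lam \<noteq> 0 \<and> rep_iso Q M (band_module Q b l lam))"

text \<open>
  As usual, being a direct sum is meant up to isomorphism.
\<close>

definition is_band_semibrick ::
  "('v, 'a) pre_digraph \<Rightarrow> 'a list set \<Rightarrow> ('v, 'a, 'k :: field) rep \<Rightarrow> bool" where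
  "is_band_semibrick Q \<rho> S \<longleftrightarrow> (\<exists>Bs. rep_iso Q S (rep_sum Bs) \<and>
     (\<forall>B\<in>set Bs. is_brick Q \<rho> B \<and> is_band_module Q \<rho> B) \<and>
     (\<forall>i<length Bs. \<forall>j<length Bs. i \<noteq> j \<longrightarrow>
        (\<forall>f\<in>rep_hom Q (Bs ! i) (Bs ! j). f = rep_zero Q (Bs ! i) (Bs ! j))))"

section \<open>The ordered alphabet and traces\<close>

type_synonym 'v letter = "'v \<times> int"

primrec syl_sgn_src :: "('a \<Rightarrow> int) \<Rightarrow> ('a \<Rightarrow> int) \<Rightarrow> 'a syllable \<Rightarrow> int" where
  "syl_sgn_src \<sigma> \<epsilon> (Dir a) = \<sigma> a"
| "syl_sgn_src \<sigma> \<epsilon> (Inv a) = \<epsilon> a"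

primrec syl_sgn_tgt :: "('a \<Rightarrow> int) \<Rightarrow> ('a \<Rightarrow> int) \<Rightarrow> 'a syllable \<Rightarrow> int" where
  "syl_sgn_tgt \<sigma> \<epsilon> (Dir a) = \<epsilon> a"
| "syl_sgn_tgt \<sigma> \<epsilon> (Inv a) = \<sigma> a"

definition letter_src ::
  "('v, 'a) pre_digraph \<Rightarrow> ('a \<Rightarrow> int) \<Rightarrow> ('a \<Rightarrow> int) \<Rightarrow> 'a syllable \<Rightarrow> 'v letter" where
  "letter_src Q \<sigma> \<epsilon> x = (syl_src Q x, - syl_sgn_src \<sigma> \<epsilon> x)"

definition letter_tgt ::
  "('v, 'a) pre_digraph \<Rightarrow> ('a \<Rightarrow> int) \<Rightarrow> ('a \<Rightarrow> int) \<Rightarrow> 'a syllable \<Rightarrow> 'v letter" where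
  "letter_tgt Q \<sigma> \<epsilon> x = (syl_tgt Q x, syl_sgn_tgt \<sigma> \<epsilon> x)"

definition letter_less ::
  "('v, 'a) pre_digraph \<Rightarrow> ('a \<Rightarrow> int) \<Rightarrow> ('a \<Rightarrow> int) \<Rightarrow> 'v letter \<Rightarrow> 'v letter \<Rightarrow> bool" where
  "letter_less Q \<sigma> \<epsilon> = tranclp (\<lambda>p q. \<exists>a\<in>arcs Q.
     letter_src Q \<sigma> \<epsilon> (Dir a) = q \<and> letter_tgt Q \<sigma> \<epsilon> (Dir a) = p \<or>
     letter_src Q \<sigma> \<epsilon> (Inv a) = p \<and> letter_tgt Q \<sigma> \<epsilon> (Inv a) = q)"

definition homogeneous :: "'a syllable list \<Rightarrow> bool" where
  "homogeneous z \<longleftrightarrow> (\<forall>x\<in>set z. is_direct x) \<or> (\<forall>x\<in>set z. \<not> is_direct x)"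

definition connects :: "('v, 'a) pre_digraph \<Rightarrow> 'a list set \<Rightarrow> ('a \<Rightarrow> int) \<Rightarrow> ('a \<Rightarrow> int) \<Rightarrow>
    'v letter \<Rightarrow> 'v letter \<Rightarrow> 'a syllable list \<Rightarrow> bool" where
  "connects Q \<rho> \<sigma> \<epsilon> p q z \<longleftrightarrow> is_string Q \<rho> z \<and> homogeneous z \<and>
     letter_src Q \<sigma> \<epsilon> (hd z) = p \<and> letter_tgt Q \<sigma> \<epsilon> (last z) = q"

text \<open>For an acyclic signed string algebra, at most one string connects given letters.\<close>

definition letter_trace :: "('v, 'a) pre_digraph \<Rightarrow> 'a list set \<Rightarrow> ('a \<Rightarrow> int) \<Rightarrow> ('a \<Rightarrow> int) \<Rightarrow>
    'v letter \<Rightarrow> 'v letter \<Rightarrow> 'v letter list" where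
  "letter_trace Q \<rho> \<sigma> \<epsilon> p q = (if \<exists>z. connects Q \<rho> \<sigma> \<epsilon> p q z
     then p # map (letter_src Q \<sigma> \<epsilon>) (tl (THE z. connects Q \<rho> \<sigma> \<epsilon> p q z)) @ [q] else [])"

section \<open>The word of a band\<close>

text \<open>
  \<open>runs b\<close> is the decomposition \<open>[x\<^sub>1, \<dots>, x\<^sub>k]\<close> of \<open>b\<close> into maximal homogeneous pieces. The
  lemmas below show that it is the unique decomposition with the required properties.
\<close>

fun runs :: "'a syllable list \<Rightarrow> 'a syllable list list" where
  "runs [] = []"
| "runs [x] = [[x]]"
| "runs (x # y # w) = (if is_direct x = is_direct y
     then (x # hd (runs (y # w))) # tl (runs (y # w)) else [x] # runs (y # w))"

definition is_run_decomposition :: "'a syllable list \<Rightarrow> 'a syllable list list \<Rightarrow> bool" where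
  "is_run_decomposition w xs \<longleftrightarrow> concat xs = w \<and> (\<forall>x\<in>set xs. x \<noteq> [] \<and> homogeneous x) \<and>
     (\<forall>i. Suc i < length xs \<longrightarrow> is_direct (hd (xs ! i)) \<noteq> is_direct (hd (xs ! Suc i)))"

lemma runs_Cons_nonempty: "runs (x # w) \<noteq> [] \<and> hd (runs (x # w)) \<noteq> [] \<and> hd (hd (runs (x # w))) = x"
  by (induction w arbitrary: x) auto

lemma is_run_decomposition_runs: "is_run_decomposition w (runs w)"
proof (induction w rule: runs.induct)
  case 1
  then show ?case by (simp add: is_run_decomposition_def)
next
  case (2 x)
  then show ?case by (simp add: is_run_decomposition_def homogeneous_def)
next
  case (3 x y w)
  obtain r rs where r: "runs (y # w) = r # rs" "r \<noteq> []" "hd r = y"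
    using runs_Cons_nonempty[of y w] by (cases "runs (y # w)") auto
  have IH: "is_run_decomposition (y # w) (r # rs)"
    using 3 r by (cases "is_direct x = is_direct y") auto
  have y: "y \<in> set r" using r by (metis hd_in_set)
  show ?case
  proof (cases "is_direct x = is_direct y")
    case True
    have "homogeneous (x # r)"
      using IH y True unfolding is_run_decomposition_def homogeneous_def by auto
    moreover have "is_direct (hd (((x # r) # rs) ! i)) \<noteq> is_direct (hd (((x # r) # rs) ! Suc i))"
      if "Suc i < length ((x # r) # rs)" for i
      using IH that True r unfolding is_run_decomposition_def by (cases i) auto
    ultimately show ?thesis
      using IH True r unfolding is_run_decomposition_def by simp
  next
    case False
    have "is_direct (hd (([x] # r # rs) ! i)) \<noteq> is_direct (hd (([x] # r # rs) ! Suc i))"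
      if "Suc i < length ([x] # r # rs)" for i
      using IH that False r unfolding is_run_decomposition_def by (cases i) auto
    then show ?thesis
      using IH False r unfolding is_run_decomposition_def homogeneous_def by simp
  qed
qed

lemma is_run_decomposition_ConsD:
  assumes "is_run_decomposition w (u # us)"
  shows "is_run_decomposition (concat us) us" "u \<noteq> []"
    "u = takeWhile (\<lambda>x. is_direct x = is_direct (hd w)) w"
proof -
  have alt: "is_direct (hd ((u # us) ! i)) \<noteq> is_direct (hd ((u # us) ! Suc i))"
    if "Suc i < length (u # us)" for i
    using assms that unfolding is_run_decomposition_def by blast
  show "is_run_decomposition (concat us) us"
    using assms alt[of "Suc i" for i] unfolding is_run_decomposition_def by auto
  show u: "u \<noteq> []"
    using assms unfolding is_run_decomposition_def by simp
  have w: "w = u @ concat us" and hom: "homogeneous u"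
    using assms unfolding is_run_decomposition_def by auto
  have all: "\<forall>x\<in>set u. is_direct x = is_direct (hd w)"
    using hom hd_in_set[OF u] hd_append2[OF u, of "concat us"] w unfolding homogeneous_def by auto
  have "takeWhile (\<lambda>x. is_direct x = is_direct (hd w)) (concat us) = []"
  proof (cases us)
    case (Cons v vs)
    have "v \<noteq> []" using assms Cons unfolding is_run_decomposition_def by simp
    moreover have "is_direct (hd u) \<noteq> is_direct (hd v)" using alt[of 0] Cons by simp
    ultimately show ?thesis using Cons u w by (cases v) auto
  qed simp
  then show "u = takeWhile (\<lambda>x. is_direct x = is_direct (hd w)) w"
    using all takeWhile_append2[of u "\<lambda>x. is_direct x = is_direct (hd w)" "concat us"] w by auto
qed

lemma is_run_decomposition_unique:
  "is_run_decomposition w xs \<Longrightarrow> is_run_decomposition w ys \<Longrightarrow> xs = ys"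
proof (induction xs arbitrary: w ys)
  case Nil
  then show ?case by (cases ys) (auto simp: is_run_decomposition_def)
next
  case (Cons x xs)
  have "w \<noteq> []" using Cons.prems(1) by (auto simp: is_run_decomposition_def)
  then obtain y ys' where ys: "ys = y # ys'"
    using Cons.prems(2) by (cases ys) (auto simp: is_run_decomposition_def)
  have xy: "x = y"
    using is_run_decomposition_ConsD(3)[OF Cons.prems(1)]
      is_run_decomposition_ConsD(3)[of w y ys'] Cons.prems(2) ys by simp
  moreover have "concat xs = concat ys'"
    using Cons.prems xy ys by (auto simp: is_run_decomposition_def)
  ultimately show ?case
    using Cons.IH[of "concat ys'" ys'] is_run_decomposition_ConsD(1)[OF Cons.prems(1)]
      is_run_decomposition_ConsD(1)[of w y ys'] Cons.prems(2) ys by simp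
qed

definition band_word :: "('v, 'a) pre_digraph \<Rightarrow> ('a \<Rightarrow> int) \<Rightarrow> ('a \<Rightarrow> int) \<Rightarrow>
    'a syllable list \<Rightarrow> 'v letter list" where
  "band_word Q \<sigma> \<epsilon> b = map (\<lambda>x. letter_src Q \<sigma> \<epsilon> (hd x)) (runs b)"

section \<open>Weakly perfectly clustering pairs\<close>

definition is_zigzag :: "('b \<Rightarrow> 'b \<Rightarrow> bool) \<Rightarrow> 'b list \<Rightarrow> bool" where
  "is_zigzag lt w \<longleftrightarrow>
     (\<forall>i. Suc i < length w \<longrightarrow> (if even i then lt (w ! i) (w ! Suc i) else lt (w ! Suc i) (w ! i))) \<or>
     (\<forall>i. Suc i < length w \<longrightarrow> (if odd i then lt (w ! i) (w ! Suc i) else lt (w ! Suc i) (w ! i)))"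

definition is_crown :: "('b \<Rightarrow> 'b \<Rightarrow> bool) \<Rightarrow> 'b list \<Rightarrow> bool" where
  "is_crown lt w \<longleftrightarrow> (\<forall>r. is_zigzag lt (rotate r w))"

definition weakly_perfectly_clustering :: "('v, 'a) pre_digraph \<Rightarrow> 'a list set \<Rightarrow>
    ('a \<Rightarrow> int) \<Rightarrow> ('a \<Rightarrow> int) \<Rightarrow> 'v letter list \<Rightarrow> 'v letter list \<Rightarrow> bool" where
  "weakly_perfectly_clustering Q \<rho> \<sigma> \<epsilon> w1 w2 \<longleftrightarrow>
     (let lt = letter_less Q \<sigma> \<epsilon>;
          P1 = list_power w1 (2 * length w2);
          P2 = list_power w2 (2 * length w1) in
      is_crown lt w1 \<and> is_crown lt w2 \<and>
      \<not> (\<exists>r1 r2 n1 m1 n2 m2 z z1 z2.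
           rotate r1 P1 = [n1] @ z @ [m1] @ z1 \<and> rotate r2 P2 = [n2] @ z @ [m2] @ z2 \<and>
           lt n1 n2 \<and> lt m1 m2 \<and> length z \<ge> 1) \<and>
      \<not> (\<exists>r1 r2 n1 m1 n2 m2 z1 z2.
           rotate r1 P1 = [n1] @ [m1] @ z1 \<and> rotate r2 P2 = [n2] @ [m2] @ z2 \<and>
           lt n1 n2 \<and> lt m1 m2 \<and> (lt n1 m1 \<longleftrightarrow> lt n2 m2) \<and>
           set (letter_trace Q \<rho> \<sigma> \<epsilon> n1 m1) \<inter> set (letter_trace Q \<rho> \<sigma> \<epsilon> n2 m2) \<noteq> {}))"

end

theory Submission
  imports Defs
begin

text \<open>
  A band is unrolled to a line, a bi-infinite periodic sequence of syllables. Morphisms between two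
  band modules with one-dimensional components are then periodic (up to the parameters) functions
  on pairs of positions, and the commutation relations say that such a function is constant along
  common substrings of the two lines and vanishes unless the common substring ends, on both sides,
  with the first line continuing down and the second one up, or unless the lines agree everywhere.
  The first case is a graph map, and it is exactly what the two forbidden configurations of words
  describe; the second one only occurs between isomorphic modules.

  For the converse, a band semibrick has an endomorphism algebra without nilpotent elements. A
  Jordan block of size at least two gives a nilpotent endomorphism, and so does a graph map: this
  is clear between different summands, and a graph map from a summand to itself strictly increases
  positions in a lexicographic order.
\<close>

section \<open>Strings and letters\<close>

text \<open>The semibrick property only provides some decomposition into bricks, with no stated
  relation to the given band modules. Instead of comparing two decompositions by Krull-Schmidt, the
  proof uses that the absence of non-zero square-zero endomorphisms is invariant under isomorphism
  and, for any decomposition, equivalent to the same property of every summand together with the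
  vanishing of all morphisms between different summands. So it can be established for one
  decomposition and read off from the other. For a single summand the obstacle is that the square of
  a graph map need not vanish and that graph maps may reverse the orientation. Hence the order
  compares unoriented positions: two graph pairs compose after reorienting the second one. A vertex
  alone does not fix how a line passes through it; the sign in a letter does, up to reversal. Equal
  letters line up two lines in one orientation, opposite letters in the reverse one. This is why a
  band is tested together with its inverse.\<close>

lemma syl_inv_syl_inv [simp]: "syl_inv (syl_inv x) = x"
  by (cases x) auto

lemma syl_arc_syl_inv [simp]: "syl_arc (syl_inv x) = syl_arc x"
  by (cases x) auto

lemma is_direct_syl_inv [simp]: "is_direct (syl_inv x) \<longleftrightarrow> \<not> is_direct x"
  by (cases x) auto

lemma syl_inv_eq_iff [simp]: "syl_inv x = syl_inv y \<longleftrightarrow> x = y"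
  by (metis syl_inv_syl_inv)

lemma str_inv_str_inv [simp]: "str_inv (str_inv w) = w"
  by (simp add: str_inv_def rev_map comp_def)

lemma str_inv_append: "str_inv (v @ w) = str_inv w @ str_inv v"
  by (simp add: str_inv_def)

lemma sublist_str_inv: "sublist u (str_inv w) \<longleftrightarrow> sublist (str_inv u) w"
  unfolding sublist_def by (metis str_inv_append str_inv_str_inv append_assoc)

lemma length_str_inv [simp]: "length (str_inv w) = length w"
  by (simp add: str_inv_def)

lemma set_str_inv [simp]: "set (str_inv w) = syl_inv ` set w"
  by (simp add: str_inv_def)

lemma str_inv_Nil_iff [simp]: "str_inv w = [] \<longleftrightarrow> w = []"
  by (simp add: str_inv_def)

lemma nth_str_inv: "i < length w \<Longrightarrow> str_inv w ! i = syl_inv (w ! (length w - Suc i))"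
  by (simp add: str_inv_def rev_nth)

lemma syl_src_syl_inv [simp]: "syl_src Q (syl_inv x) = syl_tgt Q x"
  by (cases x) auto

lemma syl_tgt_syl_inv [simp]: "syl_tgt Q (syl_inv x) = syl_src Q x"
  by (cases x) auto

lemma is_stringD:
  assumes "is_string Q \<rho> w"
  shows "w \<noteq> []" "x \<in> set w \<Longrightarrow> syl_arc x \<in> arcs Q"
    "Suc i < length w \<Longrightarrow> syl_tgt Q (w ! i) = syl_src Q (w ! Suc i)"
    "Suc i < length w \<Longrightarrow> w ! i \<noteq> syl_inv (w ! Suc i)"
    "sublist u w \<Longrightarrow> u \<notin> map Dir ` \<rho>"
    "sublist u w \<Longrightarrow> str_inv u \<notin> map Dir ` \<rho>"
  using assms by (simp_all add: is_string_def image_subset_iff)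

lemma is_string_sublist:
  assumes "is_string Q \<rho> w" "sublist u w" "u \<noteq> []"
  shows "is_string Q \<rho> u"
proof -
  obtain ps ss where w: "w = ps @ u @ ss" using assms(2) by (auto simp: sublist_def)
  have "syl_tgt Q (u ! i) = syl_src Q (u ! Suc i) \<and> u ! i \<noteq> syl_inv (u ! Suc i)"
    if "Suc i < length u" for i
  proof -
    have "u ! i = w ! (length ps + i)" "u ! Suc i = w ! Suc (length ps + i)"
      using that w by (auto simp: nth_append)
    moreover have "Suc (length ps + i) < length w" using that w by simp
    ultimately show ?thesis using assms(1) unfolding is_string_def by simp
  qed
  moreover have "sublist v w" if "sublist v u" for v
    using assms(2) that sublist_order.order_trans by blast
  moreover have "syl_arc ` set u \<subseteq> arcs Q"
    using assms(1) set_mono_sublist[OF assms(2)] unfolding is_string_def by blast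
  ultimately show ?thesis
    using assms(1,3) unfolding is_string_def by simp
qed

lemma is_string_str_inv:
  assumes "is_string Q \<rho> w"
  shows "is_string Q \<rho> (str_inv w)"
proof -
  have 1: "syl_tgt Q (str_inv w ! i) = syl_src Q (str_inv w ! Suc i) \<and>
      str_inv w ! i \<noteq> syl_inv (str_inv w ! Suc i)"
    if i: "Suc i < length w" for i
  proof -
    define j where "j = length w - Suc (Suc i)"
    have "Suc j < length w" "length w - Suc i = Suc j" using i by (auto simp: j_def)
    moreover have "syl_tgt Q (w ! j) = syl_src Q (w ! Suc j)" "w ! j \<noteq> syl_inv (w ! Suc j)"
      using assms \<open>Suc j < length w\<close> unfolding is_string_def by auto
    ultimately show ?thesis using i by (auto simp: nth_str_inv j_def[symmetric])
  qed
  have 2: "u \<notin> map Dir ` \<rho> \<and> str_inv u \<notin> map Dir ` \<rho>" if "sublist u (str_inv w)" for u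
    using assms that unfolding is_string_def sublist_str_inv by (metis str_inv_str_inv)
  show ?thesis using assms 1 2 unfolding is_string_def by (auto simp: image_image)
qed

section \<open>Letters, their negation and their order\<close>

definition letter_neg :: "'v letter \<Rightarrow> 'v letter" where
  "letter_neg p = (fst p, - snd p)"

lemma letter_neg_letter_neg [simp]: "letter_neg (letter_neg p) = p"
  by (simp add: letter_neg_def)

lemma letter_neg_eq_iff [simp]: "letter_neg p = letter_neg q \<longleftrightarrow> p = q"
  by (metis letter_neg_letter_neg)

lemma fst_letter_neg [simp]: "fst (letter_neg p) = fst p"
  by (simp add: letter_neg_def)

lemma letter_src_syl_inv [simp]: "letter_src Q \<sigma> \<epsilon> (syl_inv x) = letter_neg (letter_tgt Q \<sigma> \<epsilon> x)"
  by (cases x) (auto simp: letter_src_def letter_tgt_def letter_neg_def)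

lemma letter_tgt_syl_inv [simp]: "letter_tgt Q \<sigma> \<epsilon> (syl_inv x) = letter_neg (letter_src Q \<sigma> \<epsilon> x)"
  by (cases x) (auto simp: letter_src_def letter_tgt_def letter_neg_def)

lemma letter_less_trans:
  "letter_less Q \<sigma> \<epsilon> p q \<Longrightarrow> letter_less Q \<sigma> \<epsilon> q r \<Longrightarrow> letter_less Q \<sigma> \<epsilon> p r"
  unfolding letter_less_def by (rule tranclp_trans)

text \<open>Every arrow contributes two generating relations, one from its direct and one from its
  inverse syllable, and negating signs exchanges them.\<close>

lemma letter_less_neg:
  assumes "letter_less Q \<sigma> \<epsilon> p q"
  shows "letter_less Q \<sigma> \<epsilon> (letter_neg p) (letter_neg q)"
proof -
  define R where "R = (\<lambda>p q. \<exists>a\<in>arcs Q.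
     letter_src Q \<sigma> \<epsilon> (Dir a) = q \<and> letter_tgt Q \<sigma> \<epsilon> (Dir a) = p \<or>
     letter_src Q \<sigma> \<epsilon> (Inv a) = p \<and> letter_tgt Q \<sigma> \<epsilon> (Inv a) = q)"
  have R: "R (letter_neg p) (letter_neg q)" if "R p q" for p q
    using that unfolding R_def letter_neg_def letter_src_def letter_tgt_def by force
  have "R\<^sup>+\<^sup>+ (letter_neg p) (letter_neg q)" if "R\<^sup>+\<^sup>+ p q" for p q
    using that
  proof (induction rule: tranclp_induct)
    case (base q)
    then show ?case using R by blast
  next
    case (step q r)
    then show ?case using R by (meson tranclp.trancl_into_trancl)
  qed
  then show ?thesis using assms unfolding letter_less_def R_def by blast
qed

lemma letter_less_neg_iff [simp]:
  "letter_less Q \<sigma> \<epsilon> (letter_neg p) (letter_neg q) \<longleftrightarrow> letter_less Q \<sigma> \<epsilon> p q"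
  using letter_less_neg[of Q \<sigma> \<epsilon> p q] letter_less_neg[of Q \<sigma> \<epsilon> "letter_neg p" "letter_neg q"]
      by auto

lemma letter_less_step:
  assumes "syl_arc x \<in> arcs Q"
  shows "\<not> is_direct x \<Longrightarrow> letter_less Q \<sigma> \<epsilon> (letter_src Q \<sigma> \<epsilon> x) (letter_tgt Q \<sigma> \<epsilon> x)"
    and "is_direct x \<Longrightarrow> letter_less Q \<sigma> \<epsilon> (letter_tgt Q \<sigma> \<epsilon> x) (letter_src Q \<sigma> \<epsilon> x)"
  unfolding letter_less_def
  by (rule tranclp.r_into_trancl, use assms in \<open>cases x; auto\<close>)+

text \<open>A generating step p < q comes from an arrow out of the vertex of q into that of p, so
  chains become walks. With an acyclic quiver this makes the order irreflexive.\<close>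

lemma (in wf_digraph) letter_less_imp_awalk:
  assumes "letter_less G \<sigma> \<epsilon> p q"
  shows "\<exists>w. awalk (fst q) w (fst p) \<and> w \<noteq> []"
proof -
  have *: "\<exists>w. awalk (fst q) w (fst p) \<and> w \<noteq> []"
    if edge: "\<exists>a\<in>arcs G. letter_src G \<sigma> \<epsilon> (Dir a) = q \<and> letter_tgt G \<sigma> \<epsilon> (Dir a) = p \<or>
     letter_src G \<sigma> \<epsilon> (Inv a) = p \<and> letter_tgt G \<sigma> \<epsilon> (Inv a) = q" for p q :: "'a letter"
  proof -
    obtain a where "a \<in> arcs G" "tail G a = fst q" "head G a = fst p"
      using edge by (auto simp: letter_src_def letter_tgt_def)
    then show ?thesis by (metis arc_implies_awalk not_Cons_self2)
  qed
  show ?thesis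
    using assms unfolding letter_less_def
  proof (induction rule: tranclp_induct)
    case (base q)
    then show ?case using * by blast
  next
    case (step q r)
    obtain w where w: "awalk (fst q) w (fst p)" "w \<noteq> []" using step.IH by blast
    obtain u where u: "awalk (fst r) u (fst q)" "u \<noteq> []" using *[OF step.hyps(2)] by blast
    have "awalk (fst r) (u @ w) (fst p)" using u(1) w(1) by (rule awalk_appendI)
    then show ?case using u by blast
  qed
qed

locale acyclic_string_algebra = signed_string_algebra +
  assumes acyclic: "acyclic_quiver Q"
begin

abbreviation src where "src \<equiv> letter_src Q \<sigma> \<epsilon>"
abbreviation tgt where "tgt \<equiv> letter_tgt Q \<sigma> \<epsilon>"
abbreviation less (infix "\<prec>" 50) where "less \<equiv> letter_less Q \<sigma> \<epsilon>"

lemma less_irrefl [simp]: "\<not> p \<prec> p"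
proof
  assume "p \<prec> p"
  then obtain w where "awalk (fst p) w (fst p)" "w \<noteq> []"
    using letter_less_imp_awalk by blast
  then show False
    using closed_w_imp_cycle acyclic unfolding closed_w_def acyclic_quiver_def by auto
qed

lemma less_asym: "p \<prec> q \<Longrightarrow> \<not> q \<prec> p"
  using letter_less_trans less_irrefl by metis

text \<open>The sign conventions are made for this: the letter at a junction of two syllables can be
  read off from either side. The cases use \<open>sign_composable\<close> when both syllables point
  the same way, and the exclusion of backtracking when they do not.\<close>

lemma string_letter_composable:
  assumes "is_string Q \<rho> [x, y]"
  shows "tgt x = src y"
proof -
  have "sublist [x, y] [x, y]" by simp
  then have r: "[x, y] \<notin> map Dir ` \<rho>" "str_inv [x, y] \<notin> map Dir ` \<rho>"
    using is_stringD(5,6)[OF assms] by simp_all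
  have e: "syl_tgt Q x = syl_src Q y" "x \<noteq> syl_inv y"
    using is_stringD(3,4)[OF assms, of 0] by simp_all
  have arcs: "syl_arc x \<in> arcs Q" "syl_arc y \<in> arcs Q"
    using is_stringD(2)[OF assms] by simp_all
  show ?thesis
  proof (cases x; cases y)
    fix a b assume xy: "x = Dir a" "y = Dir b"
    then have "[a, b] \<notin> \<rho>" using r(1) by force
    then show ?thesis using sign_composable[of b a] xy e arcs
      by (auto simp: letter_src_def letter_tgt_def)
  next
    fix a b assume "x = Dir a" "y = Inv b"
    then show ?thesis using sign_target[of a b] e arcs
      by (auto simp: letter_src_def letter_tgt_def)
  next
    fix a b assume "x = Inv a" "y = Dir b"
    then show ?thesis using sign_source[of a b] e arcs
      by (auto simp: letter_src_def letter_tgt_def)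
  next
    fix a b assume xy: "x = Inv a" "y = Inv b"
    then have "[b, a] \<notin> \<rho>" using r(2) by (force simp: str_inv_def)
    then show ?thesis using sign_composable[of a b] xy e arcs
      by (auto simp: letter_src_def letter_tgt_def)
  qed
qed

text \<open>A source letter leaves one syllable for each direction, since two distinct ones would
  have opposite signs. Hence one letter and the sequence of directions determine how a line
  continues.\<close>

lemma letter_src_inj:
  assumes "syl_arc x \<in> arcs Q" "syl_arc y \<in> arcs Q" "src x = src y" "is_direct x = is_direct y"
  shows "x = y"
proof (cases x; cases y)
  fix a b assume xy: "x = Dir a" "y = Dir b"
  have "\<sigma> a \<noteq> 0" using sign_values[of a] assms xy by auto
  then show ?thesis using xy assms sign_source[of a b] by (auto simp: letter_src_def)
next
  fix a b assume xy: "x = Inv a" "y = Inv b"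
  have "\<epsilon> a \<noteq> 0" using sign_values[of a] assms xy by auto
  then show ?thesis using xy assms sign_target[of a b] by (auto simp: letter_src_def)
qed (use assms in auto)

lemma letter_src_neq_neg:
  assumes "syl_arc x \<in> arcs Q"
  shows "src x \<noteq> letter_neg (src x)"
  using assms sign_values[of "syl_arc x"] by (cases x) (auto simp: letter_src_def letter_neg_def)

end

section \<open>Lines and graph pairs\<close>

text \<open>Positions are the junctions between syllables: \<open>s t\<close> runs from position t
  to position t + 1. Reversal sends position t to - t, hence the syllable index t to - 1 -
  t.\<close>

definition flip :: "(int \<Rightarrow> 'a syllable) \<Rightarrow> int \<Rightarrow> 'a syllable" where
  "flip s t = syl_inv (s (- 1 - t))"

lemma flip_flip [simp]: "flip (flip s) = s"
  by (simp add: flip_def fun_eq_iff)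

definition turning :: "(int \<Rightarrow> 'a syllable) \<Rightarrow> int \<Rightarrow> bool" where
  "turning s t \<longleftrightarrow> is_direct (s (t - 1)) \<noteq> is_direct (s t)"

lemma turning_flip [simp]: "turning (flip s) t \<longleftrightarrow> turning s (- t)"
proof -
  have eqs: "- 1 - (t - 1) = - t" "- 1 - t = - t - 1" by auto
  show ?thesis unfolding turning_def flip_def eqs by auto
qed

definition enumerates_turning :: "(int \<Rightarrow> int) \<Rightarrow> (int \<Rightarrow> 'a syllable) \<Rightarrow> bool" where
  "enumerates_turning T s \<longleftrightarrow> strict_mono T \<and> range T = {t. turning s t}"

lemma enumerates_turning_flip:
  assumes "enumerates_turning T s"
  shows "enumerates_turning (\<lambda>i. - T (- i)) (flip s)"
proof -
  have "strict_mono (\<lambda>i. - T (- i))"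
    using assms unfolding enumerates_turning_def strict_mono_def by simp
  moreover have "t \<in> range (\<lambda>i. - T (- i)) \<longleftrightarrow> - t \<in> range T" for t
    by (metis (no_types, lifting) minus_minus rangeE rangeI)
  ultimately show ?thesis
    using assms unfolding enumerates_turning_def by auto
qed

text \<open>A strict lexicographic comparison of two right-infinite words, a direct syllable
  counting as smaller than an inverse one. The first line goes down where the second goes up, so
  towards this side the common part is a factor of the first module and a submodule of the
  second.\<close>

definition diverges :: "(int \<Rightarrow> 'a syllable) \<Rightarrow> int \<Rightarrow> (int \<Rightarrow> 'a syllable) \<Rightarrow> int \<Rightarrow> bool" where
  "diverges s x s' y \<longleftrightarrow> (\<exists>q::nat. (\<forall>t<q. s (x + int t) = s' (y + int t)) \<and>
     is_direct (s (x + int q)) \<and> \<not> is_direct (s' (y + int q)))"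

lemma divergesI:
  assumes "\<And>t. t < q \<Longrightarrow> s (x + int t) = s' (y + int t)"
    "is_direct (s (x + int q))" "\<not> is_direct (s' (y + int q))"
  shows "diverges s x s' y"
  using assms unfolding diverges_def by blast

lemma diverges_irrefl [simp]: "\<not> diverges s x s x"
  by (auto simp: diverges_def)

lemma diverges_trans:
  assumes "diverges s x s' y" "diverges s' y s'' z"
  shows "diverges s x s'' z"
proof -
  obtain q where q: "\<And>t. t < q \<Longrightarrow> s (x + int t) = s' (y + int t)"
    "is_direct (s (x + int q))" "\<not> is_direct (s' (y + int q))"
    using assms(1) unfolding diverges_def by blast
  obtain p where p: "\<And>t. t < p \<Longrightarrow> s' (y + int t) = s'' (z + int t)"
    "is_direct (s' (y + int p))" "\<not> is_direct (s'' (z + int p))"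
    using assms(2) unfolding diverges_def by blast
  show ?thesis
  proof (rule divergesI[where q = "min p q"])
    show "s (x + int t) = s'' (z + int t)" if "t < min p q" for t
      using that p(1) q(1) by simp
    show "is_direct (s (x + int (min p q)))"
      using p(2) q(1)[of p] q(2) by (cases "p < q") (auto simp: min_def)
    show "\<not> is_direct (s'' (z + int (min p q)))"
      using p(1)[of q] p(3) q(3) p(2) by (cases "p \<le> q") (auto simp: min_def)
  qed
qed

lemma diverges_prefix:
  assumes "\<And>t. t < n \<Longrightarrow> s (x + int t) = s' (y + int t)"
    and "diverges s (x + int n) s' (y + int n)"
  shows "diverges s x s' y"
proof -
  obtain q where q: "\<And>t. t < q \<Longrightarrow> s (x + int n + int t) = s' (y + int n + int t)"
    "is_direct (s (x + int n + int q))" "\<not> is_direct (s' (y + int n + int q))"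
    using assms(2) unfolding diverges_def by blast
  show ?thesis
  proof (rule divergesI[where q = "n + q"])
    show "s (x + int t) = s' (y + int t)" if "t < n + q" for t
    proof (cases "t < n")
      case True
      then show ?thesis using assms(1) by simp
    next
      case False
      then have "x + int t = x + int n + int (t - n)" "y + int t = y + int n + int (t - n)" by auto
      then show ?thesis using q(1)[of "t - n"] False that by simp
    qed
  qed (use q in \<open>simp_all add: add.assoc\<close>)
qed

lemma diverges_step:
  assumes "s x = s' y"
  shows "diverges s (x + 1) s' (y + 1) \<longleftrightarrow> diverges s x s' y"
proof
  show "diverges s x s' y" if "diverges s (x + 1) s' (y + 1)"
    using diverges_prefix[of 1 s x s' y] assms that by simp
next
  assume "diverges s x s' y"
  then obtain q where q: "\<And>t. t < q \<Longrightarrow> s (x + int t) = s' (y + int t)"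
    "is_direct (s (x + int q))" "\<not> is_direct (s' (y + int q))"
    unfolding diverges_def by blast
  from q(2,3) assms obtain p where p: "q = Suc p" by (cases q) auto
  show "diverges s (x + 1) s' (y + 1)"
    using q(1)[of "Suc t" for t] q(2,3) p by (intro divergesI[where q = p]) (auto simp: add.assoc)
qed

context acyclic_string_algebra
begin

definition line :: "(int \<Rightarrow> 'b syllable) \<Rightarrow> bool" where
  "line s \<longleftrightarrow> (\<forall>t n. n > 0 \<longrightarrow> is_string Q \<rho> (map (\<lambda>i. s (t + int i)) [0..<n]))"

lemma line_string: "line s \<Longrightarrow> n > 0 \<Longrightarrow> is_string Q \<rho> (map (\<lambda>i. s (t + int i)) [0..<n])"
  by (simp add: line_def)

lemma line_arc: "line s \<Longrightarrow> syl_arc (s t) \<in> arcs Q"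
  using is_stringD(2)[OF line_string[of s 1 t], of "s t"] by simp

lemma line_pair: "line s \<Longrightarrow> is_string Q \<rho> [s t, s (t + 1)]"
  using line_string[of s 2 t] by (simp add: numeral_2_eq_2)

lemma line_step: "line s \<Longrightarrow> tgt (s t) = src (s (t + 1))"
  using string_letter_composable line_pair by blast

lemma line_no_backtrack: "line s \<Longrightarrow> s t \<noteq> syl_inv (s (t + 1))"
  using is_stringD(4)[OF line_pair[of s t], of 0] by simp

lemma line_flip:
  assumes "line s"
  shows "line (flip s)"
  unfolding line_def
proof (intro allI impI)
  fix t and n :: nat
  assume n: "n > 0"
  have "map (\<lambda>i. flip s (t + int i)) [0..<n] = str_inv (map (\<lambda>i. s (- t - int n + int i)) [0..<n])"
  proof (rule nth_equalityI)
    fix i assume "i < length (map (\<lambda>i. flip s (t + int i)) [0..<n])"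
    then have i: "i < n" by simp
    then show "map (\<lambda>i. flip s (t + int i)) [0..<n] ! i =
        str_inv (map (\<lambda>i. s (- t - int n + int i)) [0..<n]) ! i"
      using i by (simp add: nth_str_inv flip_def algebra_simps)
  qed simp
  then show "is_string Q \<rho> (map (\<lambda>i. flip s (t + int i)) [0..<n])"
    using is_string_str_inv[OF line_string[OF assms n]] by simp
qed

lemma src_flip: "line s \<Longrightarrow> src (flip s t) = letter_neg (src (s (- t)))"
  using line_step[of s "- 1 - t"] by (simp add: flip_def)

lemma line_ascend:
  assumes "line s" "x < y" "\<And>t. x \<le> t \<Longrightarrow> t < y \<Longrightarrow> \<not> is_direct (s t)"
  shows "src (s x) \<prec> src (s y)"
proof -
  have step: "src (s t) \<prec> src (s (t + 1))" if "x \<le> t" "t < y" for t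
    using letter_less_step(1)[OF line_arc[OF assms(1), of t]] line_step[OF assms(1), of t]
      assms(3)[OF that] by metis
  have "y' \<le> y \<longrightarrow> src (s x) \<prec> src (s y')" if "x + 1 \<le> y'" for y'
    using that
  proof (induction rule: int_ge_induct)
    case base
    then show ?case using step[of x] by auto
  next
    case (step y')
    then show ?case using \<open>\<And>t. x \<le> t \<Longrightarrow> t < y \<Longrightarrow> src (s t) \<prec> src (s (t + 1))\<close>[of y']
        letter_less_trans by fastforce
  qed
  then show ?thesis using assms(2) by simp
qed

lemma line_descend:
  assumes "line s" "x < y" "\<And>t. x \<le> t \<Longrightarrow> t < y \<Longrightarrow> is_direct (s t)"
  shows "src (s y) \<prec> src (s x)"
proof -
  have "src (flip s (- y)) \<prec> src (flip s (- x))"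
    by (rule line_ascend[OF line_flip[OF assms(1)]]) (use assms in \<open>auto simp: flip_def\<close>)
  then show ?thesis using src_flip[OF assms(1)] by simp
qed

text \<open>Equal letters and directions give equal syllables by \<open>letter_src_inj\<close>;
  composability passes the equality of letters on to the next position.\<close>

lemma line_agree:
  assumes "line s" "line s'" "src (s x) = src (s' y)"
    and "\<forall>t<n. is_direct (s (x + int t)) = is_direct (s' (y + int t))"
  shows "\<forall>t<n. s (x + int t) = s' (y + int t)"
    and "src (s (x + int n)) = src (s' (y + int n))"
proof -
  have "src (s (x + int m)) = src (s' (y + int m)) \<and> (\<forall>t<m. s (x + int t) = s' (y + int t))"
    if "m \<le> n" for m
    using that
  proof (induction m)
    case 0
    then show ?case using assms(3) by simp
  next
    case (Suc m)
    then have "s (x + int m) = s' (y + int m)"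
      using letter_src_inj assms(4) line_arc assms(1,2) by auto
    then show ?case
      using Suc line_step[OF assms(1), of "x + int m"] line_step[OF assms(2), of "y + int m"]
      by (auto simp: less_Suc_eq algebra_simps)
  qed
  from this[of n] show "\<forall>t<n. s (x + int t) = s' (y + int t)"
    and "src (s (x + int n)) = src (s' (y + int n))" by auto
qed

end

text \<open>\<open>T\<close> numbers the turning positions by all integers; run i consists of the
  syllables from \<open>T i\<close> up to just before \<open>T (i + 1)\<close>. For an unrolled
  band, the letters at the turning positions are those of its word.\<close>

locale turning_line = acyclic_string_algebra +
  fixes s :: "int \<Rightarrow> 'b syllable" and T :: "int \<Rightarrow> int"
  assumes line: "line s" and turning: "enumerates_turning T s"
begin

lemma T_less_iff [simp]: "T i < T j \<longleftrightarrow> i < j"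
  using turning unfolding enumerates_turning_def by (simp add: strict_mono_less)

lemma T_le_iff [simp]: "T i \<le> T j \<longleftrightarrow> i \<le> j"
  using turning unfolding enumerates_turning_def by (simp add: strict_mono_less_eq)

lemma turning_T [simp]: "turning s (T i)"
  using turning unfolding enumerates_turning_def by blast

lemma turningE: assumes "turning s t" obtains i where "t = T i"
  using turning assms unfolding enumerates_turning_def by blast

lemma turning_line_flip: "turning_line Q \<rho> \<sigma> \<epsilon> (flip s) (\<lambda>i. - T (- i))"
  by unfold_locales (simp_all add: line_flip[OF line] enumerates_turning_flip[OF turning])

lemma run_direction:
  assumes "T i \<le> t" "t < T (i + 1)"
  shows "is_direct (s t) = is_direct (s (T i))"
proof -
  have "t < T (i + 1) \<longrightarrow> is_direct (s t) = is_direct (s (T i))"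
    using assms(1)
  proof (induction rule: int_ge_induct)
    case (step t)
    show ?case
    proof (intro impI)
      assume t: "t + 1 < T (i + 1)"
      have "\<not> turning s (t + 1)"
      proof
        assume "turning s (t + 1)"
        then obtain j where j: "t + 1 = T j" by (rule turningE)
        have "T i < T j" "T j < T (i + 1)" using j t step.hyps by linarith+
        then show False by simp
      qed
      then show "is_direct (s (t + 1)) = is_direct (s (T i))"
        using step t by (simp add: turning_def)
    qed
  qed simp
  then show ?thesis using assms(2) by simp
qed

lemma run_alternate: "is_direct (s (T (i + 1))) \<longleftrightarrow> \<not> is_direct (s (T i))"
proof -
  have "T i \<le> T (i + 1) - 1" using T_less_iff[of i "i + 1"] by linarith
  then have "is_direct (s (T (i + 1) - 1)) = is_direct (s (T i))"
    by (intro run_direction) auto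
  then show ?thesis using turning_T[of "i + 1"] unfolding turning_def by auto
qed

lemma run_ascend:
  assumes "\<not> is_direct (s (T i))" "T i \<le> x" "x < y" "y \<le> T (i + 1)"
  shows "src (s x) \<prec> src (s y)"
proof (rule line_ascend[OF line assms(3)])
  fix t assume "x \<le> t" "t < y"
  then have "is_direct (s t) = is_direct (s (T i))"
    using assms by (intro run_direction) auto
  then show "\<not> is_direct (s t)" using assms(1) by simp
qed

lemma run_descend:
  assumes "is_direct (s (T i))" "T i \<le> x" "x < y" "y \<le> T (i + 1)"
  shows "src (s y) \<prec> src (s x)"
proof (rule line_descend[OF line assms(3)])
  fix t assume "x \<le> t" "t < y"
  then have "is_direct (s t) = is_direct (s (T i))"
    using assms by (intro run_direction) auto
  then show "is_direct (s t)" using assms(1) by simp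
qed

lemma T_growth: "T i + int n \<le> T (i + int n)"
proof (induction n)
  case (Suc n)
  have "T (i + int n) < T (i + int (Suc n))" by simp
  then show ?case using Suc by linarith
qed simp

text \<open>\<open>T_growth\<close> makes \<open>T\<close> unbounded in both directions; the run
  containing x is the one before the first turning position beyond x.\<close>

lemma run_index: obtains i where "T i \<le> x" "x < T (i + 1)"
proof -
  define i0 where "i0 = - int (nat (T 0 - x))"
  have "T i0 + int (nat (T 0 - x)) \<le> T 0" using T_growth[of i0 "nat (T 0 - x)"]
      by (simp add: i0_def)
  then have i0: "T i0 \<le> x" by linarith
  have "x < T (i0 + int (nat (x - T i0) + 1))" using T_growth[of i0 "nat (x - T i0) + 1"] i0 by simp
  then have ex: "\<exists>n::nat. x < T (i0 + int n)" by blast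
  define n where "n = (LEAST n::nat. x < T (i0 + int n))"
  have n: "x < T (i0 + int n)" unfolding n_def using ex by (rule LeastI_ex)
  obtain m where m: "n = Suc m" using n i0 by (cases n) auto
  have "\<not> x < T (i0 + int m)" using not_less_Least[of m "\<lambda>n. x < T (i0 + int n)"] m n_def by simp
  then show thesis using that[of "i0 + int m"] n m by (simp add: add.commute add.left_commute)
qed

lemma turning_bound:
  assumes "turning s t" "T i < t"
  shows "T (i + 1) \<le> t"
proof -
  obtain j where "t = T j" using turningE[OF assms(1)] by blast
  then show ?thesis using assms(2) by simp
qed

end

context acyclic_string_algebra
begin

text \<open>The combinatorial form of a graph map: through x and y runs a common finite substring,
  at both ends of which the first line continues down and the second up. The condition on letters
  also covers a substring of length zero, where the two divergence conditions say nothing about the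
  vertex.\<close>

definition graph_pair :: "(int \<Rightarrow> 'b syllable) \<Rightarrow> (int \<Rightarrow> 'b syllable) \<Rightarrow> int \<Rightarrow> int \<Rightarrow> bool" where
  "graph_pair s s' x y \<longleftrightarrow> src (s x) = src (s' y) \<and> diverges s x s' y \<and>
     diverges (flip s) (- x) (flip s') (- y)"

lemma graph_pair_flip:
  assumes "line s" "line s'"
  shows "graph_pair (flip s) (flip s') (- x) (- y) \<longleftrightarrow> graph_pair s s' x y"
  using assms by (auto simp: graph_pair_def src_flip)

lemma graph_pair_trans: "graph_pair s s' x y \<Longrightarrow> graph_pair s' s'' y z \<Longrightarrow> graph_pair s s'' x z"
  unfolding graph_pair_def using diverges_trans by metis

lemma graph_pair_irrefl [simp]: "\<not> graph_pair s s x x"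
  by (simp add: graph_pair_def)

lemma graph_pair_step:
  assumes "line s" "line s'" "s x = s' y"
  shows "graph_pair s s' (x + 1) (y + 1) \<longleftrightarrow> graph_pair s s' x y"
proof -
  have "diverges (flip s) (- (x + 1) + 1) (flip s') (- (y + 1) + 1) \<longleftrightarrow>
      diverges (flip s) (- (x + 1)) (flip s') (- (y + 1))"
    using assms(3) by (intro diverges_step) (simp add: flip_def)
  moreover have "src (s (x + 1)) = src (s' (y + 1))"
    using line_step assms by metis
  ultimately show ?thesis
    using assms(3) diverges_step[of s x s' y] unfolding graph_pair_def by simp
qed

end

section \<open>Turning points\<close>

lemma is_direct_flip: "is_direct (flip s t) \<longleftrightarrow> \<not> is_direct (s (- 1 - t))"
  by (simp add: flip_def)

locale turning_line_pair = A: turning_line Q \<rho> \<sigma> \<epsilon> s T + B: turning_line Q \<rho> \<sigma> \<epsilon> s' T'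
  for Q :: "('a, 'b) pre_digraph" (structure) and \<rho> \<sigma> \<epsilon> s T s' T'
begin

lemma turning_line_pair_flip:
  "turning_line_pair Q \<rho> \<sigma> \<epsilon> (flip s) (\<lambda>i. - T (- i)) (flip s') (\<lambda>i. - T' (- i))"
  by (intro turning_line_pair.intro A.turning_line_flip B.turning_line_flip)

text \<open>Both runs have the same direction, so the lines agree until the shorter remaining run
  ends. On an ascending run this must be the run of \<open>s\<close>, since otherwise its end would
  lie above the end of the other one; on a descending run it must be the run of \<open>s'\<close>.
  Either way \<open>s\<close> is then direct and \<open>s'\<close> inverse.\<close>

lemma diverges_in_runs:
  assumes dir: "is_direct (s (T i)) = is_direct (s' (T' j))"
    and x: "T i \<le> x" "x \<le> T (i + 1)" and y: "T' j \<le> y" "y \<le> T' (j + 1)"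
    and eq: "A.src (s x) = A.src (s' y)"
    and less: "A.less (A.src (s (T (i + 1)))) (A.src (s' (T' (j + 1))))"
  shows "diverges s x s' y"
proof -
  define m where "m = nat (T (i + 1) - x)"
  define m' where "m' = nat (T' (j + 1) - y)"
  have m: "x + int m = T (i + 1)" and m': "y + int m' = T' (j + 1)"
    using x y by (auto simp: m_def m'_def)
  define n where "n = min m m'"
  have d: "is_direct (s (x + int t)) = is_direct (s (T i))" if "t < m" for t
    using that x m by (intro A.run_direction) auto
  have d': "is_direct (s' (y + int t)) = is_direct (s' (T' j))" if "t < m'" for t
    using that y m' by (intro B.run_direction) auto
  have "\<forall>t<n. is_direct (s (x + int t)) = is_direct (s' (y + int t))"
    using d d' dir by (simp add: n_def)
  note agree = A.line_agree[OF A.line B.line eq this]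
  have ne: "m \<noteq> m'"
    using agree(2) less m m' by (auto simp: n_def)
  show ?thesis
  proof (cases "is_direct (s (T i))")
    case False
    show ?thesis
    proof (cases "m < m'")
      case True
      then have "is_direct (s (x + int m))" "\<not> is_direct (s' (y + int m))"
        using d'[of m] False dir A.run_alternate[of i] m by auto
      then show ?thesis using agree(1) True by (intro divergesI[where q = m]) (auto simp: n_def)
    next
      case ge: False
      then have "A.less (A.src (s (x + int m'))) (A.src (s (T (i + 1))))"
        using False x m ne by (intro A.run_ascend) auto
      moreover have "n = m'" using ge by (simp add: n_def)
      ultimately show ?thesis using agree(2) less m' A.less_asym by metis
    qed
  next
    case True
    show ?thesis
    proof (cases "m' < m")
      case less_m: True
      then have "is_direct (s (x + int m'))" "\<not> is_direct (s' (y + int m'))"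
        using d[of m'] True dir B.run_alternate[of j] m' by auto
      then show ?thesis using agree(1) less_m by (intro divergesI[where q = m']) (auto simp: n_def)
    next
      case False
      then have "A.less (A.src (s' (T' (j + 1)))) (A.src (s' (y + int m)))"
        using True dir y m' ne by (intro B.run_descend) auto
      moreover have "n = m" using False by (simp add: n_def)
      ultimately show ?thesis using agree(2) less m A.less_asym by metis
    qed
  qed
qed

lemma T_Suc: "T i < T (i + 1)" "T' i < T' (i + 1)"
  by simp_all

lemma run_ascend_ends: "\<not> is_direct (s (T i)) \<Longrightarrow> A.less (A.src (s (T i))) (A.src (s (T (i + 1))))"
  "\<not> is_direct (s' (T' j)) \<Longrightarrow> A.less (A.src (s' (T' j))) (A.src (s' (T' (j + 1))))"
  by (simp_all add: A.run_ascend B.run_ascend)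

lemma run_descend_ends: "is_direct (s (T i)) \<Longrightarrow> A.less (A.src (s (T (i + 1)))) (A.src (s (T i)))"
  "is_direct (s' (T' j)) \<Longrightarrow> A.less (A.src (s' (T' (j + 1)))) (A.src (s' (T' j)))"
  by (simp_all add: A.run_descend B.run_descend)

text \<open>If the directions differ, \<open>s\<close> must be the descending line: otherwise the
  inequality of the end letters would make the two equal starting letters strictly ordered.\<close>

lemma diverges_at_turning:
  assumes eq: "A.src (s (T i)) = A.src (s' (T' j))"
    and less: "A.less (A.src (s (T (i + 1)))) (A.src (s' (T' (j + 1))))"
  shows "diverges s (T i) s' (T' j)"
proof (cases "is_direct (s (T i)) = is_direct (s' (T' j))")
  case True
  then show ?thesis using eq less by (intro diverges_in_runs) auto
next
  case False
  show ?thesis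
  proof (cases "is_direct (s (T i))")
    case True
    then show ?thesis using False by (intro divergesI[where q = 0]) auto
  next
    case inv: False
    then have "A.less (A.src (s (T i))) (A.src (s' (T' j)))"
      using run_ascend_ends(1)[of i] run_descend_ends(2)[of j] False less letter_less_trans by metis
    then show ?thesis using eq by simp
  qed
qed

text \<open>Runs between equal end letters coincide: letters are strictly monotone along a run, so a
  longer run would meet the common end letter twice.\<close>

lemma diverges_previous_turning:
  assumes eq: "A.src (s (T i)) = A.src (s' (T' j))"
    and eq': "A.src (s (T (i + 1))) = A.src (s' (T' (j + 1)))"
    and div: "diverges s (T (i + 1)) s' (T' (j + 1))"
  shows "diverges s (T i) s' (T' j)"
proof -
  have dir: "is_direct (s (T i)) = is_direct (s' (T' j))"
    using eq eq' run_ascend_ends(1)[of i] run_ascend_ends(2)[of j]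
      run_descend_ends(1)[of i] run_descend_ends(2)[of j] A.less_asym by metis
  define m where "m = nat (T (i + 1) - T i)"
  define m' where "m' = nat (T' (j + 1) - T' j)"
  have m: "T i + int m = T (i + 1)" and m': "T' j + int m' = T' (j + 1)"
    using T_Suc[of i] T_Suc[of j] by (auto simp: m_def m'_def)
  define n where "n = min m m'"
  have d: "is_direct (s (T i + int t)) = is_direct (s (T i))" if "t < m" for t
    using that m by (intro A.run_direction) auto
  have d': "is_direct (s' (T' j + int t)) = is_direct (s' (T' j))" if "t < m'" for t
    using that m' by (intro B.run_direction) auto
  have "\<forall>t<n. is_direct (s (T i + int t)) = is_direct (s' (T' j + int t))"
    using d d' dir by (simp add: n_def)
  note agree = A.line_agree[OF A.line B.line eq this]
  have "m = m'"
  proof (rule linorder_cases[of m m'])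
    assume l: "m < m'"
    then have "A.src (s' (T' j + int m)) = A.src (s' (T' (j + 1)))"
      using agree(2) eq' m by (simp add: n_def)
    moreover have "A.less (A.src (s' (T' j + int m))) (A.src (s' (T' (j + 1))))"
      if "\<not> is_direct (s' (T' j))" using that l m' by (intro B.run_ascend) auto
    moreover have "A.less (A.src (s' (T' (j + 1)))) (A.src (s' (T' j + int m)))"
      if "is_direct (s' (T' j))" using that l m' by (intro B.run_descend) auto
    ultimately show ?thesis by (cases "is_direct (s' (T' j))") auto
  next
    assume l: "m' < m"
    then have "A.src (s (T i + int m')) = A.src (s (T (i + 1)))"
      using agree(2) eq' m' by (simp add: n_def)
    moreover have "A.less (A.src (s (T i + int m'))) (A.src (s (T (i + 1))))"
      if "\<not> is_direct (s (T i))" using that l m by (intro A.run_ascend) auto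
    moreover have "A.less (A.src (s (T (i + 1)))) (A.src (s (T i + int m')))"
      if "is_direct (s (T i))" using that l m by (intro A.run_descend) auto
    ultimately show ?thesis by (cases "is_direct (s (T i))") auto
  qed
  then have "n = m" by (simp add: n_def)
  show ?thesis
  proof (rule diverges_prefix[where n = m])
    show "s (T i + int t) = s' (T' j + int t)" if "t < m" for t
      using agree(1) that \<open>n = m\<close> by simp
    show "diverges s (T i + int m) s' (T' j + int m)"
      using div m m' \<open>m = m'\<close> by simp
  qed
qed

lemma diverges_from_turnings:
  assumes "\<And>t. t \<le> L \<Longrightarrow> A.src (s (T (i + int t))) = A.src (s' (T' (j + int t)))"
    and "A.less (A.src (s (T (i + int L + 1)))) (A.src (s' (T' (j + int L + 1))))"
  shows "diverges s (T i) s' (T' j)"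
  using assms
proof (induction L arbitrary: i j)
  case 0
  then show ?case using diverges_at_turning by auto
next
  case (Suc L)
  have "diverges s (T (i + 1)) s' (T' (j + 1))"
  proof (rule Suc.IH)
    show "A.src (s (T (i + 1 + int t))) = A.src (s' (T' (j + 1 + int t)))" if "t \<le> L" for t
      using Suc.prems(1)[of "Suc t"] that by (simp add: algebra_simps)
    show "A.less (A.src (s (T (i + 1 + int L + 1)))) (A.src (s' (T' (j + 1 + int L + 1))))"
      using Suc.prems(2) by (simp add: algebra_simps)
  qed
  then show ?case
    using Suc.prems(1)[of 0] Suc.prems(1)[of 1] diverges_previous_turning[of i j] by simp
qed

text \<open>Realises the first forbidden pattern: a common factor of L + 1 letters flanked by two
  strict inequalities. The inequality on the left becomes one on the right after reversal.\<close>

lemma graph_pair_from_turnings: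
  assumes "A.less (A.src (s (T i))) (A.src (s' (T' j)))"
    and "\<And>t. t \<le> L \<Longrightarrow> A.src (s (T (i + 1 + int t))) = A.src (s' (T' (j + 1 + int t)))"
    and "A.less (A.src (s (T (i + 1 + int L + 1)))) (A.src (s' (T' (j + 1 + int L + 1))))"
  shows "A.graph_pair s s' (T (i + 1)) (T' (j + 1))"
proof -
  interpret F: turning_line_pair Q \<rho> \<sigma> \<epsilon> "flip s" "\<lambda>i. - T (- i)" "flip s'" "\<lambda>i. - T' (- i)"
    by (rule turning_line_pair_flip)
  have "diverges (flip s) (- T (i + 1)) (flip s') (- T' (j + 1))"
    using assms(1) assms(2)[of 0] A.line B.line F.diverges_at_turning[of "- (i + 1)" "- (j + 1)"]
    by (simp add: A.src_flip add.commute)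
  then show ?thesis
    using assms(2)[of 0] diverges_from_turnings[OF assms(2,3)] unfolding A.graph_pair_def by simp
qed

text \<open>Realises the second forbidden pattern: two runs of equal direction with strictly ordered
  ends on both sides, meeting in a common letter.\<close>

lemma graph_pair_in_runs:
  assumes less: "A.less (A.src (s (T i))) (A.src (s' (T' j)))"
      "A.less (A.src (s (T (i + 1)))) (A.src (s' (T' (j + 1))))"
    and dir: "is_direct (s (T i)) = is_direct (s' (T' j))"
    and x: "T i \<le> x" "x \<le> T (i + 1)" and y: "T' j \<le> y" "y \<le> T' (j + 1)"
    and eq: "A.src (s x) = A.src (s' y)"
  shows "A.graph_pair s s' x y"
proof -
  interpret F: turning_line_pair Q \<rho> \<sigma> \<epsilon> "flip s" "\<lambda>i. - T (- i)" "flip s'" "\<lambda>i. - T' (- i)"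
    by (rule turning_line_pair_flip)
  have "is_direct (s (T (i + 1) - 1)) = is_direct (s (T i))"
    using T_Suc[of i] by (intro A.run_direction) auto
  moreover have "is_direct (s' (T' (j + 1) - 1)) = is_direct (s' (T' j))"
    using T_Suc[of j] by (intro B.run_direction) auto
  ultimately have "diverges (flip s) (- x) (flip s') (- y)"
    using less(1) x y eq dir A.line B.line
    by (intro F.diverges_in_runs[of "- (i + 1)" "- (j + 1)"])
        (simp_all add: A.src_flip is_direct_flip add.commute)
  then show ?thesis
    using diverges_in_runs[OF dir x y eq less(2)] eq unfolding A.graph_pair_def by auto
qed

end

section \<open>From a common substring back to turning points\<close>

context acyclic_string_algebra
begin

text \<open>A turning position strictly inside the common stretch has both adjacent syllables in
  common, hence is a turning position of both lines.\<close>

lemma next_turning_le: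
  assumes "turning_line_pair Q \<rho> \<sigma> \<epsilon> s T s' T'"
    and agree: "\<And>t. t < r \<Longrightarrow> s (u + int t) = s' (v + int t)"
    and a: "T i \<le> u + int a" "u + int a < T (i + 1)" "T' j \<le> v + int a" "v + int a < T' (j + 1)"
    and "T (i + 1) < u + int r"
  shows "T' (j + 1) - v \<le> T (i + 1) - u"
proof -
  interpret turning_line_pair Q \<rho> \<sigma> \<epsilon> s T s' T' by fact
  define w where "w = nat (T (i + 1) - u)"
  have w: "T (i + 1) = u + int w" "0 < w" "w < r" "a < w" using a assms(7) by (auto simp: w_def)
  have "s (u + int w) = s' (v + int w)" "s (u + int w - 1) = s' (v + int w - 1)"
    using agree[of w] agree[of "w - 1"] w by (simp_all add: add_diff_eq less_imp_diff_less)
  then have "turning s' (v + int w)"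
    using A.turning_T[of "i + 1"] w unfolding turning_def by metis
  then have "T' (j + 1) \<le> v + int w" using a w by (intro B.turning_bound) auto
  then show ?thesis using w by simp
qed

end

context turning_line_pair
begin

text \<open>By \<open>next_turning_le\<close> in both directions, turning positions inside the
  common stretch have the same offset in both lines. The case m = 0 stands for the start of the
  stretch, which need not be a turning position; there the offset is 0.\<close>

lemma turnings_correspond:
  assumes agree: "\<And>t. t < r \<Longrightarrow> s (u + int t) = s' (v + int t)"
    and i: "T i \<le> u" "u < T (i + 1)" and j: "T' j \<le> v" "v < T' (j + 1)"
    and "m = 0 \<or> T (i + int m) < u + int r"
  shows "\<exists>a. (m = 0 \<longrightarrow> a = 0) \<and> (m > 0 \<longrightarrow> a < r \<and> T (i + int m) = u + int a \<and> T' (j + int m) = v +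
      int a) \<and>
    T (i + int m) \<le> u + int a \<and> u + int a < T (i + int m + 1) \<and>
    T' (j + int m) \<le> v + int a \<and> v + int a < T' (j + int m + 1)"
  using assms(6)
proof (induction m)
  case 0
  then show ?case using i j by auto
next
  case (Suc m)
  have S: "T (i + int m + 1) < u + int r" using Suc.prems by (simp add: algebra_simps)
  moreover have "T (i + int m) < T (i + int m + 1)" by simp
  ultimately have "T (i + int m) < u + int r" by linarith
  then obtain a where a: "T (i + int m) \<le> u + int a" "u + int a < T (i + int m + 1)"
    "T' (j + int m) \<le> v + int a" "v + int a < T' (j + int m + 1)"
    using Suc.IH by auto
  have le: "T' (j + int m + 1) - v \<le> T (i + int m + 1) - u"
    by (rule A.next_turning_le[OF turning_line_pair_axioms agree a S]) auto
  have "turning_line_pair Q \<rho> \<sigma> \<epsilon> s' T' s T" ..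
  then have ge: "T (i + int m + 1) - u \<le> T' (j + int m + 1) - v"
    by (rule A.next_turning_le[of s' T' s T r v u j' a i' for i' j']) (use agree a le S in auto)
  define b where "b = nat (T (i + int m + 1) - u)"
  have "int b = T (i + int m + 1) - u" using a by (simp add: b_def)
  then have b: "T (i + int (Suc m)) = u + int b" "T' (j + int (Suc m)) = v + int b" "b < r"
    using le ge S by (auto simp: algebra_simps)
  then show ?case using T_Suc(1)[of "i + int (Suc m)"] T_Suc(2)[of "j + int (Suc m)"]
    by (intro exI[of _ b]) auto
qed

text \<open>z and z' are right ends of a common substring whose last syllable lies in the runs i and
  j. If that syllable ascends, \<open>s\<close> turns at z while \<open>s'\<close> keeps ascending;
  if it descends, \<open>s'\<close> turns while \<open>s\<close> keeps descending.\<close>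

lemma run_ends_less:
  assumes z: "T i < z" "z \<le> T (i + 1)" and z': "T' j < z'" "z' \<le> T' (j + 1)"
    and dir: "is_direct (s (z - 1)) = is_direct (s' (z' - 1))"
    and eq: "A.src (s z) = A.src (s' z')"
    and d: "is_direct (s z)" and d': "\<not> is_direct (s' z')"
  shows "A.less (A.src (s (T (i + 1)))) (A.src (s' (T' (j + 1))))"
proof -
  have D: "is_direct (s (z - 1)) = is_direct (s (T i))" using z by (intro A.run_direction) auto
  have D': "is_direct (s' (z' - 1)) = is_direct (s' (T' j))" using z' by (intro B.run_direction)
      auto
  show ?thesis
  proof (cases "is_direct (s (z - 1))")
    case False
    then have "T (i + 1) = z"
      using d z A.turning_bound[of z i] by (auto simp: turning_def)
    moreover have "z' \<noteq> T' (j + 1)"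
      using B.run_alternate[of j] D' False dir d' by auto
    then have "A.less (A.src (s' z')) (A.src (s' (T' (j + 1))))"
      using False dir D' z' by (intro B.run_ascend) auto
    ultimately show ?thesis using eq by simp
  next
    case True
    then have "T' (j + 1) = z'"
      using d' dir z' B.turning_bound[of z' j] by (auto simp: turning_def)
    moreover have "z \<noteq> T (i + 1)"
      using A.run_alternate[of i] D True d by auto
    then have "A.less (A.src (s (T (i + 1)))) (A.src (s z))"
      using True D z by (intro A.run_descend) auto
    ultimately show ?thesis using eq by simp
  qed
qed

text \<open>The turning positions inside the common substring are the L positions with equal
  letters, and the ones just before and after give the strict inequalities. If there are none, the
  substring lies in a single run of each line, which is the second forbidden pattern.\<close>

lemma graph_pair_imp_turnings:
  assumes "A.graph_pair s s' x y"
  obtains i j L where "A.less (A.src (s (T i))) (A.src (s' (T' j)))"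
    and "\<And>t. 1 \<le> t \<Longrightarrow> t \<le> L \<Longrightarrow> A.src (s (T (i + int t))) = A.src (s' (T' (j + int t)))"
    and "A.less (A.src (s (T (i + int L + 1)))) (A.src (s' (T' (j + int L + 1))))"
    and "L = 0 \<Longrightarrow> is_direct (s (T i)) = is_direct (s' (T' j))"
    and "L = 0 \<Longrightarrow> \<exists>x y. T i \<le> x \<and> x \<le> T (i + 1) \<and> T' j \<le> y \<and> y \<le> T' (j + 1) \<and>
      A.src (s x) = A.src (s' y)"
proof -
  obtain q where q: "\<And>t. t < q \<Longrightarrow> s (x + int t) = s' (y + int t)"
    "is_direct (s (x + int q))" "\<not> is_direct (s' (y + int q))"
    using assms unfolding A.graph_pair_def diverges_def by blast
  obtain p where p: "\<And>t. t < p \<Longrightarrow> flip s (- x + int t) = flip s' (- y + int t)"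
    "is_direct (flip s (- x + int p))" "\<not> is_direct (flip s' (- y + int p))"
    using assms unfolding A.graph_pair_def diverges_def by blast
  \<comment> \<open>u and v are the left ends of the common substring through x and y, and r is its
    length; p and q are the lengths of its parts to the left and to the right.\<close>
  define u where "u = x - int p"
  define v where "v = y - int p"
  define r where "r = p + q"
  have agree: "s (u + int t) = s' (v + int t)" if "t < r" for t
  proof (cases "t < p")
    case True
    have "s (x - int (Suc (p - Suc t))) = s' (y - int (Suc (p - Suc t)))"
      using p(1)[of "p - Suc t"] True by (simp add: flip_def algebra_simps)
    moreover have "int (Suc (p - Suc t)) = int p - int t" using True by auto
    ultimately show ?thesis by (simp only: u_def v_def) (simp add: algebra_simps)
  next
    case False
    then show ?thesis using q(1)[of "t - p"] that by (simp add: u_def v_def r_def algebra_simps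
        of_nat_diff)
  qed
  have right: "is_direct (s (u + int r))" "\<not> is_direct (s' (v + int r))"
    using q(2,3) by (simp_all add: u_def v_def r_def)
  have left: "\<not> is_direct (s (u - 1))" "is_direct (s' (v - 1))"
    using p(2,3) by (simp_all add: u_def v_def flip_def algebra_simps)
  have equ: "A.src (s u) = A.src (s' v)"
  proof (cases "r = 0")
    case True
    then show ?thesis using assms by (simp add: u_def v_def r_def A.graph_pair_def)
  next
    case False
    then show ?thesis using agree[of 0] by simp
  qed
  have eqr: "A.src (s (u + int r)) = A.src (s' (v + int r))"
    using agree by (intro A.line_agree(2)[OF A.line B.line equ]) simp
  show thesis
  proof (cases "r = 0")
    case True
    \<comment> \<open>The common substring is a single vertex, a peak of \<open>s\<close> and a
      valley of \<open>s'\<close>. It is itself the only common turning position, hence L = 1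
      below.\<close>
    have "turning s u" "turning s' v" using left right True by (auto simp: turning_def)
    then obtain a b where ab: "u = T a" "v = T' b" using A.turningE B.turningE by metis
    have 1: "\<not> is_direct (s (T (a - 1)))" "is_direct (s' (T' (b - 1)))"
      using A.run_alternate[of "a - 1"] B.run_alternate[of "b - 1"] right True ab by auto
    show thesis
    proof (rule that[of "a - 1" "b - 1" 1])
      show "A.less (A.src (s (T (a - 1)))) (A.src (s' (T' (b - 1))))"
        using run_ascend_ends(1)[OF 1(1)] run_descend_ends(2)[OF 1(2)] equ ab letter_less_trans
        by fastforce
      show "A.less (A.src (s (T (a - 1 + int 1 + 1)))) (A.src (s' (T' (b - 1 + int 1 + 1))))"
        using run_descend_ends(1)[of a] run_ascend_ends(2)[of b] right True equ ab letter_less_trans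
        by fastforce
    qed (use equ ab in \<open>auto simp: le_antisym\<close>)
  next
    case False
    obtain i where i: "T i \<le> u" "u < T (i + 1)" by (rule A.run_index)
    obtain j where j: "T' j \<le> v" "v < T' (j + 1)" by (rule B.run_index)
    \<comment> \<open>The run of the last common syllable; its index counted from the run i of the
      first one is L.\<close>
    obtain e where e: "T e \<le> u + int r - 1" "u + int r - 1 < T (e + 1)" by (rule A.run_index)
    have "T i < T (e + 1)" using i e False by linarith
    then have "i \<le> e" by simp
    then obtain L where L: "e = i + int L" using zle_iff_zadd by blast
    have corr: "\<exists>a. (m = 0 \<longrightarrow> a = 0) \<and> (m > 0 \<longrightarrow> a < r \<and> T (i + int m) = u + int a \<and> T' (j + int m) =
        v + int a) \<and>
      T (i + int m) \<le> u + int a \<and> u + int a < T (i + int m + 1) \<and>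
      T' (j + int m) \<le> v + int a \<and> v + int a < T' (j + int m + 1)" if "m \<le> L" for m
    proof (rule turnings_correspond[OF agree i j])
      have "T (i + int m) \<le> T e" using that L by simp
      then show "m = 0 \<or> T (i + int m) < u + int r" using e by linarith
    qed auto
    obtain a where a: "L = 0 \<longrightarrow> a = 0" "L > 0 \<longrightarrow> a < r" "T (i + int L) \<le> u + int a" "u +
        int a < T (i + int L + 1)"
      "T' (j + int L) \<le> v + int a" "v + int a < T' (j + int L + 1)"
      using corr[of L] by blast
    have ar: "a < r" using a False by (cases "L = 0") auto
    have z: "u + int r \<le> T (i + int L + 1)" using e L by simp
    have z': "v + int r \<le> T' (j + int L + 1)"
    proof (rule ccontr)
      assume c: "\<not> ?thesis"
      have "turning_line_pair Q \<rho> \<sigma> \<epsilon> s' T' s T" ..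
      then have "T (i + int L + 1) - u \<le> T' (j + int L + 1) - v"
        by (rule A.next_turning_le[of s' T' s T r v u j' a i' for i' j']) (use agree a c in auto)
      then show False using c z by simp
    qed
    have last: "s (u + int r - 1) = s' (v + int r - 1)"
      using agree[of "r - 1"] False by (simp add: of_nat_diff algebra_simps)
    have first: "s u = s' v" using agree[of 0] False by simp
    interpret F: turning_line_pair Q \<rho> \<sigma> \<epsilon> "flip s" "\<lambda>i. - T (- i)" "flip s'" "\<lambda>i. - T' (- i)"
      by (rule turning_line_pair_flip)
    have "A.less (A.src (flip s (- T (- (- (i + 1) + 1))))) (A.src (flip s' (- T' (- (- (j + 1) +
        1)))))"
      by (rule F.run_ends_less[where z = "- u" and z' = "- v"])
        (use i j first equ left A.line B.line in \<open>simp_all add: A.src_flip is_direct_flip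
            add.commute\<close>)
    then have l1: "A.less (A.src (s (T i))) (A.src (s' (T' j)))"
      using A.line B.line by (simp add: A.src_flip)
    have l2: "A.less (A.src (s (T (i + int L + 1)))) (A.src (s' (T' (j + int L + 1))))"
      by (rule run_ends_less[where z = "u + int r" and z' = "v + int r"])
        (use e L z z' a ar last eqr right in auto)
    show thesis
    proof (rule that[OF l1 _ l2])
      show "A.src (s (T (i + int t))) = A.src (s' (T' (j + int t)))" if "1 \<le> t" "t \<le> L" for t
        using corr[OF that(2)] that(1) agree by auto
      show "is_direct (s (T i)) = is_direct (s' (T' j))"
        using A.run_direction[OF i] B.run_direction[OF j] first by simp
      show "\<exists>x y. T i \<le> x \<and> x \<le> T (i + 1) \<and> T' j \<le> y \<and> y \<le> T' (j + 1) \<and> A.src (s x) = A.src (s' y)"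
        using i j equ by (metis less_imp_le)
    qed
  qed
qed

end

section \<open>Words of bands\<close>

definition unroll :: "'b list \<Rightarrow> int \<Rightarrow> 'b" where
  "unroll b t = b ! nat (t mod int (length b))"

lemma unroll_periodic [simp]: "unroll b (t + int (length b) * n) = unroll b t"
  by (simp add: unroll_def)

lemma unroll_of_nat: "i < length b \<Longrightarrow> unroll b (int i) = b ! i"
  by (simp add: unroll_def)

lemma list_power_Suc: "list_power b (Suc m) = b @ list_power b m"
  by (simp add: list_power_def)

lemma length_list_power [simp]: "length (list_power b m) = m * length b"
  by (induction m) (simp_all add: list_power_Suc, simp add: list_power_def)

lemma nth_list_power:
  "i < m * length b \<Longrightarrow> list_power b m ! i = b ! (i mod length b)"
proof (induction m arbitrary: i)
  case (Suc m)
  then show ?case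
    by (cases "i < length b") (auto simp: list_power_Suc nth_append le_mod_geq)
qed simp

lemma str_inv_list_power: "str_inv (list_power b m) = list_power (str_inv b) m"
proof (rule nth_equalityI)
  fix i assume i: "i < length (str_inv (list_power b m))"
  define k where "k = length b"
  have im: "i < m * k" using i by (simp add: k_def)
  then have k: "k > 0" by (cases k) auto
  have r: "i mod k < k" using k by simp
  have "i div k < m" using im k by (simp add: less_mult_imp_div_less)
  then obtain d where d: "m = Suc (i div k) + d" using less_iff_Suc_add by (metis add_Suc)
  have "m * k = i div k * k + k + d * k" by (simp add: d algebra_simps)
  moreover have "i = i div k * k + i mod k" by simp
  ultimately have "m * k - Suc i = (k - Suc (i mod k)) + d * k" using r by linarith
  then have "(m * k - Suc i) mod k = k - Suc (i mod k)" using k by simp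
  moreover have "m * k - Suc i < m * k" using im by simp
  ultimately show "str_inv (list_power b m) ! i = list_power (str_inv b) m ! i"
    using im r by (simp add: nth_str_inv nth_list_power k_def)
qed simp

lemma is_band_str_inv:
  assumes "is_band Q \<rho> b"
  shows "is_band Q \<rho> (str_inv b)"
proof -
  have ne: "b \<noteq> []" using assms by (auto simp: is_band_def is_string_def)
  then have hd: "hd (str_inv b) = syl_inv (last b)" "last (str_inv b) = syl_inv (hd b)"
    by (simp_all add: str_inv_def hd_rev last_rev last_map hd_map)
  have "b = list_power (str_inv u) m" if "str_inv b = list_power u m" for u m
    by (metis that str_inv_list_power str_inv_str_inv)
  then show ?thesis
    using assms hd is_string_str_inv unfolding is_band_def
    by (metis str_inv_list_power is_direct_syl_inv syl_src_syl_inv syl_tgt_syl_inv)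
qed

text \<open>Both periodic lines have a seam between two copies of the band at position 0, which
  reversal fixes; hence no shift appears.\<close>

lemma unroll_str_inv:
  assumes "b \<noteq> []"
  shows "unroll (str_inv b) = flip (unroll b)"
proof
  fix t
  define k where "k = int (length b)"
  have k: "k > 0" using assms by (simp add: k_def)
  have r: "0 \<le> t mod k" "t mod k < k" using k by simp_all
  have "- 1 - t = (k - 1 - t mod k) + k * (- (t div k) - 1)"
    using div_mult_mod_eq[of t k] by (simp add: algebra_simps)
  then have "(- 1 - t) mod k = (k - 1 - t mod k) mod k" by (simp only: mod_mult_self2)
  also have "\<dots> = k - 1 - t mod k" using r by (intro mod_pos_pos_trivial) auto
  finally have m: "(- 1 - t) mod k = k - 1 - t mod k" .
  have "nat (t mod k) < length b" using r by (simp add: k_def)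
  moreover have "length b - Suc (nat (t mod k)) = nat (k - 1 - t mod k)"
    using r by (simp add: k_def)
  ultimately show "unroll (str_inv b) t = flip (unroll b) t"
    using m by (simp add: unroll_def flip_def nth_str_inv k_def[symmetric])
qed

text \<open>The index 0 is included as the start of the first run. For a band it is a genuine
  turning position of the unrolled line, because a band starts inverse and ends direct.\<close>

definition turn_positions :: "'a syllable list \<Rightarrow> nat list" where
  "turn_positions w = filter (\<lambda>i. i = 0 \<or> is_direct (w ! (i - 1)) \<noteq> is_direct (w ! i))
      [0..<length w]"

lemma turn_positions_Cons:
  "turn_positions (x # y # w) = 0 #
     (if is_direct x = is_direct y then [] else [1]) @ map Suc (tl (turn_positions (y # w)))"
proof -
  have "[0..<length (x # y # w)] = 0 # 1 # map Suc [1..<length (y # w)]"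
    by (simp add: upt_conv_Cons map_Suc_upt del: upt_Suc)
  moreover have "turn_positions (y # w) = 0 # filter (\<lambda>i. i = 0 \<or>
      is_direct ((y # w) ! (i - 1)) \<noteq> is_direct ((y # w) ! i)) [1..<length (y # w)]"
    unfolding turn_positions_def by (simp add: upt_conv_Cons del: upt_Suc)
  moreover have "filter (\<lambda>i. i = 0 \<or> is_direct ((x # y # w) ! (i - 1)) \<noteq> is_direct ((x # y # w)
      ! i))
      (map Suc [1..<length (y # w)]) = map Suc (filter (\<lambda>i. i = 0 \<or>
      is_direct ((y # w) ! (i - 1)) \<noteq> is_direct ((y # w) ! i)) [1..<length (y # w)])"
    unfolding filter_map by (intro arg_cong[where f = "map Suc"] filter_cong) (auto simp: nth_Cons')
  ultimately show ?thesis
    unfolding turn_positions_def by auto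
qed

lemma turn_positions_Cons_0: "turn_positions (x # w) = 0 # tl (turn_positions (x # w))"
  unfolding turn_positions_def by (simp add: upt_conv_Cons del: upt_Suc)

text \<open>Turns the recursive decomposition into index form, in which it can be continued
  periodically.\<close>

lemma map_hd_runs: "map hd (runs w) = map (\<lambda>i. w ! i) (turn_positions w)"
proof (induction w rule: runs.induct)
  case 1
  then show ?case by (simp add: turn_positions_def)
next
  case (2 x)
  then show ?case by (simp add: turn_positions_def)
next
  case (3 x y w)
  have IH: "map hd (runs (y # w)) = map (\<lambda>i. (y # w) ! i) (turn_positions (y # w))"
    using 3 by (cases "is_direct x = is_direct y") auto
  obtain r rs where r: "runs (y # w) = r # rs"
    using runs_Cons_nonempty[of y w] by (cases "runs (y # w)") auto
  have "map hd rs = map (\<lambda>i. (y # w) ! i) (tl (turn_positions (y # w)))"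
    using IH turn_positions_Cons_0[of y w] unfolding r by (metis list.sel(3) map_tl)
  moreover have "hd r = y" using runs_Cons_nonempty[of y w] r by simp
  ultimately show ?case
    using r by (auto simp: turn_positions_Cons comp_def)
qed

lemma length_turn_positions: "length (turn_positions w) = length (runs w)"
  using map_hd_runs[of w] by (metis length_map)

text \<open>The periodic continuation of \<open>turn_positions\<close>: c turning positions for each
  copy of the band, and every further copy adds the length of the band.\<close>

definition turn :: "'a syllable list \<Rightarrow> int \<Rightarrow> int" where
  "turn b i = (let c = int (length (turn_positions b)) in
     (i div c) * int (length b) + int (turn_positions b ! nat (i mod c)))"

context acyclic_string_algebra
begin

abbreviation word :: "'b syllable list \<Rightarrow> 'a letter list" where
  "word \<equiv> band_word Q \<sigma> \<epsilon>"

lemma length_word: "length (word b) = length (turn_positions b)"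
  by (simp add: band_word_def length_turn_positions)

lemma line_unroll:
  assumes "is_band Q \<rho> b"
  shows "line (unroll b)"
  unfolding line_def
proof (intro allI impI)
  fix t and n :: nat
  assume n: "n > 0"
  define k where "k = length b"
  have k: "k > 0" using assms by (auto simp: is_band_def is_string_def k_def)
  define u where "u = nat (t mod int k)"
  \<comment> \<open>As k is positive, u + n copies of the band are long enough to contain the window
    of length n starting at u.\<close>
  define m where "m = u + n"
  have "m \<le> m * k" using k by simp
  have nth: "unroll b (t + int i) = list_power b m ! (u + i)" if "i < n" for i
  proof -
    have "(t + int i) mod int k = (int u + int i) mod int k"
      using k by (simp add: u_def mod_add_left_eq)
    also have "\<dots> = int ((u + i) mod k)" by (simp add: zmod_int)
    finally have "unroll b (t + int i) = b ! ((u + i) mod k)" by (simp add: unroll_def k_def)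
    moreover have "u + i < m" using that by (simp add: m_def)
    then have "u + i < m * k" using \<open>m \<le> m * k\<close> by (rule less_le_trans)
    ultimately show ?thesis by (simp add: nth_list_power k_def)
  qed
  have "map (\<lambda>i. unroll b (t + int i)) [0..<n] = take n (drop u (list_power b m))"
  proof (rule nth_equalityI)
    have "u + n \<le> m * k" using \<open>m \<le> m * k\<close> by (simp only: m_def)
    then show len: "length (map (\<lambda>i. unroll b (t + int i)) [0..<n]) =
        length (take n (drop u (list_power b m)))"
      by (simp add: k_def[symmetric])
    show "map (\<lambda>i. unroll b (t + int i)) [0..<n] ! i = take n (drop u (list_power b m)) ! i"
      if "i < length (map (\<lambda>i. unroll b (t + int i)) [0..<n])" for i
    proof -
      have i: "i < n" using that by simp
      moreover have "u + i \<le> length (list_power b m)"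
        using i \<open>u + n \<le> m * k\<close> by (simp add: k_def)
      ultimately show ?thesis by (simp add: nth)
    qed
  qed
  moreover have "sublist (take n (drop u (list_power b m))) (list_power b m)"
    using sublist_order.order_trans sublist_take sublist_drop by blast
  moreover have "is_string Q \<rho> (list_power b m)" using assms n by (simp add: is_band_def m_def)
  ultimately show "is_string Q \<rho> (map (\<lambda>i. unroll b (t + int i)) [0..<n])"
    using n by (metis is_string_sublist length_greater_0_conv length_map length_upt diff_zero)
qed

lemma turning_unroll_iff:
  assumes "is_band Q \<rho> b"
  shows "turning (unroll b) t \<longleftrightarrow> nat (t mod int (length b)) \<in> set (turn_positions b)"
proof -
  define k where "k = int (length b)"
  have ne: "b \<noteq> []" and ends: "\<not> is_direct (hd b)" "is_direct (last b)"
    using assms by (auto simp: is_band_def is_string_def)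
  have k: "k > 0" using ne by (simp add: k_def)
  have r: "0 \<le> t mod k" "t mod k < k" using k by simp_all
  have u: "unroll b t = b ! nat (t mod k)" by (simp add: unroll_def k_def)
  show ?thesis
  proof (cases "t mod k = 0")
    case True
    have "(t - 1) mod k = (t mod k - 1) mod k" by (simp add: mod_diff_left_eq)
    also have "\<dots> = k - 1" using True k by (simp add: zmod_minus1)
    finally have "unroll b (t - 1) = last b"
      using ne by (simp add: unroll_def k_def last_conv_nth nat_diff_distrib')
    moreover have "unroll b t = hd b" using u True ne by (simp add: hd_conv_nth)
    ultimately show ?thesis
      using ends True ne by (simp add: turning_def turn_positions_def k_def[symmetric])
  next
    case False
    have "(t - 1) mod k = (t mod k - 1) mod k" by (simp add: mod_diff_left_eq)
    also have "\<dots> = t mod k - 1" using False r by (intro mod_pos_pos_trivial) linarith+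
    finally have "(t - 1) mod k = t mod k - 1" .
    moreover have "nat (t mod k - 1) = nat (t mod k) - 1"
        using False r by (simp add: nat_diff_distrib)
    ultimately have "unroll b (t - 1) = b ! (nat (t mod k) - 1)"
      by (simp add: unroll_def k_def[symmetric])
    moreover have "nat (t mod k) < length b" "nat (t mod k) \<noteq> 0" using r False by (auto simp: k_def)
    ultimately show ?thesis
      using u unfolding turning_def turn_positions_def k_def[symmetric] by auto
  qed
qed

lemma turn_positions_nonempty: "is_band Q \<rho> b \<Longrightarrow> turn_positions b \<noteq> []"
proof -
  assume "is_band Q \<rho> b"
  then have "b \<noteq> []" by (auto simp: is_band_def is_string_def)
  then show ?thesis by (metis turn_positions_Cons_0 list.collapse list.distinct(1))
qed

lemma turn_positions_less: "i < length (turn_positions b) \<Longrightarrow> turn_positions b ! i < length b"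
  using nth_mem[of i "turn_positions b"] by (auto simp: turn_positions_def)

lemma turn_mod:
  assumes "is_band Q \<rho> b"
  shows "turn b i mod int (length b) = int (turn_positions b ! nat (i mod int (length
      (turn_positions b))))"
proof -
  define c where "c = length (turn_positions b)"
  have "c > 0" using turn_positions_nonempty[OF assms] by (simp add: c_def)
  then have "nat (i mod int c) < c" by (simp add: nat_less_iff)
  then have "turn_positions b ! nat (i mod int c) < length b"
      using turn_positions_less by (simp add: c_def)
  then show ?thesis by (simp add: turn_def Let_def c_def)
qed

lemma turn_div:
  assumes "is_band Q \<rho> b"
  shows "turn b i div int (length b) = i div int (length (turn_positions b))"
proof -
  have "turn b i = (i div int (length (turn_positions b))) * int (length b) +
      turn b i mod int (length b)"
    unfolding turn_mod[OF assms] by (simp add: turn_def Let_def)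
  moreover have "int (length b) \<noteq> 0" using assms by (auto simp: is_band_def is_string_def)
  ultimately show ?thesis
    by (metis div_mult_mod_eq add_right_cancel mult_cancel_right)
qed

lemma enumerates_turning_turn:
  assumes "is_band Q \<rho> b"
  shows "enumerates_turning (turn b) (unroll b)"
  unfolding enumerates_turning_def
proof (intro conjI subset_antisym subsetI)
  define c where "c = int (length (turn_positions b))"
  define k where "k = int (length b)"
  have c: "c > 0" using turn_positions_nonempty[OF assms] by (simp add: c_def)
  have k: "k > 0" using assms by (auto simp: is_band_def is_string_def k_def)
  have tm: "turn b i mod k = int (turn_positions b ! nat (i mod c))" for i
    using turn_mod[OF assms] by (simp add: c_def k_def)
  have td: "turn b i div k = i div c" for i
    using turn_div[OF assms] by (simp add: c_def k_def)
  have eq: "turn b i = (i div c) * k + turn b i mod k" for i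
    using td[of i] div_mult_mod_eq[of "turn b i" k] by simp
  show "strict_mono (turn b)"
  proof (rule strict_monoI)
    fix i j :: int assume ij: "i < j"
    show "turn b i < turn b j"
    proof (cases "i div c = j div c")
      case True
      then have "i mod c < j mod c"
        using ij div_mult_mod_eq[of i c] div_mult_mod_eq[of j c] unfolding True by linarith
      have "nat (i mod c) < nat (j mod c)"
        using \<open>i mod c < j mod c\<close> c nat_less_eq_zless[of "i mod c" "j mod c"] by simp
      moreover have "nat (j mod c) < length (turn_positions b)"
        using c by (simp add: nat_less_iff c_def)
      moreover have "sorted_wrt (<) (turn_positions b)"
        by (simp add: turn_positions_def sorted_wrt_filter)
      ultimately have "turn_positions b ! nat (i mod c) < turn_positions b ! nat (j mod c)"
        by (metis sorted_wrt_nth_less)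
      then show ?thesis using True eq[of i] eq[of j] tm by simp
    next
      case False
      then have "i div c + 1 \<le> j div c" using ij c zdiv_mono1[of i j c] by simp
      then have "(i div c + 1) * k \<le> j div c * k" using k by (intro mult_right_mono) auto
      moreover have "turn b i mod k < k" "0 \<le> turn b j mod k" using k by simp_all
      ultimately show ?thesis using eq[of i] eq[of j] by (simp add: algebra_simps)
    qed
  qed
  show "t \<in> {t. turning (unroll b) t}" if "t \<in> range (turn b)" for t
    using that c tm by (auto simp: turning_unroll_iff[OF assms] k_def[symmetric] c_def nat_less_iff)
  show "t \<in> range (turn b)" if t: "t \<in> {t. turning (unroll b) t}" for t
  proof -
    obtain r where r: "r < length (turn_positions b)" "turn_positions b ! r = nat (t mod k)"
      using t by (auto simp: turning_unroll_iff[OF assms] in_set_conv_nth k_def)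
    define i where "i = int r + t div k * c"
    have "int r div c = 0" "int r mod c = int r" using r(1) by (simp_all add: c_def)
    then have "i div c = t div k" "i mod c = int r" using c by (simp_all add: i_def)
    then have "turn b i = t"
      using eq[of i] tm[of i] r(2) k by simp
    then show ?thesis by blast
  qed
qed

lemma turning_line_band: "is_band Q \<rho> b \<Longrightarrow> turning_line Q \<rho> \<sigma> \<epsilon> (unroll b) (turn b)"
  by unfold_locales (simp_all add: line_unroll enumerates_turning_turn)

lemma nth_word:
  assumes "is_band Q \<rho> b"
  shows "word b ! nat (i mod int (length (word b))) = src (unroll b (turn b i))"
proof -
  define c where "c = int (length (turn_positions b))"
  have r: "nat (i mod c) < length (turn_positions b)"
    using turn_positions_nonempty[OF assms] by (simp add: c_def nat_less_iff)
  have w: "word b = map (\<lambda>i. src (b ! i)) (turn_positions b)"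
  proof -
    have "word b = map src (map hd (runs b))" by (simp add: band_word_def)
    then show ?thesis by (simp add: map_hd_runs)
  qed
  have "unroll b (turn b i) = b ! (turn_positions b ! nat (i mod c))"
    using turn_mod[OF assms, of i] by (simp add: unroll_def c_def)
  then show ?thesis using r by (simp add: w c_def)
qed

lemma nth_word_nat:
  assumes "is_band Q \<rho> b"
  shows "word b ! (n mod length (word b)) = src (unroll b (turn b (int n)))"
  using nth_word[OF assms, of "int n"] by (simp add: zmod_int[symmetric])

lemma word_nonempty: "is_band Q \<rho> b \<Longrightarrow> length (word b) > 0"
  using turn_positions_nonempty by (simp add: length_word)

lemma src_turn_periodic:
  assumes "is_band Q \<rho> b"
  shows "src (unroll b (turn b (i + int (length (word b)) * n))) = src (unroll b (turn b i))"
  using nth_word[OF assms, of "i + int (length (word b)) * n"] nth_word[OF assms, of i] by simp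

text \<open>Runs alternate in direction, also across the seam, so the letters at consecutive turning
  positions alternate in every rotation.\<close>

lemma is_crown_word:
  assumes "is_band Q \<rho> b"
  shows "is_crown less (word b)"
  unfolding is_crown_def
proof
  fix r
  interpret turning_line Q \<rho> \<sigma> \<epsilon> "unroll b" "turn b"
    using turning_line_band[OF assms] .
  define g where "g i = src (unroll b (turn b (int (r + i))))" for i
  define d where "d i = is_direct (unroll b (turn b (int (r + i))))" for i
  have nth: "rotate r (word b) ! i = g i" if "i < length (word b)" for i
    using that nth_rotate[OF that, of r] nth_word_nat[OF assms] by (simp add: g_def)
  have S: "int (r + Suc i) = int (r + i) + 1" for i by simp
  have par: "d i \<longleftrightarrow> (d 0 \<longleftrightarrow> even i)" for i
  proof (induction i)
    case (Suc i)
    then show ?case using run_alternate[of "int (r + i)"] unfolding d_def S by auto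
  qed simp
  have up: "\<not> d i \<Longrightarrow> less (g i) (g (Suc i))" for i
    unfolding d_def g_def S by (rule run_ascend) auto
  have down: "d i \<Longrightarrow> less (g (Suc i)) (g i)" for i
    unfolding d_def g_def S by (rule run_descend) auto
  have "if even i then less (g i) (g (Suc i)) else less (g (Suc i)) (g i)" if "\<not> d 0" for i
    using that par[of i] up[of i] down[of i] by (cases "even i") auto
  moreover have "if odd i then less (g i) (g (Suc i)) else less (g (Suc i)) (g i)" if "d 0" for i
    using that par[of i] up[of i] down[of i] by (cases "even i") auto
  ultimately show "is_zigzag less (rotate r (word b))"
    unfolding is_zigzag_def using nth by (cases "d 0") (simp_all add: Suc_lessD)
qed

section \<open>Traces\<close>

lemma connects_Cons:
  assumes "connects Q \<rho> \<sigma> \<epsilon> p q (x # y # w)"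
  shows "src x = p" "connects Q \<rho> \<sigma> \<epsilon> (tgt x) q (y # w)"
proof -
  have s: "is_string Q \<rho> (x # y # w)" using assms by (simp add: connects_def)
  have "sublist [x, y] (x # y # w)" "sublist (y # w) (x # y # w)"
    by (auto simp: sublist_def intro: exI[of _ "[]"] exI[of _ "[x]"])
  then have "is_string Q \<rho> [x, y]" "is_string Q \<rho> (y # w)"
    using is_string_sublist[OF s] by blast+
  then show "connects Q \<rho> \<sigma> \<epsilon> (tgt x) q (y # w)"
    using assms string_letter_composable[of x y] by (auto simp: connects_def homogeneous_def)
  show "src x = p" using assms by (simp add: connects_def)
qed

lemma connects_less:
  assumes "connects Q \<rho> \<sigma> \<epsilon> p q z"
  shows "if is_direct (hd z) then q \<prec> p else p \<prec> q"
  using assms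
proof (induction z arbitrary: p rule: induct_list012)
  case 1
  then show ?case by (simp add: connects_def is_string_def)
next
  case (2 x)
  then have "syl_arc x \<in> arcs Q" by (simp add: connects_def is_string_def)
  then show ?case using letter_less_step[of x Q \<sigma> \<epsilon>] 2 by (auto simp: connects_def)
next
  case (3 x y w)
  have arc: "syl_arc x \<in> arcs Q" using 3 by (simp add: connects_def is_string_def)
  have d: "is_direct x = is_direct y" using 3 by (auto simp: connects_def homogeneous_def)
  have "if is_direct y then q \<prec> tgt x else tgt x \<prec> q"
    using 3(2)[OF connects_Cons(2)[OF 3(3)]] by simp
  then show ?case
    using letter_less_step[OF arc, of \<sigma> \<epsilon>] connects_Cons(1)[OF 3(3)] d
    by (auto intro: letter_less_trans split: if_splits)
qed

text \<open>The end letters fix the direction by \<open>connects_less\<close>, and then each source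
  letter fixes the next syllable. Neither string can be longer, since the rest would connect q with
  itself.\<close>

lemma connects_unique:
  assumes "connects Q \<rho> \<sigma> \<epsilon> p q z" "connects Q \<rho> \<sigma> \<epsilon> p q z'"
  shows "z = z'"
proof -
  have d: "is_direct (hd z) = is_direct (hd z')"
    using connects_less[OF assms(1)] connects_less[OF assms(2)] less_asym by (auto split: if_splits)
  show ?thesis using assms d
  proof (induction z arbitrary: p z' rule: induct_list012)
    case 1
    then show ?case by (simp add: connects_def is_string_def)
  next
    case (2 x)
    obtain x' w' where z': "z' = x' # w'" using 2 by (cases z')
        (auto simp: connects_def is_string_def)
    have "x = x'" using 2 z' by (intro letter_src_inj) (auto simp: connects_def is_string_def)
    show ?case
    proof (cases w')
      case (Cons y' v')
      then have "connects Q \<rho> \<sigma> \<epsilon> (tgt x') q (y' # v')" using 2(2) connects_Cons z' by blast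
      moreover have "tgt x' = q" using 2(1) \<open>x = x'\<close> by (simp add: connects_def)
      ultimately show ?thesis using connects_less[of q q] by (auto split: if_splits)
    qed (simp add: z' \<open>x = x'\<close>)
  next
    case (3 x y w)
    obtain x' w' where z': "z' = x' # w'" using 3(4) by (cases z')
        (auto simp: connects_def is_string_def)
    have x: "x = x'" using 3(3-5) z' by (intro letter_src_inj)
        (auto simp: connects_def is_string_def)
    have c: "connects Q \<rho> \<sigma> \<epsilon> (tgt x) q (y # w)" using connects_Cons(2)[OF 3(3)] .
    show ?case
    proof (cases w')
      case Nil
      then have "tgt x = q" using 3(4) z' x by (simp add: connects_def)
      then show ?thesis using connects_less[OF c] by (auto split: if_splits)
    next
      case (Cons y' v')
      then have c': "connects Q \<rho> \<sigma> \<epsilon> (tgt x) q (y' # v')" using 3(4) connects_Cons z' x by blast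
      have "is_direct y = is_direct y'"
        using 3(3-5) z' Cons x by (auto simp: connects_def homogeneous_def)
      then show ?thesis using 3(2)[OF c c'] z' x Cons by simp
    qed
  qed
qed

end

context turning_line
begin

text \<open>The run itself is the string connecting its end letters. A common element of two traces
  thus becomes a pair of positions with equal letters.\<close>

lemma letter_trace_run:
  "set (letter_trace Q \<rho> \<sigma> \<epsilon> (src (s (T i))) (src (s (T (i + 1))))) =
     {src (s x) | x. T i \<le> x \<and> x \<le> T (i + 1)}"
proof -
  define m where "m = nat (T (i + 1) - T i)"
  have lt: "T i < T (i + 1)" by simp
  then have m: "T (i + 1) = T i + int m" "m > 0" by (simp_all add: m_def)
  define z where "z = map (\<lambda>t. s (T i + int t)) [0..<m]"
  have dir: "is_direct (s (T i + int t)) = is_direct (s (T i))" if "t < m" for t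
    using that m by (intro run_direction) auto
  have "is_string Q \<rho> z" unfolding z_def using line_string[OF line m(2)] .
  moreover have "homogeneous z"
    using dir by (cases "is_direct (s (T i))") (auto simp: homogeneous_def z_def)
  moreover have "hd z = s (T i)" using m(2) by (simp add: z_def hd_map)
  moreover have "last z = s (T (i + 1) - 1)"
    using m by (simp add: z_def last_map of_nat_diff add_diff_eq)
  ultimately have c: "connects Q \<rho> \<sigma> \<epsilon> (src (s (T i))) (src (s (T (i + 1)))) z"
    using line_step[OF line, of "T (i + 1) - 1"] by (simp add: connects_def)
  then have "(THE z. connects Q \<rho> \<sigma> \<epsilon> (src (s (T i))) (src (s (T (i + 1)))) z) = z"
    using connects_unique by blast
  then have tr: "letter_trace Q \<rho> \<sigma> \<epsilon> (src (s (T i))) (src (s (T (i + 1)))) =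
      src (s (T i)) # map src (tl z) @ [src (s (T (i + 1)))]"
    using c by (auto simp: letter_trace_def)
  have "tl z = map (\<lambda>t. s (T i + int t)) [1..<m]"
    using m(2) by (simp add: z_def map_tl[symmetric] upt_conv_Cons)
  then have "set (letter_trace Q \<rho> \<sigma> \<epsilon> (src (s (T i))) (src (s (T (i + 1))))) =
      insert (src (s (T i))) (insert (src (s (T (i + 1)))) (src ` set (tl z)))"
    unfolding tr by auto
  also have "\<dots> = insert (src (s (T i)))
      (insert (src (s (T i + int m))) ((\<lambda>t. src (s (T i + int t))) ` {1..<m}))"
    by (simp add: \<open>tl z = _\<close> m(1) image_image)
  also have "\<dots> = (\<lambda>t. src (s (T i + int t))) ` {0..m}"
  proof -
    have "{0..m} = insert 0 (insert m {1..<m})" using m(2) by auto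
    then show ?thesis by simp
  qed
  also have "\<dots> = {src (s x) | x. T i \<le> x \<and> x \<le> T (i + 1)}"
  proof (rule subset_antisym)
    show "{src (s x) | x. T i \<le> x \<and> x \<le> T (i + 1)} \<subseteq> (\<lambda>t. src (s (T i + int t))) ` {0..m}"
    proof
      fix p assume "p \<in> {src (s x) | x. T i \<le> x \<and> x \<le> T (i + 1)}"
      then obtain x where x: "p = src (s x)" "T i \<le> x" "x \<le> T (i + 1)" by blast
      then have "p = src (s (T i + int (nat (x - T i))))" "nat (x - T i) \<in> {0..m}" using m by auto
      then show "p \<in> (\<lambda>t. src (s (T i + int t))) ` {0..m}" by blast
    qed
  qed (use m in auto)
  finally show ?thesis .
qed

end

lemma nth_rotate_list_power:
  "j < M * length w \<Longrightarrow> rotate r (list_power w M) ! j = w ! ((r + j) mod length w)"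
proof -
  assume j: "j < M * length w"
  then have "(r + j) mod (M * length w) < M * length w" by (intro mod_less_divisor) linarith
  then show ?thesis
    using j by (simp add: nth_rotate nth_list_power mod_mult2_eq' mod_mod_cancel)
qed

lemma list_split_at_two:
  assumes "L + 2 \<le> length xs"
  shows "xs = [xs ! 0] @ take L (drop 1 xs) @ [xs ! Suc L] @ drop (L + 2) xs"
proof -
  have "drop 1 xs = take L (drop 1 xs) @ drop (Suc L) xs"
    by (metis append_take_drop_id drop_drop add.commute plus_1_eq_Suc)
  moreover have "drop (Suc L) xs = xs ! Suc L # drop (L + 2) xs"
    using assms Cons_nth_drop_Suc[of "Suc L" xs] by simp
  moreover have "xs = xs ! 0 # drop 1 xs"
    using assms by (cases xs) auto
  ultimately show ?thesis by (metis append_Cons append_Nil)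
qed

context acyclic_string_algebra
begin

text \<open>The letters of a rotated power are the letters at consecutive turning positions, and the
  trace of two neighbours is a run. So the two forbidden patterns are statements about turning
  positions, which the lemmas on turning points translate into graph pairs and back.\<close>

lemma weakly_perfectly_clustering_iff:
  assumes b: "is_band Q \<rho> b" and b': "is_band Q \<rho> b'"
  shows "weakly_perfectly_clustering Q \<rho> \<sigma> \<epsilon> (word b) (word b') \<longleftrightarrow>
    (\<nexists>x y. graph_pair (unroll b) (unroll b') x y)"
proof -
  define s T c where "s = unroll b" "T = turn b" "c = length (word b)"
  define s' T' c' where "s' = unroll b'" "T' = turn b'" "c' = length (word b')"
  interpret turning_line_pair Q \<rho> \<sigma> \<epsilon> s T s' T'
    unfolding s_T_c_def s'_T'_c'_def using turning_line_band b b' by (intro turning_line_pair.intro)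
  have c: "c > 0" "c' > 0" using word_nonempty b b' by (simp_all add: s_T_c_def s'_T'_c'_def)
  define P where "P r = rotate r (list_power (word b) (2 * c'))" for r
  define P' where "P' r = rotate r (list_power (word b') (2 * c))" for r
  define N where "N = 2 * c' * c"
  have len: "length (P r) = N" "length (P' r) = N" for r
    by (simp_all add: P_def P'_def N_def s_T_c_def s'_T'_c'_def)
  have nthP: "P r ! j = src (s (T (int (r + j))))" if "j < N" for r j
    using that nth_word_nat[OF b, of "r + j"]
    by (simp add: P_def N_def s_T_c_def s'_T'_c'_def nth_rotate_list_power)
  have nthP': "P' r ! j = src (s' (T' (int (r + j))))" if "j < N" for r j
  proof -
    have "j < 2 * c * length (word b')"
      using that by (simp add: N_def s'_T'_c'_def mult.commute mult.left_commute)
    then show ?thesis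
      using nth_word_nat[OF b', of "r + j"]
      by (simp add: P'_def s'_T'_c'_def nth_rotate_list_power)
  qed
  have per: "src (s (T (i + int c * n))) = src (s (T i))" for i n
    using src_turn_periodic[OF b] by (simp add: s_T_c_def)
  have per': "src (s' (T' (i + int c' * n))) = src (s' (T' i))" for i n
    using src_turn_periodic[OF b'] by (simp add: s'_T'_c'_def)
  have up: "src (s (T i)) \<prec> src (s (T (i + 1))) \<longleftrightarrow> \<not> is_direct (s (T i))" for i
    using run_ascend_ends(1)[of i] run_descend_ends(1)[of i] less_asym by blast
  have up': "src (s' (T' i)) \<prec> src (s' (T' (i + 1))) \<longleftrightarrow> \<not> is_direct (s' (T' i))" for i
    using run_ascend_ends(2)[of i] run_descend_ends(2)[of i] less_asym by blast
  define V1 where "V1 \<longleftrightarrow> (\<exists>r1 r2 n1 m1 n2 m2 z z1 z2. P r1 = [n1] @ z @ [m1] @ z1 \<and>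
     P' r2 = [n2] @ z @ [m2] @ z2 \<and> n1 \<prec> n2 \<and> m1 \<prec> m2 \<and> length z \<ge> 1)"
  define V2 where "V2 \<longleftrightarrow> (\<exists>r1 r2 n1 m1 n2 m2 z1 z2. P r1 = [n1] @ [m1] @ z1 \<and>
     P' r2 = [n2] @ [m2] @ z2 \<and> n1 \<prec> n2 \<and> m1 \<prec> m2 \<and> (n1 \<prec> m1 \<longleftrightarrow> n2 \<prec> m2) \<and>
     set (letter_trace Q \<rho> \<sigma> \<epsilon> n1 m1) \<inter> set (letter_trace Q \<rho> \<sigma> \<epsilon> n2 m2) \<noteq> {})"
  have wpc: "weakly_perfectly_clustering Q \<rho> \<sigma> \<epsilon> (word b) (word b') \<longleftrightarrow> \<not> V1 \<and> \<not> V2"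
    using is_crown_word[OF b] is_crown_word[OF b']
    unfolding weakly_perfectly_clustering_def Let_def V1_def V2_def P_def P'_def s_T_c_def
        s'_T'_c'_def
    by simp
  have "\<exists>x y. graph_pair s s' x y" if v: V1
  proof -
    obtain r1 r2 n1 m1 n2 m2 z z1 z2 where z: "P r1 = [n1] @ z @ [m1] @ z1"
      "P' r2 = [n2] @ z @ [m2] @ z2" "n1 \<prec> n2" "m1 \<prec> m2" "length z \<ge> 1"
      using v unfolding V1_def by blast
    \<comment> \<open>The common factor has L + 1 letters, in accordance with
      \<open>graph_pair_from_turnings\<close>.\<close>
    define L where "L = length z - 1"
    have N: "L + 3 \<le> N" using len(1)[of r1] z(1,5) by (simp add: L_def)
    have at: "n1 = P r1 ! 0" "m1 = P r1 ! (L + 2)" "n2 = P' r2 ! 0" "m2 = P' r2 ! (L + 2)"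
    proof -
      have "L + 2 = Suc (length z)" using z(5) by (simp add: L_def)
      then show "n1 = P r1 ! 0" "m1 = P r1 ! (L + 2)" "n2 = P' r2 ! 0" "m2 = P' r2 ! (L + 2)"
        by (simp_all add: z(1,2) nth_append)
    qed
    have mid: "P r1 ! Suc t = P' r2 ! Suc t" if "t \<le> L" for t
    proof -
      have "t < length z" using that z(5) by (auto simp: L_def)
      then show ?thesis by (simp add: z(1,2) nth_append)
    qed
    have "graph_pair s s' (T (int r1 + 1)) (T' (int r2 + 1))"
    proof (rule graph_pair_from_turnings)
      show "src (s (T (int r1))) \<prec> src (s' (T' (int r2)))"
        using z(3) at N nthP[of 0 r1] nthP'[of 0 r2] by simp
      show "src (s (T (int r1 + 1 + int t))) = src (s' (T' (int r2 + 1 + int t)))" if "t \<le> L" for t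
        using mid[OF that] that N nthP[of "Suc t" r1] nthP'[of "Suc t" r2]
            by (simp add: algebra_simps)
      show "src (s (T (int r1 + 1 + int L + 1))) \<prec> src (s' (T' (int r2 + 1 + int L + 1)))"
        using z(4) at N nthP[of "L + 2" r1] nthP'[of "L + 2" r2] by (simp add: algebra_simps)
    qed
    then show ?thesis by blast
  qed
  moreover have "\<exists>x y. graph_pair s s' x y" if v: V2
  proof -
    obtain r1 r2 n1 m1 n2 m2 z1 z2 where z: "P r1 = [n1] @ [m1] @ z1"
      "P' r2 = [n2] @ [m2] @ z2" "n1 \<prec> n2" "m1 \<prec> m2" "n1 \<prec> m1 \<longleftrightarrow> n2 \<prec> m2"
      "set (letter_trace Q \<rho> \<sigma> \<epsilon> n1 m1) \<inter> set (letter_trace Q \<rho> \<sigma> \<epsilon> n2 m2) \<noteq> {}"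
      using v unfolding V2_def by blast
    have N: "2 \<le> N" using len(1)[of r1] z(1) by simp
    have at: "n1 = src (s (T (int r1)))" "m1 = src (s (T (int r1 + 1)))"
      "n2 = src (s' (T' (int r2)))" "m2 = src (s' (T' (int r2 + 1)))"
      using N nthP[of 0 r1] nthP'[of 0 r2] nthP[of 1 r1] nthP'[of 1 r2]
      by (simp_all add: z(1,2) algebra_simps)
    have "is_direct (s (T (int r1))) = is_direct (s' (T' (int r2)))"
      using z(5) unfolding at up up' by simp
    moreover obtain p where p: "p \<in> {src (s x) | x. T (int r1) \<le> x \<and> x \<le> T (int r1 + 1)}"
      "p \<in> {src (s' y) | y. T' (int r2) \<le> y \<and> y \<le> T' (int r2 + 1)}"
      using z(6) unfolding at A.letter_trace_run B.letter_trace_run by blast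
    obtain x where "p = src (s x)" "T (int r1) \<le> x" "x \<le> T (int r1 + 1)" using p(1) by blast
    moreover obtain y where "p = src (s' y)" "T' (int r2) \<le> y" "y \<le> T' (int r2 + 1)" using p(2)
        by blast
    ultimately show ?thesis
      using z(3,4) graph_pair_in_runs[of "int r1" "int r2" x y] unfolding at by metis
  qed
  moreover have "V1 \<or> V2" if gp: "graph_pair s s' x y" for x y
  proof -
    obtain i j L where less1: "src (s (T i)) \<prec> src (s' (T' j))"
      and eq: "\<And>t. 1 \<le> t \<Longrightarrow> t \<le> L \<Longrightarrow> src (s (T (i + int t))) = src (s' (T' (j + int t)))"
      and less2: "src (s (T (i + int L + 1))) \<prec> src (s' (T' (j + int L + 1)))"
      and L0: "L = 0 \<Longrightarrow> is_direct (s (T i)) = is_direct (s' (T' j))"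
        "L = 0 \<Longrightarrow> \<exists>x y. T i \<le> x \<and> x \<le> T (i + 1) \<and> T' j \<le> y \<and> y \<le> T' (j + 1) \<and> src (s x) = src (s' y)"
      using graph_pair_imp_turnings[OF gp] by metis
    \<comment> \<open>A longer common factor would reach the offset c c'. This is a multiple of both
      periods, so the letters just before the factor would be equal, not strictly ordered. Hence the
      pattern, with its two flanking letters, fits into the N = 2 c c' letters of the
      powers.\<close>
    have "L < c * c'"
    proof (rule ccontr)
      assume "\<not> L < c * c'"
      then have "src (s (T (i + int c * int c'))) = src (s' (T' (j + int c' * int c)))"
        using eq[of "c * c'"] c by (simp add: mult.commute)
      then show False using less1 unfolding per per' by simp
    qed
    moreover have "1 \<le> c * c'" using c by simp
    ultimately have N: "L + 2 \<le> N" by (simp add: N_def mult.commute mult.left_commute)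
    \<comment> \<open>Rotations are by natural numbers, whereas turning positions are numbered by
      integers.\<close>
    define r1 where "r1 = nat (i mod int c)"
    define r2 where "r2 = nat (j mod int c')"
    have W: "src (s (T (int r1 + int t))) = src (s (T (i + int t)))" for t
    proof -
      have "i + int t = int r1 + int t + int c * (i div int c)"
        using c by (simp add: r1_def)
      then show ?thesis using per[of "int r1 + int t" "i div int c"] by metis
    qed
    have W': "src (s' (T' (int r2 + int t))) = src (s' (T' (j + int t)))" for t
    proof -
      have "j + int t = int r2 + int t + int c' * (j div int c')"
        using c by (simp add: r2_def)
      then show ?thesis using per'[of "int r2 + int t" "j div int c'"] by metis
    qed
    have atP: "P r1 ! t = src (s (T (i + int t)))" if "t < N" for t
      using nthP[OF that, of r1] W[of t] by simp
    have atP': "P' r2 ! t = src (s' (T' (j + int t)))" if "t < N" for t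
      using nthP'[OF that, of r2] W'[of t] by simp
    have ends: "P r1 ! 0 \<prec> P' r2 ! 0" "P r1 ! Suc L \<prec> P' r2 ! Suc L"
      using less1 less2 atP[of 0] atP'[of 0] atP[of "Suc L"] atP'[of "Suc L"] N
      by (simp_all add: algebra_simps)
    show ?thesis
    proof (cases "L = 0")
      case False
      have "take L (drop 1 (P r1)) = take L (drop 1 (P' r2))"
      proof (rule nth_equalityI)
        fix t assume "t < length (take L (drop 1 (P r1)))"
        then have "t < L" by simp
        then show "take L (drop 1 (P r1)) ! t = take L (drop 1 (P' r2)) ! t"
          using eq[of "Suc t"] atP[of "Suc t"] atP'[of "Suc t"] N len by simp
      qed (simp add: len)
      moreover have "length (take L (drop 1 (P r1))) \<ge> 1" using False N len by simp
      ultimately have V1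
        unfolding V1_def
        using list_split_at_two[of L "P r1"] list_split_at_two[of L "P' r2"] N len ends by metis
      then show ?thesis ..
    next
      case True
      have at: "P r1 ! 0 = src (s (T i))" "P r1 ! 1 = src (s (T (i + 1)))"
        "P' r2 ! 0 = src (s' (T' j))" "P' r2 ! 1 = src (s' (T' (j + 1)))"
        using atP[of 0] atP[of 1] atP'[of 0] atP'[of 1] N by simp_all
      have "set (letter_trace Q \<rho> \<sigma> \<epsilon> (P r1 ! 0) (P r1 ! 1)) \<inter>
          set (letter_trace Q \<rho> \<sigma> \<epsilon> (P' r2 ! 0) (P' r2 ! 1)) \<noteq> {}"
        unfolding at A.letter_trace_run B.letter_trace_run using L0(2)[OF True] by auto
      moreover have "P r1 ! 0 \<prec> P r1 ! 1 \<longleftrightarrow> P' r2 ! 0 \<prec> P' r2 ! 1"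
        unfolding at up up' using L0(1)[OF True] by simp
      moreover have "P r1 = [P r1 ! 0] @ [P r1 ! 1] @ drop 2 (P r1)"
        "P' r2 = [P' r2 ! 0] @ [P' r2 ! 1] @ drop 2 (P' r2)"
        using list_split_at_two[of 0 "P r1"] list_split_at_two[of 0 "P' r2"] N len
        by (simp_all add: numeral_2_eq_2)
      moreover have "P r1 ! 1 \<prec> P' r2 ! 1" using ends(2) True by simp
      ultimately have V2 unfolding V2_def using ends(1) by blast
      then show ?thesis ..
    qed
  qed
  ultimately show ?thesis
    unfolding wpc s_T_c_def s'_T'_c'_def by blast
qed

end

section \<open>Representations without nilpotent endomorphisms\<close>

lemma sum_delta_mult:
  fixes f :: "nat \<Rightarrow> 'k :: semiring_1"
  shows "(\<Sum>k = 0..<n. (if k = h then 1 else 0) * f k) = (if h < n then f h else 0)"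
    and "(\<Sum>k = 0..<n. f k * (if k = h then 1 else 0)) = (if h < n then f h else 0)"
    and "(\<Sum>k = 0..<n. f k * (if h = k then 1 else 0)) = (if h < n then f h else 0)"
  by (simp_all add: if_distrib[of "\<lambda>x. x * _"] if_distrib[of "\<lambda>x. _ * x"] cong: if_cong)

section \<open>Inclusions and projections of a direct sum of two spaces, as matrices\<close>

definition inl_mat :: "nat \<Rightarrow> nat \<Rightarrow> 'k :: semiring_1 mat" where
  "inl_mat m n = mat (m + n) m (\<lambda>(i, j). if j = i then 1 else 0)"

definition inr_mat :: "nat \<Rightarrow> nat \<Rightarrow> 'k :: semiring_1 mat" where
  "inr_mat m n = mat (m + n) n (\<lambda>(i, j). if i = m + j then 1 else 0)"

definition prl_mat :: "nat \<Rightarrow> nat \<Rightarrow> 'k :: semiring_1 mat" where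
  "prl_mat m n = mat m (m + n) (\<lambda>(i, j). if j = i then 1 else 0)"

definition prr_mat :: "nat \<Rightarrow> nat \<Rightarrow> 'k :: semiring_1 mat" where
  "prr_mat m n = mat n (m + n) (\<lambda>(i, j). if j = m + i then 1 else 0)"

lemma biproduct_mat_carrier [simp]:
  "inl_mat m n \<in> carrier_mat (m + n) m" "inr_mat m n \<in> carrier_mat (m + n) n"
  "prl_mat m n \<in> carrier_mat m (m + n)" "prr_mat m n \<in> carrier_mat n (m + n)"
  by (simp_all add: inl_mat_def inr_mat_def prl_mat_def prr_mat_def)

lemma inl_mat_mult:
  assumes "B \<in> carrier_mat m k"
  shows "inl_mat m n * B = mat (m + n) k (\<lambda>(i, j). if i < m then B $$ (i, j) else 0)"
  using assms by (intro eq_matI) (auto simp: inl_mat_def scalar_prod_def sum_delta_mult)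

lemma inr_mat_mult:
  assumes "B \<in> carrier_mat n k"
  shows "inr_mat m n * B = mat (m + n) k (\<lambda>(i, j). if i < m then 0 else B $$ (i - m, j))"
proof (intro eq_matI)
  fix i j assume ij: "i < dim_row (mat (m + n) k (\<lambda>(i, j). if i < m then 0 else B $$ (i - m, j)))"
    "j < dim_col (mat (m + n) k (\<lambda>(i, j). if i < m then 0 else B $$ (i - m, j)))"
  \<comment> \<open>A row of the upper block selects no r at all; n serves as an index outside the
    range of the sum.\<close>
  have "(if i = m + r then 1 else 0) = (if r = (if i < m then n else i - m) then 1 else 0 :: 'a)" if
      "r < n" for r
    using that by auto
  then have "(\<Sum>r = 0..<n. (if i = m + r then 1 else 0) * B $$ (r, j)) =
      (\<Sum>r = 0..<n. (if r = (if i < m then n else i - m) then 1 else 0) * B $$ (r, j))"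
    by (intro sum.cong) auto
  also have "\<dots> = (if i < m then 0 else B $$ (i - m, j))"
    unfolding sum_delta_mult using ij by auto
  finally show "(inr_mat m n * B) $$ (i, j) =
      mat (m + n) k (\<lambda>(i, j). if i < m then 0 else B $$ (i - m, j)) $$ (i, j)"
    using ij assms by (auto simp: inr_mat_def scalar_prod_def)
qed (use assms in \<open>auto simp: inr_mat_def\<close>)

lemma prl_mat_mult:
  assumes "B \<in> carrier_mat (m + n) k"
  shows "prl_mat m n * B = mat m k (\<lambda>(i, j). B $$ (i, j))"
  using assms by (intro eq_matI) (auto simp: prl_mat_def scalar_prod_def sum_delta_mult)

lemma prr_mat_mult:
  assumes "B \<in> carrier_mat (m + n) k"
  shows "prr_mat m n * B = mat n k (\<lambda>(i, j). B $$ (m + i, j))"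
  using assms by (intro eq_matI) (auto simp: prr_mat_def scalar_prod_def sum_delta_mult)

lemma mult_inl_mat:
  assumes "B \<in> carrier_mat k (m + n)"
  shows "B * inl_mat m n = mat k m (\<lambda>(i, j). B $$ (i, j))"
  using assms
  by (intro eq_matI) (auto simp: inl_mat_def scalar_prod_def sum_delta_mult)

lemma mult_inr_mat:
  assumes "B \<in> carrier_mat k (m + n)"
  shows "B * inr_mat m n = mat k n (\<lambda>(i, j). B $$ (i, m + j))"
  using assms by (intro eq_matI) (auto simp: inr_mat_def scalar_prod_def sum_delta_mult)

lemma mult_prl_mat:
  assumes "B \<in> carrier_mat k m"
  shows "B * prl_mat m n = mat k (m + n) (\<lambda>(i, j). if j < m then B $$ (i, j) else 0)"
  using assms
  by (intro eq_matI) (auto simp: prl_mat_def scalar_prod_def sum_delta_mult)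

lemma mult_prr_mat:
  assumes "B \<in> carrier_mat k n"
  shows "B * prr_mat m n = mat k (m + n) (\<lambda>(i, j). if j < m then 0 else B $$ (i, j - m))"
proof (intro eq_matI)
  fix i j assume ij: "i < dim_row (mat k (m + n) (\<lambda>(i, j). if j < m then 0 else B $$ (i, j - m)))"
    "j < dim_col (mat k (m + n) (\<lambda>(i, j). if j < m then 0 else B $$ (i, j - m)))"
  have "(if j = m + r then 1 else 0) = (if r = (if j < m then n else j - m) then 1 else 0 :: 'a)" if
      "r < n" for r
    using that by auto
  then have "(\<Sum>r = 0..<n. B $$ (i, r) * (if j = m + r then 1 else 0)) =
      (\<Sum>r = 0..<n. B $$ (i, r) * (if r = (if j < m then n else j - m) then 1 else 0))"
    by (intro sum.cong) auto
  also have "\<dots> = (if j < m then 0 else B $$ (i, j - m))"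
    unfolding sum_delta_mult using ij by auto
  finally show "(B * prr_mat m n) $$ (i, j) =
      mat k (m + n) (\<lambda>(i, j). if j < m then 0 else B $$ (i, j - m)) $$ (i, j)"
    using ij assms by (auto simp: prr_mat_def scalar_prod_def)
qed (use assms in \<open>auto simp: prr_mat_def\<close>)

text \<open>Only the shapes of the matrices. Morphisms, sums and square-zero endomorphisms are
  treated at this level, which covers band modules with Jordan blocks of any size; the relations are
  checked for one-dimensional components, where bricks are exhibited.\<close>

definition rep_ok :: "('v, 'a) pre_digraph \<Rightarrow> ('v, 'a, 'k :: field) rep \<Rightarrow> bool" where
  "rep_ok Q M \<longleftrightarrow> (\<forall>a\<in>arcs Q. rmat M a \<in> carrier_mat (rdim M (head Q a)) (rdim M (tail Q a)))"

lemma is_module_rep_ok: "is_module Q \<rho> M \<Longrightarrow> rep_ok Q M"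
  by (simp add: is_module_def rep_ok_def)

definition hom_zero :: "('v, 'a) pre_digraph \<Rightarrow> ('v, 'a, 'k :: field) rep \<Rightarrow> ('v, 'a, 'k) rep \<Rightarrow> bool"
    where
  "hom_zero Q M N \<longleftrightarrow> (\<forall>f\<in>rep_hom Q M N. f = rep_zero Q M N)"

text \<open>Squares are enough to exclude all nilpotent endomorphisms: a non-zero nilpotent one has
  a non-zero power of square zero.\<close>

definition reduced :: "('v, 'a) pre_digraph \<Rightarrow> ('v, 'a, 'k :: field) rep \<Rightarrow> bool" where
  "reduced Q M \<longleftrightarrow> (\<forall>f\<in>rep_hom Q M M. rep_comp Q f f = rep_zero Q M M \<longrightarrow> f = rep_zero Q M M)"

context wf_digraph
begin

lemma rep_hom_carrier:
  "f \<in> rep_hom G M N \<Longrightarrow> v \<in> verts G \<Longrightarrow> f v \<in> carrier_mat (rdim N v) (rdim M v)"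
  by (auto simp: rep_hom_def)

lemma rep_hom_commute:
  "f \<in> rep_hom G M N \<Longrightarrow> a \<in> arcs G \<Longrightarrow> f (head G a) * rmat M a = rmat N a * f (tail G a)"
  by (auto simp: rep_hom_def)

lemma rep_hom_restrictI:
  assumes "\<And>v. v \<in> verts G \<Longrightarrow> f v \<in> carrier_mat (rdim N v) (rdim M v)"
    and "\<And>a. a \<in> arcs G \<Longrightarrow> f (head G a) * rmat M a = rmat N a * f (tail G a)"
  shows "(\<lambda>v\<in>verts G. f v) \<in> rep_hom G M N"
  using assms by (auto simp: rep_hom_def)

lemma rep_hom_eqI:
  assumes "f \<in> rep_hom G M N" "g \<in> rep_hom G M N" "\<And>v. v \<in> verts G \<Longrightarrow> f v = g v"
  shows "f = g"
  using assms unfolding rep_hom_def by (auto intro: PiE_ext)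

lemma rep_zero_hom [simp]:
  assumes "rep_ok G M" "rep_ok G N"
  shows "rep_zero G M N \<in> rep_hom G M N"
  unfolding rep_zero_def
proof (rule rep_hom_restrictI)
  fix a assume a: "a \<in> arcs G"
  then have "rmat M a \<in> carrier_mat (rdim M (head G a)) (rdim M (tail G a))"
    "rmat N a \<in> carrier_mat (rdim N (head G a)) (rdim N (tail G a))"
    using assms by (auto simp: rep_ok_def)
  then show "0\<^sub>m (rdim N (head G a)) (rdim M (head G a)) * rmat M a =
      rmat N a * 0\<^sub>m (rdim N (tail G a)) (rdim M (tail G a))"
    by simp
qed simp

lemma rep_id_hom [simp]:
  assumes "rep_ok G M"
  shows "rep_id G M \<in> rep_hom G M M"
  unfolding rep_id_def
proof (rule rep_hom_restrictI)
  fix a assume a: "a \<in> arcs G"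
  then have "rmat M a \<in> carrier_mat (rdim M (head G a)) (rdim M (tail G a))"
    using assms by (auto simp: rep_ok_def)
  then show "1\<^sub>m (rdim M (head G a)) * rmat M a = rmat M a * 1\<^sub>m (rdim M (tail G a))"
    by simp
qed simp

lemma rep_comp_hom:
  assumes ok: "rep_ok G M" "rep_ok G N" "rep_ok G P"
    and f: "f \<in> rep_hom G M N" and g: "g \<in> rep_hom G N P"
  shows "rep_comp G g f \<in> rep_hom G M P"
  unfolding rep_comp_def
proof (rule rep_hom_restrictI)
  show "g v * f v \<in> carrier_mat (rdim P v) (rdim M v)" if "v \<in> verts G" for v
    using rep_hom_carrier[OF f that] rep_hom_carrier[OF g that] by simp
next
  fix a assume a: "a \<in> arcs G"
  then have v: "head G a \<in> verts G" "tail G a \<in> verts G" by simp_all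
  note c = rep_hom_carrier[OF f v(1)] rep_hom_carrier[OF f v(2)]
    rep_hom_carrier[OF g v(1)] rep_hom_carrier[OF g v(2)]
  have r: "rmat M a \<in> carrier_mat (rdim M (head G a)) (rdim M (tail G a))"
    "rmat N a \<in> carrier_mat (rdim N (head G a)) (rdim N (tail G a))"
    "rmat P a \<in> carrier_mat (rdim P (head G a)) (rdim P (tail G a))"
    using ok a by (auto simp: rep_ok_def)
  have "g (head G a) * f (head G a) * rmat M a = g (head G a) * (f (head G a) * rmat M a)"
    using c r by (intro assoc_mult_mat)
  also have "\<dots> = g (head G a) * (rmat N a * f (tail G a))" using rep_hom_commute[OF f a] by simp
  also have "\<dots> = g (head G a) * rmat N a * f (tail G a)"
    using c r by (intro assoc_mult_mat[symmetric])
  also have "\<dots> = rmat P a * g (tail G a) * f (tail G a)" using rep_hom_commute[OF g a] by simp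
  also have "\<dots> = rmat P a * (g (tail G a) * f (tail G a))"
    using c r by (intro assoc_mult_mat)
  finally show "g (head G a) * f (head G a) * rmat M a = rmat P a * (g (tail G a) * f (tail G a))" .
qed

lemma rep_comp_assoc:
  assumes "f \<in> rep_hom G M N" "g \<in> rep_hom G N P" "h \<in> rep_hom G P R"
  shows "rep_comp G (rep_comp G h g) f = rep_comp G h (rep_comp G g f)"
  unfolding rep_comp_def
proof (rule restrict_ext)
  fix v assume "v \<in> verts G"
  then show "(\<lambda>v\<in>verts G. h v * g v) v * f v = h v * (\<lambda>v\<in>verts G. g v * f v) v"
    using assoc_mult_mat[OF rep_hom_carrier[OF assms(3)] rep_hom_carrier[OF assms(2)]
        rep_hom_carrier[OF assms(1)]] by simp
qed

lemma rep_comp_zero: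
  assumes "f \<in> rep_hom G M N"
  shows "rep_comp G f (rep_zero G P M) = rep_zero G P N"
    and "rep_comp G (rep_zero G N P) f = rep_zero G M P"
proof -
  show "rep_comp G f (rep_zero G P M) = rep_zero G P N"
    unfolding rep_comp_def rep_zero_def
    by (rule restrict_ext) (simp add: right_mult_zero_mat[OF rep_hom_carrier[OF assms]])
  show "rep_comp G (rep_zero G N P) f = rep_zero G M P"
    unfolding rep_comp_def rep_zero_def
    by (rule restrict_ext) (simp add: left_mult_zero_mat[OF rep_hom_carrier[OF assms]])
qed

lemma rep_comp_id:
  assumes "f \<in> rep_hom G M N"
  shows "rep_comp G f (rep_id G M) = f" and "rep_comp G (rep_id G N) f = f"
proof -
  have e: "f = restrict f (verts G)" using assms by (auto simp: rep_hom_def PiE_restrict)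
  have "rep_comp G f (rep_id G M) = restrict f (verts G)"
    unfolding rep_comp_def rep_id_def
    by (rule restrict_ext) (simp add: right_mult_one_mat[OF rep_hom_carrier[OF assms]])
  then show "rep_comp G f (rep_id G M) = f" using e by simp
  have "rep_comp G (rep_id G N) f = restrict f (verts G)"
    unfolding rep_comp_def rep_id_def
    by (rule restrict_ext) (simp add: left_mult_one_mat[OF rep_hom_carrier[OF assms]])
  then show "rep_comp G (rep_id G N) f = f" using e by simp
qed

lemma rep_iso_refl: "rep_ok G M \<Longrightarrow> rep_iso G M M"
  unfolding rep_iso_def using rep_id_hom rep_comp_id by blast

text \<open>Conjugation by the isomorphism preserves square zero, and w h = f w allows f to be
  recovered from its conjugate h.\<close>

lemma reduced_iso:
  assumes ok: "rep_ok G M" "rep_ok G N" and "rep_iso G M N" and "reduced G N"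
  shows "reduced G M"
  unfolding reduced_def
proof (intro ballI impI)
  fix f assume f: "f \<in> rep_hom G M M" and f2: "rep_comp G f f = rep_zero G M M"
  obtain u w where u: "u \<in> rep_hom G M N" and w: "w \<in> rep_hom G N M"
    and wu: "rep_comp G w u = rep_id G M"
    using assms(3) unfolding rep_iso_def by blast
  define h where "h = rep_comp G u (rep_comp G f w)"
  have fw: "rep_comp G f w \<in> rep_hom G N M" using rep_comp_hom ok f w by blast
  have h: "h \<in> rep_hom G N N" unfolding h_def using rep_comp_hom ok fw u by blast
  have wh: "rep_comp G w h = rep_comp G f w"
    unfolding h_def using rep_comp_assoc[OF fw u w] wu rep_comp_id(2)[OF fw] by simp
  have "rep_comp G h h = rep_comp G u (rep_comp G (rep_comp G f w) h)"
    using rep_comp_assoc[OF h fw u] unfolding h_def by simp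
  also have "rep_comp G (rep_comp G f w) h = rep_comp G f (rep_comp G f w)"
    using rep_comp_assoc[OF h w f] wh by simp
  also have "\<dots> = rep_comp G (rep_comp G f f) w"
    using rep_comp_assoc[OF w f f] by simp
  also have "\<dots> = rep_zero G N M" using f2 rep_comp_zero(2)[OF w] by simp
  also have "rep_comp G u (rep_zero G N M) = rep_zero G N N" using rep_comp_zero(1)[OF u] .
  finally have "h = rep_zero G N N" using assms(4) h unfolding reduced_def by blast
  then have "rep_comp G f w = rep_zero G N M" using wh rep_comp_zero(1)[OF w] by simp
  then have "rep_comp G (rep_zero G N M) u = rep_comp G f (rep_comp G w u)"
    using rep_comp_assoc[OF u w f] by simp
  then show "f = rep_zero G M M"
    using wu rep_comp_id(1)[OF f] rep_comp_zero(2)[OF u] by simp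
qed

text \<open>The endomorphism ring embeds in a field. That the isomorphism preserves zero is obtained
  from 0 + 0 = 0.\<close>

lemma reduced_brick:
  assumes "is_brick G \<rho> M"
  shows "reduced G M"
  unfolding reduced_def
proof (intro ballI impI)
  fix f assume f: "f \<in> rep_hom G M M" and f2: "rep_comp G f f = rep_zero G M M"
  have ok: "rep_ok G M" using assms is_module_rep_ok unfolding is_brick_def by blast
  have z: "rep_zero G M M \<in> rep_hom G M M" using ok by simp
  obtain h where h: "h \<in> ring_iso (end_algebra G M) (ground_algebra :: ('c, 'c) module)"
    using assms unfolding is_brick_def is_alg_iso_def by blast
  have inj: "inj_on h (rep_hom G M M)"
    using ring_iso_memE(5)[OF h] unfolding end_algebra_def by (auto simp: bij_betw_def)
  have mult: "h (rep_comp G x y) = h x * h y" if "x \<in> rep_hom G M M" "y \<in> rep_hom G M M" for x y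
    using ring_iso_memE(2)[OF h, of x y] that by (simp add: end_algebra_def ground_algebra_def)
  have "rep_comp G (rep_zero G M M) (rep_zero G M M) = rep_zero G M M"
    using rep_comp_zero(1)[OF z] .
  moreover have "(\<lambda>v\<in>verts G. rep_zero G M M v + rep_zero G M M v) = rep_zero G M M"
    unfolding rep_zero_def by (rule restrict_ext) simp
  then have "h (rep_zero G M M) = h (rep_zero G M M) + h (rep_zero G M M)"
    using ring_iso_memE(3)[OF h, of "rep_zero G M M" "rep_zero G M M"] z
    by (simp add: end_algebra_def ground_algebra_def)
  then have h0: "h (rep_zero G M M) = 0" by (metis add_cancel_left_right)
  have "h f * h f = 0" using mult[OF f f] f2 h0 by simp
  then have "h f = h (rep_zero G M M)" using h0 by simp
  then show "f = rep_zero G M M" using inj f z by (auto dest: inj_onD)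
qed

lemma rep_sum_Cons:
  assumes "rep_ok G M" "rep_ok G (rep_sum Ms)"
  shows "rdim (rep_sum (M # Ms)) v = rdim M v + rdim (rep_sum Ms) v"
    and "a \<in> arcs G \<Longrightarrow> rmat (rep_sum (M # Ms)) a = four_block_mat (rmat M a)
      (0\<^sub>m (rdim M (head G a)) (rdim (rep_sum Ms) (tail G a)))
      (0\<^sub>m (rdim (rep_sum Ms) (head G a)) (rdim M (tail G a))) (rmat (rep_sum Ms) a)"
proof -
  show "rdim (rep_sum (M # Ms)) v = rdim M v + rdim (rep_sum Ms) v"
    by (simp add: rep_sum_def)
  assume "a \<in> arcs G"
  then have "rmat M a \<in> carrier_mat (rdim M (head G a)) (rdim M (tail G a))"
    "rmat (rep_sum Ms) a \<in> carrier_mat (rdim (rep_sum Ms) (head G a)) (rdim (rep_sum Ms)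
        (tail G a))"
    using assms by (auto simp: rep_ok_def)
  then show "rmat (rep_sum (M # Ms)) a = four_block_mat (rmat M a)
      (0\<^sub>m (rdim M (head G a)) (rdim (rep_sum Ms) (tail G a)))
      (0\<^sub>m (rdim (rep_sum Ms) (head G a)) (rdim M (tail G a))) (rmat (rep_sum Ms) a)"
    by (simp add: rep_sum_def Let_def)
qed

lemma rep_ok_rep_sum:
  assumes "\<And>M. M \<in> set Ms \<Longrightarrow> rep_ok G M"
  shows "rep_ok G (rep_sum Ms)"
  using assms
proof (induction Ms)
  case Nil
  then show ?case by (simp add: rep_ok_def rep_sum_def)
next
  case (Cons M Ms)
  then have ok: "rep_ok G M" "rep_ok G (rep_sum Ms)" by simp_all
  show ?case
    using ok unfolding rep_ok_def by (simp add: rep_sum_Cons[OF ok])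
qed

end

text \<open>A biproduct S of M and N. The properties \<open>joint_epi\<close> and
  \<open>joint_mono\<close> take the place of the identity \<open>il pl + ir pr = id\<close>, so
  that no sums of morphisms are involved.\<close>

locale rep_biproduct = wf_digraph G for G :: "('v, 'a) pre_digraph" +
  fixes M N S :: "('v, 'a, 'k :: field) rep" and il ir pl pr
  assumes ok: "rep_ok G M" "rep_ok G N" "rep_ok G S"
    and homs: "il \<in> rep_hom G M S" "ir \<in> rep_hom G N S" "pl \<in> rep_hom G S M" "pr \<in> rep_hom G S N"
    and inverse: "rep_comp G pl il = rep_id G M" "rep_comp G pr ir = rep_id G N"
    and cross: "rep_comp G pl ir = rep_zero G N M" "rep_comp G pr il = rep_zero G M N"
    and joint_epi: "\<And>X f g. \<lbrakk>f \<in> rep_hom G S X; g \<in> rep_hom G S X;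
      rep_comp G f il = rep_comp G g il; rep_comp G f ir = rep_comp G g ir\<rbrakk> \<Longrightarrow> f = g"
    and joint_mono: "\<And>X f g. \<lbrakk>f \<in> rep_hom G X S; g \<in> rep_hom G X S;
      rep_comp G pl f = rep_comp G pl g; rep_comp G pr f = rep_comp G pr g\<rbrakk> \<Longrightarrow> f = g"
begin

lemma hom_zero_from_sum:
  assumes X: "rep_ok G X"
  shows "hom_zero G S X \<longleftrightarrow> hom_zero G M X \<and> hom_zero G N X"
proof
  assume z: "hom_zero G S X"
  have "f = rep_zero G M X" if f: "f \<in> rep_hom G M X" for f
  proof -
    have "rep_comp G f pl \<in> rep_hom G S X" using rep_comp_hom ok X homs f by blast
    then have "rep_comp G f pl = rep_zero G S X" using z by (simp add: hom_zero_def)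
    then have "rep_comp G f (rep_comp G pl il) = rep_comp G (rep_zero G S X) il"
      using rep_comp_assoc[OF homs(1,3) f] by simp
    then show ?thesis using inverse rep_comp_id(1)[OF f] rep_comp_zero(2)[OF homs(1)] by simp
  qed
  moreover have "f = rep_zero G N X" if f: "f \<in> rep_hom G N X" for f
  proof -
    have "rep_comp G f pr \<in> rep_hom G S X" using rep_comp_hom ok X homs f by blast
    then have "rep_comp G f pr = rep_zero G S X" using z by (simp add: hom_zero_def)
    then have "rep_comp G f (rep_comp G pr ir) = rep_comp G (rep_zero G S X) ir"
      using rep_comp_assoc[OF homs(2,4) f] by simp
    then show ?thesis using inverse rep_comp_id(1)[OF f] rep_comp_zero(2)[OF homs(2)] by simp
  qed
  ultimately show "hom_zero G M X \<and> hom_zero G N X" by (simp add: hom_zero_def)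
next
  assume z: "hom_zero G M X \<and> hom_zero G N X"
  show "hom_zero G S X"
    unfolding hom_zero_def
  proof
    fix f assume f: "f \<in> rep_hom G S X"
    have "rep_comp G f il \<in> rep_hom G M X" "rep_comp G f ir \<in> rep_hom G N X"
      using rep_comp_hom ok X homs f by blast+
    then have "rep_comp G f il = rep_zero G M X" "rep_comp G f ir = rep_zero G N X"
      using z by (auto simp: hom_zero_def)
    then show "f = rep_zero G S X"
      using f X ok homs by - (rule joint_epi[of f X], simp_all add: rep_comp_zero(2))
  qed
qed

lemma hom_zero_to_sum:
  assumes X: "rep_ok G X"
  shows "hom_zero G X S \<longleftrightarrow> hom_zero G X M \<and> hom_zero G X N"
proof
  assume z: "hom_zero G X S"
  have "f = rep_zero G X M" if f: "f \<in> rep_hom G X M" for f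
  proof -
    have "rep_comp G il f \<in> rep_hom G X S" using rep_comp_hom ok X homs f by blast
    then have "rep_comp G il f = rep_zero G X S" using z by (simp add: hom_zero_def)
    then have "rep_comp G (rep_comp G pl il) f = rep_comp G pl (rep_zero G X S)"
      using rep_comp_assoc[OF f homs(1,3)] by simp
    then show ?thesis using inverse rep_comp_id(2)[OF f] rep_comp_zero(1)[OF homs(3)] by simp
  qed
  moreover have "f = rep_zero G X N" if f: "f \<in> rep_hom G X N" for f
  proof -
    have "rep_comp G ir f \<in> rep_hom G X S" using rep_comp_hom ok X homs f by blast
    then have "rep_comp G ir f = rep_zero G X S" using z by (simp add: hom_zero_def)
    then have "rep_comp G (rep_comp G pr ir) f = rep_comp G pr (rep_zero G X S)"
      using rep_comp_assoc[OF f homs(2,4)] by simp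
    then show ?thesis using inverse rep_comp_id(2)[OF f] rep_comp_zero(1)[OF homs(4)] by simp
  qed
  ultimately show "hom_zero G X M \<and> hom_zero G X N" by (simp add: hom_zero_def)
next
  assume z: "hom_zero G X M \<and> hom_zero G X N"
  show "hom_zero G X S"
    unfolding hom_zero_def
  proof
    fix f assume f: "f \<in> rep_hom G X S"
    have "rep_comp G pl f \<in> rep_hom G X M" "rep_comp G pr f \<in> rep_hom G X N"
      using rep_comp_hom ok X homs f by blast+
    then have "rep_comp G pl f = rep_zero G X M" "rep_comp G pr f = rep_zero G X N"
      using z by (auto simp: hom_zero_def)
    then show "f = rep_zero G X S"
      using f X ok homs by - (rule joint_mono[of f X], simp_all add: rep_comp_zero(1))
  qed
qed

text \<open>Extending \<open>f\<close> by zero gives the endomorphism \<open>i f p\<close> of the sum, whose square is zero.\<close>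

lemma square_zero_extend:
  assumes red: "reduced G S" and X: "rep_ok G X" "rep_ok G Y"
    and i: "i \<in> rep_hom G Y S" and p: "p \<in> rep_hom G S X" and f: "f \<in> rep_hom G X Y"
    and i': "i' \<in> rep_hom G X S" "rep_comp G p i' = rep_id G X"
    and p': "p' \<in> rep_hom G S Y" "rep_comp G p' i = rep_id G Y"
    and zero: "rep_comp G f (rep_comp G (rep_comp G p i) f) = rep_zero G X Y"
  shows "f = rep_zero G X Y"
proof -
  have fp: "rep_comp G f p \<in> rep_hom G S Y" using rep_comp_hom ok X f p by blast
  \<comment> \<open>The middle part of h h is f (p i) f. If X and Y are the same summand, p i is the
    identity and f has square zero; if they are different, p i vanishes. The hypothesis
    \<open>zero\<close> covers both.\<close>
  define h where "h = rep_comp G i (rep_comp G f p)"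
  have h: "h \<in> rep_hom G S S" unfolding h_def using rep_comp_hom ok X i fp by blast
  have pi: "rep_comp G p i \<in> rep_hom G Y X" using rep_comp_hom ok X i p by blast
  have pif: "rep_comp G (rep_comp G p i) f \<in> rep_hom G X X" using rep_comp_hom X pi f by blast
  have "rep_comp G h h = rep_comp G i (rep_comp G (rep_comp G f p) h)"
    using rep_comp_assoc[OF h fp i] by (simp add: h_def)
  also have "rep_comp G (rep_comp G f p) h = rep_comp G f (rep_comp G p h)"
    using rep_comp_assoc[OF h p f] .
  also have "rep_comp G p h = rep_comp G (rep_comp G p i) (rep_comp G f p)"
    using rep_comp_assoc[OF fp i p] by (simp add: h_def)
  also have "\<dots> = rep_comp G (rep_comp G (rep_comp G p i) f) p"
    using rep_comp_assoc[OF p f pi] by simp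
  also have "rep_comp G f \<dots> = rep_comp G (rep_zero G X Y) p"
    using rep_comp_assoc[OF p pif f] zero by simp
  also have "\<dots> = rep_zero G S Y" using rep_comp_zero(2)[OF p] .
  also have "rep_comp G i \<dots> = rep_zero G S S" using rep_comp_zero(1)[OF i] .
  finally have h0: "h = rep_zero G S S" using red h by (simp add: reduced_def)
  \<comment> \<open>The retraction p' of i and the section i' of p strip h down to f.\<close>
  have "rep_comp G p' h = rep_comp G f p"
    using rep_comp_assoc[OF fp i p'(1)] p'(2) rep_comp_id(2)[OF fp] by (simp add: h_def)
  then have "rep_comp G f p = rep_zero G S Y" using h0 rep_comp_zero(1)[OF p'(1)] by simp
  then have "rep_comp G f (rep_comp G p i') = rep_zero G X Y"
    using rep_comp_assoc[OF i'(1) p f] rep_comp_zero(2)[OF i'(1)] by simp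
  then show ?thesis using i'(2) rep_comp_id(1)[OF f] by simp
qed

text \<open>From left to right, \<open>square_zero_extend\<close> applies to all four pairs of
  summands. From right to left, vanishing morphisms between the summands make every endomorphism
  block diagonal, so the blocks of a square-zero one have square zero as well.\<close>

lemma reduced_sum_iff:
  "reduced G S \<longleftrightarrow> reduced G M \<and> reduced G N \<and> hom_zero G M N \<and> hom_zero G N M"
proof
  assume red: "reduced G S"
  have "reduced G M"
    unfolding reduced_def
  proof (intro ballI impI)
    fix f assume f: "f \<in> rep_hom G M M" "rep_comp G f f = rep_zero G M M"
    then show "f = rep_zero G M M"
      using inverse rep_comp_id(2)[OF f(1)] ok homs
      by - (rule square_zero_extend[OF red, where i = il and p = pl and i' = il and p' = pl],
          simp_all)
  qed
  moreover have "reduced G N"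
    unfolding reduced_def
  proof (intro ballI impI)
    fix f assume f: "f \<in> rep_hom G N N" "rep_comp G f f = rep_zero G N N"
    then show "f = rep_zero G N N"
      using inverse rep_comp_id(2)[OF f(1)] ok homs
      by - (rule square_zero_extend[OF red, where i = ir and p = pr and i' = ir and p' = pr],
          simp_all)
  qed
  moreover have "hom_zero G M N"
    unfolding hom_zero_def
  proof
    fix f assume f: "f \<in> rep_hom G M N"
    then show "f = rep_zero G M N"
      using inverse cross rep_comp_zero[OF f] ok homs
      by - (rule square_zero_extend[OF red, where i = ir and p = pl and i' = il and p' = pr],
          simp_all)
  qed
  moreover have "hom_zero G N M"
    unfolding hom_zero_def
  proof
    fix f assume f: "f \<in> rep_hom G N M"
    then show "f = rep_zero G N M"
      using inverse cross rep_comp_zero[OF f] ok homs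
      by - (rule square_zero_extend[OF red, where i = il and p = pr and i' = ir and p' = pl],
          simp_all)
  qed
  ultimately show "reduced G M \<and> reduced G N \<and> hom_zero G M N \<and> hom_zero G N M" by blast
next
  assume r: "reduced G M \<and> reduced G N \<and> hom_zero G M N \<and> hom_zero G N M"
  \<comment> \<open>On a summand X that f preserves, f acts by the block g = p f i, whose square
    vanishes with that of f.\<close>
  have component: "rep_comp G f i = rep_zero G X S"
    if f: "f \<in> rep_hom G S S" "rep_comp G f f = rep_zero G S S" and X: "rep_ok G X" "reduced G X"
      and ip: "i \<in> rep_hom G X S" "p \<in> rep_hom G S X"
      and fi: "rep_comp G f i = rep_comp G i (rep_comp G p (rep_comp G f i))" for f i p X
  proof -
    have fi_hom: "rep_comp G f i \<in> rep_hom G X S" using rep_comp_hom ok X f ip by blast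
    define g where "g = rep_comp G p (rep_comp G f i)"
    have g: "g \<in> rep_hom G X X" unfolding g_def using rep_comp_hom ok X fi_hom ip by blast
    have "rep_comp G g g = rep_comp G p (rep_comp G (rep_comp G f i) g)"
      using rep_comp_assoc[OF g fi_hom ip(2)] by (simp add: g_def)
    also have "rep_comp G (rep_comp G f i) g = rep_comp G f (rep_comp G f i)"
      using rep_comp_assoc[OF g ip(1) f(1)] fi by (simp add: g_def)
    also have "\<dots> = rep_zero G X S"
      using rep_comp_assoc[OF ip(1) f(1) f(1)] f(2) rep_comp_zero(2)[OF ip(1)] by simp
    also have "rep_comp G p \<dots> = rep_zero G X X" using rep_comp_zero(1)[OF ip(2)] .
    finally have "g = rep_zero G X X" using X(2) g by (simp add: reduced_def)
    then show ?thesis using fi rep_comp_zero(1)[OF ip(1)] by (simp add: g_def)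
  qed
  show "reduced G S"
    unfolding reduced_def
  proof (intro ballI impI)
    fix f assume f: "f \<in> rep_hom G S S" "rep_comp G f f = rep_zero G S S"
    have fil: "rep_comp G f il \<in> rep_hom G M S" and fir: "rep_comp G f ir \<in> rep_hom G N S"
      using rep_comp_hom ok f homs by blast+
    have hs: "rep_comp G pl (rep_comp G f il) \<in> rep_hom G M M"
      "rep_comp G pr (rep_comp G f ir) \<in> rep_hom G N N"
      "rep_comp G pr (rep_comp G f il) \<in> rep_hom G M N"
      "rep_comp G pl (rep_comp G f ir) \<in> rep_hom G N M"
      using rep_comp_hom ok fil fir homs by blast+
    then have z: "rep_comp G pr (rep_comp G f il) = rep_zero G M N"
      "rep_comp G pl (rep_comp G f ir) = rep_zero G N M"
      using r by (auto simp: hom_zero_def)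
    have "rep_comp G f il = rep_comp G il (rep_comp G pl (rep_comp G f il))"
    proof (rule joint_mono[OF fil])
      show "rep_comp G il (rep_comp G pl (rep_comp G f il)) \<in> rep_hom G M S"
        using rep_comp_hom ok hs homs by blast
      show "rep_comp G pl (rep_comp G f il) =
          rep_comp G pl (rep_comp G il (rep_comp G pl (rep_comp G f il)))"
        using rep_comp_assoc[OF hs(1) homs(1,3)] inverse rep_comp_id(2)[OF hs(1)] by simp
      show "rep_comp G pr (rep_comp G f il) =
          rep_comp G pr (rep_comp G il (rep_comp G pl (rep_comp G f il)))"
        using rep_comp_assoc[OF hs(1) homs(1,4)] cross rep_comp_zero(2)[OF hs(1)] z by simp
    qed
    then have "rep_comp G f il = rep_zero G M S"
      using component[OF f, of M il pl] ok r homs by blast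
    moreover have "rep_comp G f ir = rep_comp G ir (rep_comp G pr (rep_comp G f ir))"
    proof (rule joint_mono[OF fir])
      show "rep_comp G ir (rep_comp G pr (rep_comp G f ir)) \<in> rep_hom G N S"
        using rep_comp_hom ok hs homs by blast
      show "rep_comp G pr (rep_comp G f ir) =
          rep_comp G pr (rep_comp G ir (rep_comp G pr (rep_comp G f ir)))"
        using rep_comp_assoc[OF hs(2) homs(2,4)] inverse rep_comp_id(2)[OF hs(2)] by simp
      show "rep_comp G pl (rep_comp G f ir) =
          rep_comp G pl (rep_comp G ir (rep_comp G pr (rep_comp G f ir)))"
        using rep_comp_assoc[OF hs(2) homs(2,3)] cross rep_comp_zero(2)[OF hs(2)] z by simp
    qed
    then have "rep_comp G f ir = rep_zero G N S"
      using component[OF f, of N ir pr] ok r homs by blast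
    ultimately show "f = rep_zero G S S"
      using f ok homs by - (rule joint_epi[of f S], simp_all add: rep_comp_zero(2))
  qed
qed

end

context wf_digraph
begin

text \<open>The block form in \<open>rep_sum_Cons\<close> splits off the first summand, so that
  statements about \<open>rep_sum\<close> follow by induction on the list.\<close>

lemma rep_sum_biproduct:
  assumes ok: "rep_ok G M" "rep_ok G (rep_sum Ms)" and S: "rep_ok G (rep_sum (M # Ms))"
  shows "rep_biproduct G M (rep_sum Ms) (rep_sum (M # Ms))
    (\<lambda>v\<in>verts G. inl_mat (rdim M v) (rdim (rep_sum Ms) v))
    (\<lambda>v\<in>verts G. inr_mat (rdim M v) (rdim (rep_sum Ms) v))
    (\<lambda>v\<in>verts G. prl_mat (rdim M v) (rdim (rep_sum Ms) v))
    (\<lambda>v\<in>verts G. prr_mat (rdim M v) (rdim (rep_sum Ms) v))"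
proof -
  define N where "N = rep_sum Ms"
  define S where "S = rep_sum (M # Ms)"
  have okN: "rep_ok G N" and okS: "rep_ok G S" using assms by (simp_all add: N_def S_def)
  have dim: "rdim S v = rdim M v + rdim N v" for v
    using rep_sum_Cons(1)[OF ok] by (simp add: N_def S_def)
  have mat: "rmat S a = four_block_mat (rmat M a)
      (0\<^sub>m (rdim M (head G a)) (rdim N (tail G a)))
      (0\<^sub>m (rdim N (head G a)) (rdim M (tail G a))) (rmat N a)" if "a \<in> arcs G" for a
    using rep_sum_Cons(2)[OF ok that] by (simp add: N_def S_def)
  have cM: "rmat M a \<in> carrier_mat (rdim M (head G a)) (rdim M (tail G a))"
    and cN: "rmat N a \<in> carrier_mat (rdim N (head G a)) (rdim N (tail G a))"
    and cS: "rmat S a \<in> carrier_mat (rdim M (head G a) + rdim N (head G a)) (rdim M (tail G a) +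
        rdim N (tail G a))"
    if "a \<in> arcs G" for a
    using that ok(1) okN okS unfolding rep_ok_def dim by auto
  have homs: "(\<lambda>v\<in>verts G. inl_mat (rdim M v) (rdim N v)) \<in> rep_hom G M S"
    "(\<lambda>v\<in>verts G. inr_mat (rdim M v) (rdim N v)) \<in> rep_hom G N S"
    "(\<lambda>v\<in>verts G. prl_mat (rdim M v) (rdim N v)) \<in> rep_hom G S M"
    "(\<lambda>v\<in>verts G. prr_mat (rdim M v) (rdim N v)) \<in> rep_hom G S N"
    subgoal
    proof (rule rep_hom_restrictI)
      fix a assume a: "a \<in> arcs G"
      show "inl_mat (rdim M (head G a)) (rdim N (head G a)) * rmat M a =
          rmat S a * inl_mat (rdim M (tail G a)) (rdim N (tail G a))"
        unfolding inl_mat_mult[OF cM[OF a]] mult_inl_mat[OF cS[OF a]]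
        using cM[OF a] cN[OF a] by (intro eq_matI) (auto simp: mat[OF a])
    qed (simp add: dim)
    subgoal
    proof (rule rep_hom_restrictI)
      fix a assume a: "a \<in> arcs G"
      show "inr_mat (rdim M (head G a)) (rdim N (head G a)) * rmat N a =
          rmat S a * inr_mat (rdim M (tail G a)) (rdim N (tail G a))"
        unfolding inr_mat_mult[OF cN[OF a]] mult_inr_mat[OF cS[OF a]]
        using cM[OF a] cN[OF a] by (intro eq_matI) (auto simp: mat[OF a])
    qed (simp add: dim)
    subgoal
    proof (rule rep_hom_restrictI)
      fix a assume a: "a \<in> arcs G"
      show "prl_mat (rdim M (head G a)) (rdim N (head G a)) * rmat S a =
          rmat M a * prl_mat (rdim M (tail G a)) (rdim N (tail G a))"
        unfolding prl_mat_mult[OF cS[OF a]] mult_prl_mat[OF cM[OF a]]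
        using cM[OF a] cN[OF a] by (intro eq_matI) (auto simp: mat[OF a])
    qed (simp add: dim)
    subgoal
    proof (rule rep_hom_restrictI)
      fix a assume a: "a \<in> arcs G"
      show "prr_mat (rdim M (head G a)) (rdim N (head G a)) * rmat S a =
          rmat N a * prr_mat (rdim M (tail G a)) (rdim N (tail G a))"
        unfolding prr_mat_mult[OF cS[OF a]] mult_prr_mat[OF cN[OF a]]
        using cM[OF a] cN[OF a] by (intro eq_matI) (auto simp: mat[OF a])
    qed (simp add: dim)
    done
  have "rep_biproduct G M N S (\<lambda>v\<in>verts G. inl_mat (rdim M v) (rdim N v))
    (\<lambda>v\<in>verts G. inr_mat (rdim M v) (rdim N v)) (\<lambda>v\<in>verts G. prl_mat (rdim M v) (rdim N v))
    (\<lambda>v\<in>verts G. prr_mat (rdim M v) (rdim N v))"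
  proof (unfold_locales, rule ok(1), rule okN, rule okS, rule homs(1), rule homs(2), rule homs(3),
      rule homs(4))
    have 1: "prl_mat (rdim M v) (rdim N v) * inl_mat (rdim M v) (rdim N v) = (1\<^sub>m (rdim M v)
        :: 'c mat)" for v
      by (subst prl_mat_mult[where k = "rdim M v"]) (auto intro!: eq_matI simp: inl_mat_def)
    have 2: "prr_mat (rdim M v) (rdim N v) * inr_mat (rdim M v) (rdim N v) = (1\<^sub>m (rdim N v)
        :: 'c mat)" for v
      by (subst prr_mat_mult[where k = "rdim N v"]) (auto intro!: eq_matI simp: inr_mat_def)
    have 3: "prl_mat (rdim M v) (rdim N v) * inr_mat (rdim M v) (rdim N v) = (0\<^sub>m (rdim M v)
        (rdim N v) :: 'c mat)" for v
      by (subst prl_mat_mult[where k = "rdim N v"]) (auto intro!: eq_matI simp: inr_mat_def)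
    have 4: "prr_mat (rdim M v) (rdim N v) * inl_mat (rdim M v) (rdim N v) = (0\<^sub>m (rdim N v)
        (rdim M v) :: 'c mat)" for v
      by (subst prr_mat_mult[where k = "rdim M v"]) (auto intro!: eq_matI simp: inl_mat_def)
    from 1 2 3 4 show
      "rep_comp G (\<lambda>v\<in>verts G. prl_mat (rdim M v) (rdim N v)) (\<lambda>v\<in>verts G. inl_mat (rdim M v)
          (rdim N v)) = rep_id G M"
      "rep_comp G (\<lambda>v\<in>verts G. prr_mat (rdim M v) (rdim N v)) (\<lambda>v\<in>verts G. inr_mat (rdim M v)
          (rdim N v)) = rep_id G N"
      "rep_comp G (\<lambda>v\<in>verts G. prl_mat (rdim M v) (rdim N v)) (\<lambda>v\<in>verts G. inr_mat (rdim M v)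
          (rdim N v)) = rep_zero G N M"
      "rep_comp G (\<lambda>v\<in>verts G. prr_mat (rdim M v) (rdim N v)) (\<lambda>v\<in>verts G. inl_mat (rdim M v)
          (rdim N v)) = rep_zero G M N"
      unfolding rep_comp_def rep_id_def rep_zero_def by (auto intro!: restrict_ext)
  next
    fix X :: "('a, 'b, 'c) rep" and f g
    assume f: "f \<in> rep_hom G S X" and g: "g \<in> rep_hom G S X"
      and l: "rep_comp G f (\<lambda>v\<in>verts G. inl_mat (rdim M v) (rdim N v)) =
        rep_comp G g (\<lambda>v\<in>verts G. inl_mat (rdim M v) (rdim N v))"
      and r: "rep_comp G f (\<lambda>v\<in>verts G. inr_mat (rdim M v) (rdim N v)) =
        rep_comp G g (\<lambda>v\<in>verts G. inr_mat (rdim M v) (rdim N v))"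
    show "f = g"
    proof (rule rep_hom_eqI[OF f g])
      fix v assume v: "v \<in> verts G"
      have c: "f v \<in> carrier_mat (rdim X v) (rdim M v + rdim N v)"
        "g v \<in> carrier_mat (rdim X v) (rdim M v + rdim N v)"
        using rep_hom_carrier[OF f v] rep_hom_carrier[OF g v] by (simp_all add: dim)
      have 1: "mat (rdim X v) (rdim M v) (\<lambda>(i, j). f v $$ (i, j)) = mat (rdim X v) (rdim M v) (\<lambda>(i,
          j). g v $$ (i, j))"
        using fun_cong[OF l, of v] v unfolding rep_comp_def mult_inl_mat[OF c(1), symmetric]
            mult_inl_mat[OF c(2), symmetric] by simp
      have 2: "mat (rdim X v) (rdim N v) (\<lambda>(i, j). f v $$ (i, rdim M v + j)) = mat (rdim X v)
          (rdim N v) (\<lambda>(i, j). g v $$ (i, rdim M v + j))"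
        using fun_cong[OF r, of v] v unfolding rep_comp_def mult_inr_mat[OF c(1), symmetric]
            mult_inr_mat[OF c(2), symmetric] by simp
      show "f v = g v"
      proof (rule eq_matI)
        fix i j assume "i < dim_row (g v)" "j < dim_col (g v)"
        then have ij: "i < rdim X v" "j < rdim M v + rdim N v" using c by auto
        show "f v $$ (i, j) = g v $$ (i, j)"
        proof (cases "j < rdim M v")
          case True
          then show ?thesis using arg_cong[OF 1, of "\<lambda>A. A $$ (i, j)"] ij by simp
        next
          case False
          then have "j - rdim M v < rdim N v" "rdim M v + (j - rdim M v) = j" using ij by auto
          then show ?thesis using arg_cong[OF 2, of "\<lambda>A. A $$ (i, j - rdim M v)"] ij by simp
        qed
      qed (use c in auto)
    qed
  next
    fix X :: "('a, 'b, 'c) rep" and f g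
    assume f: "f \<in> rep_hom G X S" and g: "g \<in> rep_hom G X S"
      and l: "rep_comp G (\<lambda>v\<in>verts G. prl_mat (rdim M v) (rdim N v)) f =
        rep_comp G (\<lambda>v\<in>verts G. prl_mat (rdim M v) (rdim N v)) g"
      and r: "rep_comp G (\<lambda>v\<in>verts G. prr_mat (rdim M v) (rdim N v)) f =
        rep_comp G (\<lambda>v\<in>verts G. prr_mat (rdim M v) (rdim N v)) g"
    show "f = g"
    proof (rule rep_hom_eqI[OF f g])
      fix v assume v: "v \<in> verts G"
      have c: "f v \<in> carrier_mat (rdim M v + rdim N v) (rdim X v)"
        "g v \<in> carrier_mat (rdim M v + rdim N v) (rdim X v)"
        using rep_hom_carrier[OF f v] rep_hom_carrier[OF g v] by (simp_all add: dim)
      have 1: "mat (rdim M v) (rdim X v) (\<lambda>(i, j). f v $$ (i, j)) = mat (rdim M v) (rdim X v) (\<lambda>(i,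
          j). g v $$ (i, j))"
        using fun_cong[OF l, of v] v unfolding rep_comp_def prl_mat_mult[OF c(1), symmetric]
            prl_mat_mult[OF c(2), symmetric] by simp
      have 2: "mat (rdim N v) (rdim X v) (\<lambda>(i, j). f v $$ (rdim M v + i, j)) = mat (rdim N v)
          (rdim X v) (\<lambda>(i, j). g v $$ (rdim M v + i, j))"
        using fun_cong[OF r, of v] v unfolding rep_comp_def prr_mat_mult[OF c(1), symmetric]
            prr_mat_mult[OF c(2), symmetric] by simp
      show "f v = g v"
      proof (rule eq_matI)
        fix i j assume "i < dim_row (g v)" "j < dim_col (g v)"
        then have ij: "i < rdim M v + rdim N v" "j < rdim X v" using c by auto
        show "f v $$ (i, j) = g v $$ (i, j)"
        proof (cases "i < rdim M v")
          case True
          then show ?thesis using arg_cong[OF 1, of "\<lambda>A. A $$ (i, j)"] ij by simp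
        next
          case False
          then have "i - rdim M v < rdim N v" "rdim M v + (i - rdim M v) = i" using ij by auto
          then show ?thesis using arg_cong[OF 2, of "\<lambda>A. A $$ (i - rdim M v, j)"] ij by simp
        qed
      qed (use c in auto)
    qed
  qed
  then show ?thesis by (simp add: N_def S_def)
qed

lemma hom_zero_Nil:
  "hom_zero G (rep_sum []) X" "hom_zero G X (rep_sum [])"
proof -
  have "f = rep_zero G (rep_sum []) X" if "f \<in> rep_hom G (rep_sum []) X" for f
  proof
    fix v show "f v = rep_zero G (rep_sum []) X v"
      using that by (cases "v \<in> verts G")
        (auto simp: rep_hom_def rep_zero_def rep_sum_def PiE_def Pi_def extensional_def intro!:
            eq_matI)
  qed
  then show "hom_zero G (rep_sum []) X" by (simp add: hom_zero_def)
  have "f = rep_zero G X (rep_sum [])" if "f \<in> rep_hom G X (rep_sum [])" for f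
  proof
    fix v show "f v = rep_zero G X (rep_sum []) v"
      using that by (cases "v \<in> verts G")
        (auto simp: rep_hom_def rep_zero_def rep_sum_def PiE_def Pi_def extensional_def intro!:
            eq_matI)
  qed
  then show "hom_zero G X (rep_sum [])" by (simp add: hom_zero_def)
qed

lemma hom_zero_rep_sum_iff:
  assumes "\<And>M. M \<in> set Ms \<Longrightarrow> rep_ok G M" "rep_ok G X"
  shows "hom_zero G (rep_sum Ms) X \<longleftrightarrow> (\<forall>M\<in>set Ms. hom_zero G M X)"
    and "hom_zero G X (rep_sum Ms) \<longleftrightarrow> (\<forall>M\<in>set Ms. hom_zero G X M)"
proof -
  have "(hom_zero G (rep_sum Ms) X \<longleftrightarrow> (\<forall>M\<in>set Ms. hom_zero G M X)) \<and>
    (hom_zero G X (rep_sum Ms) \<longleftrightarrow> (\<forall>M\<in>set Ms. hom_zero G X M))"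
    using assms(1)
  proof (induction Ms)
    case Nil
    show ?case by (simp add: hom_zero_Nil)
  next
    case (Cons M Ms)
    have ok: "rep_ok G M" "rep_ok G (rep_sum Ms)" "rep_ok G (rep_sum (M # Ms))"
      using Cons.prems by (auto intro!: rep_ok_rep_sum)
    interpret rep_biproduct G M "rep_sum Ms" "rep_sum (M # Ms)"
      "\<lambda>v\<in>verts G. inl_mat (rdim M v) (rdim (rep_sum Ms) v)"
      "\<lambda>v\<in>verts G. inr_mat (rdim M v) (rdim (rep_sum Ms) v)"
      "\<lambda>v\<in>verts G. prl_mat (rdim M v) (rdim (rep_sum Ms) v)"
      "\<lambda>v\<in>verts G. prr_mat (rdim M v) (rdim (rep_sum Ms) v)"
      by (rule rep_sum_biproduct[OF ok])
    show ?case using Cons hom_zero_from_sum[OF assms(2)] hom_zero_to_sum[OF assms(2)] by simp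
  qed
  then show "hom_zero G (rep_sum Ms) X \<longleftrightarrow> (\<forall>M\<in>set Ms. hom_zero G M X)"
    "hom_zero G X (rep_sum Ms) \<longleftrightarrow> (\<forall>M\<in>set Ms. hom_zero G X M)" by blast+
qed

lemma reduced_rep_sum_iff:
  assumes "\<And>M. M \<in> set Ms \<Longrightarrow> rep_ok G M"
  shows "reduced G (rep_sum Ms) \<longleftrightarrow> (\<forall>M\<in>set Ms. reduced G M) \<and>
    (\<forall>i<length Ms. \<forall>j<length Ms. i \<noteq> j \<longrightarrow> hom_zero G (Ms ! i) (Ms ! j))"
  using assms
proof (induction Ms)
  case Nil
  show ?case by (simp add: reduced_def hom_zero_Nil(1)[unfolded hom_zero_def, rule_format])
next
  case (Cons M Ms)
  have ok: "rep_ok G M" "rep_ok G (rep_sum Ms)" "rep_ok G (rep_sum (M # Ms))"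
    using Cons.prems by (auto intro!: rep_ok_rep_sum)
  interpret rep_biproduct G M "rep_sum Ms" "rep_sum (M # Ms)"
    "\<lambda>v\<in>verts G. inl_mat (rdim M v) (rdim (rep_sum Ms) v)"
    "\<lambda>v\<in>verts G. inr_mat (rdim M v) (rdim (rep_sum Ms) v)"
    "\<lambda>v\<in>verts G. prl_mat (rdim M v) (rdim (rep_sum Ms) v)"
    "\<lambda>v\<in>verts G. prr_mat (rdim M v) (rdim (rep_sum Ms) v)"
    by (rule rep_sum_biproduct[OF ok])
  have "hom_zero G M (rep_sum Ms) \<longleftrightarrow> (\<forall>i<length Ms. hom_zero G M (Ms ! i))"
    "hom_zero G (rep_sum Ms) M \<longleftrightarrow> (\<forall>i<length Ms. hom_zero G (Ms ! i) M)"
    using hom_zero_rep_sum_iff[of Ms M] Cons.prems by (simp_all add: all_set_conv_all_nth)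
  then show ?case
    unfolding reduced_sum_iff using Cons.IH Cons.prems by (auto simp: All_less_Suc2)
qed

text \<open>Squaring doubles the amount by which the endomorphism raises heights.\<close>

lemma reduced_height_raising:
  assumes red: "reduced G M" and ok: "rep_ok G M"
    and bound: "\<And>v i. H v i \<le> (B :: nat)"
    and f: "f \<in> rep_hom G M M"
    and raise: "\<And>v i j. \<lbrakk>v \<in> verts G; i < rdim M v; j < rdim M v; f v $$ (i, j) \<noteq> 0\<rbrakk> \<Longrightarrow>
        H v j < H v i"
  shows "f = rep_zero G M M"
proof -
  \<comment> \<open>n is the guaranteed rise of f and m the number of squarings after which it
    exceeds the bound. As \<open>reduced\<close> speaks of squares only, the induction squares f,
    and each stage returns from f f = 0 to f = 0.\<close>
  have "f = rep_zero G M M"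
    if "n > 0" "B < n * 2 ^ m" "f \<in> rep_hom G M M"
      "\<And>v i j. \<lbrakk>v \<in> verts G; i < rdim M v; j < rdim M v; f v $$ (i, j) \<noteq> 0\<rbrakk> \<Longrightarrow> H v j + n \<le> H v i"
          for m n f
    using that
  proof (induction m arbitrary: n f)
    case 0
    have "f v $$ (i, j) = 0" if "v \<in> verts G" "i < rdim M v" "j < rdim M v" for v i j
      using 0(4)[OF that] 0(2) bound[of v i] by fastforce
    then have "f v = rep_zero G M M v" if "v \<in> verts G" for v
      using that rep_hom_carrier[OF 0(3) that] by (auto simp: rep_zero_def intro!: eq_matI)
    then show ?case using 0(3) rep_zero_hom[OF ok ok] rep_hom_eqI by blast
  next
    case (Suc m)
    have ff: "rep_comp G f f \<in> rep_hom G M M" using rep_comp_hom ok Suc.prems(3) by blast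
    have "rep_comp G f f = rep_zero G M M"
    proof (rule Suc.IH[of "2 * n"])
      show "0 < 2 * n" "B < 2 * n * 2 ^ m" using Suc.prems by simp_all
      show "rep_comp G f f \<in> rep_hom G M M" by fact
      fix v i j assume v: "v \<in> verts G" "i < rdim M v" "j < rdim M v" "rep_comp G f f v $$ (i, j)
          \<noteq> 0"
      have c: "f v \<in> carrier_mat (rdim M v) (rdim M v)" using rep_hom_carrier[OF Suc.prems(3) v(1)]
          .
      have "(\<Sum>k = 0..<rdim M v. f v $$ (i, k) * f v $$ (k, j)) \<noteq> 0"
        using v c by (simp add: rep_comp_def scalar_prod_def)
      then obtain k where "k < rdim M v" "f v $$ (i, k) * f v $$ (k, j) \<noteq> 0"
        by (meson atLeastLessThan_iff sum.neutral)
      then have "H v j + n \<le> H v k" "H v k + n \<le> H v i"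
        using Suc.prems(4) v by auto
      then show "H v j + 2 * n \<le> H v i" by simp
    qed
    then show ?case using red Suc.prems(3) by (simp add: reduced_def)
  qed
  \<comment> \<open>A strict rise is a rise by 1, and B is less than 2 ^ B, so B squarings
    suffice.\<close>
  from this[of 1 B f] show ?thesis using f raise by (simp add: Suc_le_eq)
qed

end

section \<open>Morphisms between band modules\<close>

text \<open>Matrices with rows and columns labelled by lists. For distinct labels, products are sums
  over labels, which replaces arithmetic with the indices inside a vertex space.\<close>

definition lmat :: "'p list \<Rightarrow> 'q list \<Rightarrow> ('p \<Rightarrow> 'q \<Rightarrow> 'k) \<Rightarrow> 'k mat" where
  "lmat ps qs f = mat (length ps) (length qs) (\<lambda>(i, j). f (ps ! i) (qs ! j))"

lemma lmat_carrier [simp]: "lmat ps qs f \<in> carrier_mat (length ps) (length qs)"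
  by (simp add: lmat_def)

lemma lmat_mult:
  fixes f :: "'p \<Rightarrow> 'r \<Rightarrow> 'k :: semiring_0"
  assumes "distinct rs"
  shows "lmat ps rs f * lmat rs qs g = lmat ps qs (\<lambda>p q. \<Sum>r\<in>set rs. f p r * g r q)"
proof (rule eq_matI)
  fix i j assume ij: "i < dim_row (lmat ps qs (\<lambda>p q. \<Sum>r\<in>set rs. f p r * g r q))"
    "j < dim_col (lmat ps qs (\<lambda>p q. \<Sum>r\<in>set rs. f p r * g r q))"
  have "(\<Sum>k\<in>{..<length rs}. f (ps ! i) (rs ! k) * g (rs ! k) (qs ! j)) =
      (\<Sum>r\<in>set rs. f (ps ! i) r * g r (qs ! j))"
    by (rule sum.reindex_bij_betw[OF bij_betw_nth[OF assms]]) auto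
  then show "(lmat ps rs f * lmat rs qs g) $$ (i, j) =
      lmat ps qs (\<lambda>p q. \<Sum>r\<in>set rs. f p r * g r q) $$ (i, j)"
    using ij by (simp add: lmat_def scalar_prod_def atLeast0LessThan)
qed (simp_all add: lmat_def)

lemma lmat_eq_iff:
  "lmat ps qs f = lmat ps qs g \<longleftrightarrow> (\<forall>p\<in>set ps. \<forall>q\<in>set qs. f p q = g p q)"
proof
  assume eq: "lmat ps qs f = lmat ps qs g"
  show "\<forall>p\<in>set ps. \<forall>q\<in>set qs. f p q = g p q"
  proof (intro ballI)
    fix p q assume "p \<in> set ps" "q \<in> set qs"
    then obtain i j where "i < length ps" "p = ps ! i" "j < length qs" "q = qs ! j"
      by (metis in_set_conv_nth)
    then show "f p q = g p q"
      using arg_cong[OF eq, of "\<lambda>A. A $$ (i, j)"] by (simp add: lmat_def)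
  qed
qed (auto simp: lmat_def intro!: eq_matI)

lemma lmat_zero: "0\<^sub>m (length ps) (length qs) = lmat ps qs (\<lambda>_ _. 0)"
  by (auto simp: lmat_def intro!: eq_matI)

lemma lmat_one:
  assumes "distinct ps"
  shows "1\<^sub>m (length ps) = lmat ps ps (\<lambda>p q. if p = q then 1 else 0)"
  using assms by (auto simp: lmat_def nth_eq_iff_index_eq intro!: eq_matI)

lemma lmat_surj:
  assumes A: "A \<in> carrier_mat (length ps) (length qs)" and "distinct ps" "distinct qs"
  obtains f where "A = lmat ps qs f"
proof
  define f where "f p q = A $$ (inv_into {..<length ps} ((!) ps) p, inv_into {..<length qs} ((!) qs)
      q)" for p q
  have "inj_on ((!) ps) {..<length ps}" "inj_on ((!) qs) {..<length qs}"
    using assms by (auto intro: inj_on_nth)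
  then show "A = lmat ps qs f"
    using A by (intro eq_matI) (auto simp: lmat_def f_def inv_into_f_f)
qed

definition band_coeff :: "'a syllable list \<Rightarrow> 'k :: field \<Rightarrow> 'a \<Rightarrow> nat \<Rightarrow> nat \<Rightarrow> 'k" where
  "band_coeff b lam a q p =
     (if b ! q = Dir a \<and> p = Suc q mod length b then (if Suc q = length b then lam else 1)
      else if b ! p = Inv a \<and> q = Suc p mod length b then (if Suc p = length b then lam else 1)
      else 0)"

lemma band_component_1:
  fixes lam :: "'a :: field"
  shows "band_component b 1 lam a q p $$ (0, 0) = band_coeff b lam a q p"
proof -
  have "jordan_block 1 lam $$ (0, 0) = lam" "1\<^sub>m 1 $$ (0, 0) = (1 :: 'a)" "0\<^sub>m 1 1 $$ (0, 0) =
      (0 :: 'a)"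
    by (simp_all add: jordan_block_def)
  then show ?thesis
    by (simp only: band_component_def band_coeff_def band_matrix_def if_distrib[of "\<lambda>A. A $$ (0,
        0)"])
qed

lemma set_band_positions: "set (band_positions Q b v) = {j. j < length b \<and> syl_src Q (b ! j) = v}"
  by (auto simp: band_positions_def)

lemma distinct_band_positions [simp]: "distinct (band_positions Q b v)"
  by (simp add: band_positions_def)

lemma rdim_band_module: "rdim (band_module Q b l lam) v = length (band_positions Q b v) * l"
  by (simp add: band_module_def)

text \<open>The label (p, i) is the basis vector number i of the copy at position p; the order of
  \<open>List.product\<close> matches the numbering by quotient and remainder modulo l.\<close>

lemma rmat_band_module:
  "rmat (band_module Q b l lam) a =
     lmat (List.product (band_positions Q b (head Q a)) [0..<l])
         (List.product (band_positions Q b (tail Q a)) [0..<l])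
       (\<lambda>(p, i) (q, j). band_component b l lam a q p $$ (i, j))"
  unfolding band_module_def Let_def lmat_def
  by (auto simp: length_product product_nth less_mult_imp_div_less intro!: eq_matI split:
      prod.splits)
    (metis gr0I mod_less_divisor mult_0_right not_less_zero nth_upt plus_nat.add_0)+

lemma rmat_band_module_1:
  "rmat (band_module Q b 1 lam) a =
     lmat (band_positions Q b (head Q a)) (band_positions Q b (tail Q a))
         (\<lambda>p q. band_coeff b lam a q p)"
  unfolding band_module_def Let_def lmat_def band_component_1[symmetric]
  by (auto intro!: eq_matI)

lemma rep_ok_band_module: "rep_ok Q (band_module Q b l lam)"
  by (simp add: rep_ok_def rdim_band_module) (simp add: band_module_def Let_def)

lemma periodic_pred:
  fixes P :: "int \<Rightarrow> bool"
  assumes "\<And>x. P (x + k) \<longleftrightarrow> P x"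
  shows "P (x + k * n) \<longleftrightarrow> P x"
proof (induction n rule: int_induct[where k = 0])
  case (step1 i)
  then show ?case using assms[of "x + k * i"] by (simp add: algebra_simps)
next
  case (step2 i)
  then show ?case using assms[of "x + k * (i - 1)"] by (simp add: algebra_simps)
qed simp

context acyclic_string_algebra
begin

lemma syl_src_verts: "syl_arc x \<in> arcs Q \<Longrightarrow> syl_src Q x \<in> verts Q"
  by (cases x) auto

lemma fst_src: "fst (src x) = syl_src Q x"
  by (simp add: letter_src_def)

lemma fst_tgt: "fst (tgt x) = syl_tgt Q x"
  by (simp add: letter_tgt_def)

lemma line_vertex: "line s \<Longrightarrow> syl_tgt Q (s t) = syl_src Q (s (t + 1))"
  using line_step[of s t] by (metis fst_src fst_tgt)

lemma band_nonempty: "is_band Q \<rho> b \<Longrightarrow> b \<noteq> []"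
  by (auto simp: is_band_def is_string_def)

lemma band_syl_src_verts: "is_band Q \<rho> b \<Longrightarrow> syl_src Q (unroll b t) \<in> verts Q"
  using syl_src_verts line_arc line_unroll by blast

text \<open>The power l - 1 of the nilpotent part of the Jordan block, placed in every copy, is a
  non-zero endomorphism. Its square is zero because l is at least 2.\<close>

lemma not_reduced_band_module:
  fixes lam :: "'k :: field"
  assumes b: "is_band Q \<rho> b" and l: "l \<ge> 2"
  shows "\<not> reduced Q (band_module Q b l lam)"
proof
  assume red: "reduced Q (band_module Q b l lam)"
  let ?P = "\<lambda>v. List.product (band_positions Q b v) [0..<l]"
  \<comment> \<open>The matrix unit in row 0 and column l - 1. The Jordan block scales it by lam
    from either side, since the first column and the last row of the block are zero off the
    diagonal.\<close>
  define e :: "nat \<times> nat \<Rightarrow> nat \<times> nat \<Rightarrow> 'k" where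
    "e = (\<lambda>(p, i) (q, j). if p = q \<and> i = 0 \<and> j = l - 1 then 1 else 0)"
  define f where "f = (\<lambda>v\<in>verts Q. lmat (?P v) (?P v) e)"
  have dist: "distinct (?P v)" for v by (simp add: distinct_product)
  have len: "length (?P v) = rdim (band_module Q b l lam) v" for v
    by (simp add: rdim_band_module length_product)
  have Z: "(0\<^sub>m (rdim (band_module Q b l lam) v) (rdim (band_module Q b l lam) v) :: 'k mat) =
      lmat (?P v) (?P v) (\<lambda>_ _. 0)" for v
    by (simp only: lmat_zero len[symmetric])
  have f: "f \<in> rep_hom Q (band_module Q b l lam) (band_module Q b l lam)"
    unfolding f_def
  proof (rule rep_hom_restrictI)
    show "lmat (?P v) (?P v) e \<in> carrier_mat (rdim (band_module Q b l lam) v)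
        (rdim (band_module Q b l lam) v)" for v
      using lmat_carrier[of "?P v" "?P v" e] by (simp only: len)
    fix a assume a: "a \<in> arcs Q"
    define C where "C = (\<lambda>(p, i) (q, j). band_component b l lam a q p $$ (i, j))"
    have "(\<Sum>r\<in>set (?P (head Q a)). e x r * C r y) = (\<Sum>r\<in>set (?P (tail Q a)). C x r * e r y)"
      if x: "x \<in> set (?P (head Q a))" and y: "y \<in> set (?P (tail Q a))" for x y
    proof -
      obtain p i q j where xy: "x = (p, i)" "y = (q, j)" by (cases x; cases y)
      have ij: "i < l" "j < l" using x y xy by auto
      have "(\<Sum>r\<in>set (?P (head Q a)). e x r * C r y) =
          (\<Sum>r\<in>set (?P (head Q a)). if r = (p, l - 1) then (if i = 0 then C (p, l - 1) y else 0)
              else 0)"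
        by (rule sum.cong) (auto simp: e_def xy split: if_splits)
      also have "\<dots> = (if i = 0 then C (p, l - 1) y else 0)"
        using x xy l by (subst sum.delta) auto
      also have "\<dots> = (if j = l - 1 then C x (q, 0) else 0)"
        using ij l by (auto simp: C_def xy band_component_def band_matrix_def jordan_block_def)
      also have "\<dots> = (\<Sum>r\<in>set (?P (tail Q a)). if r = (q, 0) then (if j = l - 1 then C x (q, 0)
          else 0) else 0)"
        using y xy l by (subst sum.delta) auto
      also have "\<dots> = (\<Sum>r\<in>set (?P (tail Q a)). C x r * e r y)"
        by (rule sum.cong) (auto simp: e_def xy split: if_splits)
      finally show ?thesis .
    qed
    then show "lmat (?P (head Q a)) (?P (head Q a)) e * rmat (band_module Q b l lam) a =
        rmat (band_module Q b l lam) a * lmat (?P (tail Q a)) (?P (tail Q a)) e"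
      unfolding rmat_band_module lmat_mult[OF dist] lmat_eq_iff C_def by blast
  qed
  have "rep_comp Q f f = rep_zero Q (band_module Q b l lam) (band_module Q b l lam)"
    unfolding rep_comp_def rep_zero_def
  proof (rule restrict_ext)
    fix v assume v: "v \<in> verts Q"
    have z: "(\<Sum>r\<in>set (?P v). e x r * e r y) = 0" for x y
      using l by (intro sum.neutral) (auto simp: e_def split: prod.splits)
    have "f v * f v = lmat (?P v) (?P v) (\<lambda>_ _. 0)"
      using v unfolding f_def by (simp only: restrict_apply' lmat_mult[OF dist] z)
    then show "f v * f v = 0\<^sub>m (rdim (band_module Q b l lam) v) (rdim (band_module Q b l lam) v)"
      by (simp only: Z)
  qed
  then have f0: "f = rep_zero Q (band_module Q b l lam) (band_module Q b l lam)"
    using red f by (simp add: reduced_def)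
  define v where "v = syl_src Q (unroll b 0)"
  have v: "v \<in> verts Q" unfolding v_def using band_syl_src_verts[OF b] .
  have "0 \<in> set (band_positions Q b v)"
    using band_nonempty[OF b] by (simp add: set_band_positions v_def unroll_def)
  then have in_P: "(0, 0) \<in> set (?P v)" "(0, l - 1) \<in> set (?P v)" using l by auto
  have "lmat (?P v) (?P v) e = lmat (?P v) (?P v) (\<lambda>_ _. 0)"
    using fun_cong[OF f0, of v] v unfolding f_def rep_zero_def by (simp only: restrict_apply' Z)
  then have "e (0, 0) (0, l - 1) = 0" using in_P unfolding lmat_eq_iff by blast
  then show False by (simp add: e_def)
qed

text \<open>
  A morphism between band modules with one-dimensional components is recorded by a function on
  pairs of integers. The basis vectors are unrolled along the line with \<open>e\<^bsub>x+k\<^esub> = lam e\<^sub>x\<close>,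
  so that all arrows have coefficients \<open>0\<close> and \<open>1\<close>; then \<open>F x y\<close> is the coefficient of \<open>e'\<^sub>y\<close>
  in the image of \<open>e\<^sub>x\<close>.
\<close>

definition band_map ::
  "'b syllable list \<Rightarrow> 'b syllable list \<Rightarrow> (int \<Rightarrow> int \<Rightarrow> 'k) \<Rightarrow> 'a \<Rightarrow> 'k mat" where
  "band_map b b' F = (\<lambda>v\<in>verts Q. lmat (band_positions Q b' v) (band_positions Q b v)
      (\<lambda>y x. F (int x) (int y)))"

text \<open>Compares the coefficients of \<open>e'_y\<close> in f (a e_x) and in a (f e_x): an arrow
  moves a basis vector to the right along a direct syllable and to the left along an inverse
  one.\<close>

definition local_eq :: "(int \<Rightarrow> 'b syllable) \<Rightarrow> (int \<Rightarrow> 'b syllable) \<Rightarrow> (int \<Rightarrow> int \<Rightarrow> 'k :: field)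
    \<Rightarrow> 'b \<Rightarrow> int \<Rightarrow> int \<Rightarrow> bool" where
  "local_eq s s' F a x y \<longleftrightarrow>
     (if s x = Dir a then F (x + 1) y else 0) + (if s (x - 1) = Inv a then F (x - 1) y else 0) =
     (if s' (y - 1) = Dir a then F x (y - 1) else 0) + (if s' y = Inv a then F x (y + 1) else 0)"

text \<open>A morphism has one matrix per vertex; pairs of positions over different vertices have no
  entry and are given the value 0.\<close>

definition vertexwise :: "(int \<Rightarrow> 'b syllable) \<Rightarrow> (int \<Rightarrow> 'b syllable) \<Rightarrow> (int \<Rightarrow> int \<Rightarrow> 'k :: field)
    \<Rightarrow> bool" where
  "vertexwise s s' F \<longleftrightarrow> (\<forall>x y. F x y \<noteq> 0 \<longrightarrow> syl_src Q (s x) = syl_src Q (s' y))"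

definition compatible :: "(int \<Rightarrow> 'b syllable) \<Rightarrow> (int \<Rightarrow> 'b syllable) \<Rightarrow> (int \<Rightarrow> int \<Rightarrow> 'k :: field)
    \<Rightarrow> bool" where
  "compatible s s' F \<longleftrightarrow> vertexwise s s' F \<and> (\<forall>a x y. local_eq s s' F a x y)"

text \<open>The first equation is \<open>e_(x+k) = lam e_x\<close> in the source. In the target
  \<open>e'_(y+k') = mu e'_y\<close>, and coefficients transform inversely to basis vectors.\<close>

definition twisted :: "int \<Rightarrow> int \<Rightarrow> 'k \<Rightarrow> 'k \<Rightarrow> (int \<Rightarrow> int \<Rightarrow> 'k :: field) \<Rightarrow> bool" where
  "twisted k k' lam mu F \<longleftrightarrow> (\<forall>x y. F (x + k) y = lam * F x y) \<and> (\<forall>x y. mu * F x (y + k') = F x y)"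

lemma unroll_last: "is_band Q \<rho> b \<Longrightarrow> unroll b (-1) = last b"
  using band_nonempty[of b] by (simp add: unroll_def zmod_minus1 last_conv_nth nat_diff_distrib')

lemma band_inverse_not_last:
  assumes "is_band Q \<rho> b" "b ! p = Inv a"
  shows "Suc p \<noteq> length b"
proof
  assume "Suc p = length b"
  then have "last b = Inv a" using assms(2) band_nonempty[OF assms(1)]
      by (simp add: last_conv_nth flip: \<open>Suc p = _\<close>)
  then show False using assms(1) by (simp add: is_band_def)
qed

lemma unroll_Suc_mod: "unroll b (int (Suc q mod length b)) = unroll b (int q + 1)"
  unfolding unroll_def by (simp add: zmod_int mod_mod_trivial algebra_simps)

text \<open>The two alternatives in \<open>band_coeff\<close> exclude each other because a band does
  not backtrack, so they can be added. As the last syllable is direct, only the direct term meets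
  the seam and the factor lam.\<close>

lemma band_coeff_split:
  assumes b: "is_band Q \<rho> b" and "q < length b" "p < length b"
  shows "band_coeff b lam a q p =
    (if b ! q = Dir a \<and> p = Suc q mod length b then (if Suc q = length b then lam else 1) else 0) +
    (if b ! p = Inv a \<and> q = Suc p then 1 else 0)"
proof -
  have inv: "Suc p mod length b = Suc p" "Suc p \<noteq> length b" if "b ! p = Inv a"
    using band_inverse_not_last[OF b that] assms(3) by auto
  have "\<not> (b ! q = Dir a \<and> p = Suc q mod length b \<and> b ! p = Inv a)"
  proof
    assume *: "b ! q = Dir a \<and> p = Suc q mod length b \<and> b ! p = Inv a"
    then have "unroll b (int q + 1) = b ! p" "unroll b (int q) = b ! q"
      using unroll_Suc_mod[of b q] assms(2,3) unroll_of_nat[of q b] unroll_of_nat[of p b] by metis+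
    moreover have "b ! q = Dir a" "b ! p = Inv a" using * by blast+
    ultimately have "unroll b (int q) = syl_inv (unroll b (int q + 1))" by simp
    then show False using line_no_backtrack[OF line_unroll[OF b]] by blast
  qed
  then show ?thesis using inv by (auto simp: band_coeff_def)
qed

text \<open>The twisted periodicity of h absorbs the factor lam at the seam, so the sum has the same
  form at every position of the unrolled line.\<close>

lemma band_coeff_sum_source:
  fixes h :: "int \<Rightarrow> 'k :: field"
  assumes b: "is_band Q \<rho> b" and x: "x < length b"
    and h: "\<And>t. h (t + int (length b)) = lam * h t"
  shows "(\<Sum>p<length b. h (int p) * band_coeff b lam a x p) =
    (if unroll b (int x) = Dir a then h (int x + 1) else 0) +
    (if unroll b (int x - 1) = Inv a then h (int x - 1) else 0)"
proof -
  define k where "k = length b"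
  have k: "k > 0" using x unfolding k_def by linarith
  have "(\<Sum>p<k. h (int p) * band_coeff b lam a x p) =
      (\<Sum>p<k. if p = Suc x mod k then (if b ! x = Dir a then h (int p) * (if Suc x =
          k then lam else 1) else 0) else 0) +
      (\<Sum>p<k. if b ! p = Inv a \<and> x = Suc p then h (int p) else 0)"
    unfolding sum.distrib[symmetric]
    by (rule sum.cong) (use x in \<open>auto simp: k_def band_coeff_split[OF b x] distrib_left\<close>)
  moreover have "(\<Sum>p<k. if p = Suc x mod k then (if b ! x = Dir a then h (int p) * (if Suc x =
      k then lam else 1) else 0) else 0) =
      (if unroll b (int x) = Dir a then h (int x + 1) else 0)"
  proof -
    have "h (int (Suc x mod k)) * (if Suc x = k then lam else 1) = h (int x + 1)"
    proof (cases "Suc x = k")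
      case True
      then show ?thesis using h[of 0] by (simp add: k_def[symmetric] flip: True)
          (simp add: mult.commute add.commute)
    next
      case False
      then have "Suc x mod k = Suc x" using x k_def by simp
      then show ?thesis using False by (simp add: add.commute)
    qed
    then show ?thesis
      using k x unroll_of_nat[OF x] by (subst sum.delta) auto
  qed
  moreover have "(\<Sum>p<k. if b ! p = Inv a \<and> x = Suc p then h (int p) else 0) =
      (if unroll b (int x - 1) = Inv a then h (int x - 1) else 0)"
  proof (cases x)
    case 0
    have "unroll b (int x - 1) \<noteq> Inv a"
      using unroll_last[OF b] b 0 by (auto simp: is_band_def)
    then show ?thesis using 0 by simp
  next
    case (Suc p')
    have "(\<Sum>p<k. if b ! p = Inv a \<and> x = Suc p then h (int p) else 0) =
        (\<Sum>p<k. if p = p' then (if b ! p' = Inv a then h (int p') else 0) else 0)"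
      by (rule sum.cong) (auto simp: Suc)
    then show ?thesis using Suc x unroll_of_nat[of p' b] by (simp add: k_def)
  qed
  ultimately show ?thesis by (simp add: k_def)
qed

lemma band_coeff_sum_target:
  fixes h :: "int \<Rightarrow> 'k :: field"
  assumes b: "is_band Q \<rho> b" and y: "y < length b"
    and h: "\<And>t. lam * h (t + int (length b)) = h t"
  shows "(\<Sum>q<length b. band_coeff b lam a q y * h (int q)) =
    (if unroll b (int y - 1) = Dir a then h (int y - 1) else 0) +
    (if unroll b (int y) = Inv a then h (int y + 1) else 0)"
proof -
  define k where "k = length b"
  have k: "k > 0" using y unfolding k_def by linarith
  define q0 where "q0 = (if y = 0 then k - 1 else y - 1)"
  have q0: "q0 < k" using y k k_def by (auto simp: q0_def)
  have q0_iff: "y = Suc q mod k \<longleftrightarrow> q = q0" if "q < k" for q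
  proof (cases "Suc q = k")
    case True
    then show ?thesis using y by (auto simp: q0_def k_def)
  next
    case False
    then have "Suc q mod k = Suc q" using that by simp
    then show ?thesis using False k that by (auto simp: q0_def)
  qed
  have "(\<Sum>q<k. band_coeff b lam a q y * h (int q)) =
      (\<Sum>q<k. if q = q0 then (if b ! q0 = Dir a then (if Suc q0 = k then lam else 1) * h (int q0)
          else 0) else 0) +
      (\<Sum>q<k. if q = Suc y then (if b ! y = Inv a then h (int (Suc y)) else 0) else 0)"
    unfolding sum.distrib[symmetric]
    by (rule sum.cong) (use y q0_iff in \<open>auto simp: k_def band_coeff_split[OF b _ y] distrib_right\<close>)
  moreover have "(\<Sum>q<k. if q = q0 then (if b ! q0 = Dir a then (if Suc q0 = k then lam else 1) *
      h (int q0) else 0) else 0) =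
      (if unroll b (int y - 1) = Dir a then h (int y - 1) else 0)"
  proof (cases "y = 0")
    case True
    have "int q0 = -1 + int k" "b ! q0 = unroll b (int y - 1)" "Suc q0 = k"
      using True k unroll_last[OF b] band_nonempty[OF b]
      by (auto simp: q0_def k_def last_conv_nth of_nat_diff Suc_le_eq)
    then show ?thesis using h[of "-1"] q0 True by (simp add: k_def)
  next
    case False
    have "int q0 = int y - 1" "b ! q0 = unroll b (int y - 1)" "Suc q0 \<noteq> k"
      using False y unroll_of_nat[of q0 b] q0 by (auto simp: q0_def k_def of_nat_diff)
    then show ?thesis using q0 by simp
  qed
  moreover have "(\<Sum>q<k. if q = Suc y then (if b ! y = Inv a then h (int (Suc y)) else 0) else 0) =
      (if unroll b (int y) = Inv a then h (int y + 1) else 0)"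
  proof (cases "b ! y = Inv a")
    case True
    then have "Suc y < k" using band_inverse_not_last[OF b True] y by (simp add: k_def)
    then show ?thesis using True unroll_of_nat[OF y] by (simp add: add.commute)
  next
    case False
    then show ?thesis using unroll_of_nat[OF y] by simp
  qed
  ultimately show ?thesis by (simp add: k_def)
qed

text \<open>At such pairs every term vanishes: either the syllable is absent or F is zero by
  \<open>vertexwise\<close>. So the entries of the commutation matrices account for all pairs of
  positions.\<close>

lemma local_eq_trivial:
  assumes "line s" "line s'" "vertexwise s s' F"
    and "syl_src Q (s x) \<noteq> tail Q a \<or> syl_src Q (s' y) \<noteq> head Q a"
  shows "local_eq s s' F a x y"
proof -
  have v: "F x y = 0" if "syl_src Q (s x) \<noteq> syl_src Q (s' y)" for x y
    using assms(3) that by (auto simp: vertexwise_def)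
  have st: "syl_tgt Q (s (x - 1)) = syl_src Q (s x)" "syl_tgt Q (s x) = syl_src Q (s (x + 1))"
    and st': "syl_tgt Q (s' (y - 1)) = syl_src Q (s' y)" "syl_tgt Q (s' y) = syl_src Q (s' (y + 1))"
    using line_vertex[OF assms(1), of "x - 1"] line_vertex[OF assms(1), of x]
      line_vertex[OF assms(2), of "y - 1"] line_vertex[OF assms(2), of y] by simp_all
  show ?thesis
  proof (cases "syl_src Q (s x) = tail Q a")
    case False
    then have "s x \<noteq> Dir a" "s (x - 1) \<noteq> Inv a" using st by auto
    moreover have "F x (y - 1) = 0" if "s' (y - 1) = Dir a" using that False by (intro v) simp
    moreover have "F x (y + 1) = 0" if "s' y = Inv a" using that False st' by (intro v) auto
    ultimately show ?thesis by (auto simp: local_eq_def)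
  next
    case True
    then have ne: "syl_src Q (s' y) \<noteq> head Q a" using assms(4) by simp
    then have "s' (y - 1) \<noteq> Dir a" "s' y \<noteq> Inv a" using st' by auto
    moreover have "F (x + 1) y = 0" if "s x = Dir a" using that ne st by (intro v) auto
    moreover have "F (x - 1) y = 0" if "s (x - 1) = Inv a" using that ne by (intro v) simp
    ultimately show ?thesis by (auto simp: local_eq_def)
  qed
qed

lemma band_map_commute_iff:
  fixes F :: "int \<Rightarrow> int \<Rightarrow> 'k :: field"
  assumes b: "is_band Q \<rho> b" and b': "is_band Q \<rho> b'"
    and vw: "vertexwise (unroll b) (unroll b') F"
    and tw: "twisted (int (length b)) (int (length b')) lam mu F"
    and a: "a \<in> arcs Q"
  shows "band_map b b' F (head Q a) * rmat (band_module Q b 1 lam) a =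
      rmat (band_module Q b' 1 mu) a * band_map b b' F (tail Q a) \<longleftrightarrow>
    (\<forall>x<length b. \<forall>y<length b'. local_eq (unroll b) (unroll b') F a (int x) (int y))"
proof -
  have v: "head Q a \<in> verts Q" "tail Q a \<in> verts Q" using a by simp_all
  have zero: "F x y = 0" if "syl_src Q (unroll b x) \<noteq> syl_src Q (unroll b' y)" for x y
    using vw that by (auto simp: vertexwise_def)
  have L: "(\<Sum>r\<in>set (band_positions Q b (head Q a)). F (int r) (int y) * band_coeff b lam a x r) =
      (if unroll b (int x) = Dir a then F (int x + 1) (int y) else 0) +
      (if unroll b (int x - 1) = Inv a then F (int x - 1) (int y) else 0)"
    if x: "x < length b" and y: "y < length b'" "syl_src Q (b' ! y) = head Q a" for x y
  proof -
    have "(\<Sum>r\<in>set (band_positions Q b (head Q a)). F (int r) (int y) * band_coeff b lam a x r) =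
        (\<Sum>r<length b. F (int r) (int y) * band_coeff b lam a x r)"
      using y zero[of _ "int y"]
      by (intro sum.mono_neutral_left) (auto simp: set_band_positions unroll_of_nat)
    then show ?thesis
      using band_coeff_sum_source[OF b x, of "\<lambda>t. F t (int y)" lam a] tw by (simp add: twisted_def)
  qed
  have R: "(\<Sum>r\<in>set (band_positions Q b' (tail Q a)). band_coeff b' mu a r y * F (int x) (int r)) =
      (if unroll b' (int y - 1) = Dir a then F (int x) (int y - 1) else 0) +
      (if unroll b' (int y) = Inv a then F (int x) (int y + 1) else 0)"
    if y: "y < length b'" and x: "x < length b" "syl_src Q (b ! x) = tail Q a" for x y
  proof -
    have "(\<Sum>r\<in>set (band_positions Q b' (tail Q a)). band_coeff b' mu a r y * F (int x) (int r)) =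
        (\<Sum>r<length b'. band_coeff b' mu a r y * F (int x) (int r))"
    proof (rule sum.mono_neutral_left)
      have "F (int x) (int i) = 0" if "i < length b'" "syl_src Q (b' ! i) \<noteq> tail Q a" for i
        using that x by (intro zero) (simp add: unroll_of_nat)
      then show "\<forall>i\<in>{..<length b'} - set (band_positions Q b' (tail Q a)).
          band_coeff b' mu a i y * F (int x) (int i) = 0"
        by (auto simp: set_band_positions)
    qed (auto simp: set_band_positions)
    then show ?thesis
      using band_coeff_sum_target[OF b' y, of mu "\<lambda>t. F (int x) t" a] tw by (simp add: twisted_def)
  qed
  have "band_map b b' F (head Q a) * rmat (band_module Q b 1 lam) a =
      rmat (band_module Q b' 1 mu) a * band_map b b' F (tail Q a) \<longleftrightarrow>
    (\<forall>y\<in>set (band_positions Q b' (head Q a)). \<forall>x\<in>set (band_positions Q b (tail Q a)).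
      local_eq (unroll b) (unroll b') F a (int x) (int y))"
    unfolding band_map_def restrict_apply'[OF v(1)] restrict_apply'[OF v(2)] rmat_band_module_1
      lmat_mult[OF distinct_band_positions] lmat_eq_iff
  proof (intro ball_cong refl)
    fix y x assume y: "y \<in> set (band_positions Q b' (head Q a))"
      and x: "x \<in> set (band_positions Q b (tail Q a))"
    have "x < length b" "y < length b'" "syl_src Q (b ! x) = tail Q a" "syl_src Q (b' ! y) =
        head Q a"
      using x y by (simp_all add: set_band_positions)
    then show "((\<Sum>r\<in>set (band_positions Q b (head Q a)). F (int r) (int y) * band_coeff b lam a x r)
        =
        (\<Sum>r\<in>set (band_positions Q b' (tail Q a)). band_coeff b' mu a r y * F (int x) (int r))) =
        local_eq (unroll b) (unroll b') F a (int x) (int y)"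
      using L[of x y] R[of y x] by (simp only: local_eq_def)
  qed
  also have "\<dots> \<longleftrightarrow> (\<forall>x<length b. \<forall>y<length b'. local_eq (unroll b) (unroll b') F a (int x) (int y))"
    using local_eq_trivial[OF line_unroll[OF b] line_unroll[OF b'] vw]
    by (auto simp: set_band_positions) (metis unroll_of_nat)
  finally show ?thesis .
qed

text \<open>A shift by one period multiplies both sides of the relation by lam, or by the inverse of
  mu.\<close>

lemma local_eq_periodic:
  assumes nz: "lam \<noteq> 0" "mu \<noteq> 0"
    and tw: "twisted (int (length b)) (int (length b')) lam mu F"
  shows "local_eq (unroll b) (unroll b') F a (x + int (length b)) y \<longleftrightarrow> local_eq (unroll b)
      (unroll b') F a x y"
    and "local_eq (unroll b) (unroll b') F a x (y + int (length b')) \<longleftrightarrow> local_eq (unroll b)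
        (unroll b') F a x y"
proof -
  define k where "k = int (length b)"
  define k' where "k' = int (length b')"
  have F: "F (x + k) y = lam * F x y" for x y using tw by (simp add: twisted_def k_def)
  have F': "F x (y + k') = inverse mu * F x y" for x y
    using tw nz(2) by (simp add: twisted_def k'_def field_simps)
  have u: "unroll b (x + k) = unroll b x" for x using unroll_periodic[of b x 1] by (simp add: k_def)
  have u': "unroll b' (x + k') = unroll b' x" for x using unroll_periodic[of b' x 1]
      by (simp add: k'_def)
  have e: "x + k + 1 = (x + 1) + k" "x + k - 1 = (x - 1) + k" for x k :: int by simp_all
  have c: "(if P then c * u else 0) + (if R then c * v else 0) = c * ((if P then u else 0) + (if
      R then v else 0))"
    for P R and c u v :: 'c by (simp add: algebra_simps)
  show "local_eq (unroll b) (unroll b') F a (x + int (length b)) y \<longleftrightarrow> local_eq (unroll b) (unroll b')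
      F a x y"
    unfolding local_eq_def k_def[symmetric] e u F c using nz(1) by simp
  show "local_eq (unroll b) (unroll b') F a x (y + int (length b')) \<longleftrightarrow> local_eq (unroll b)
      (unroll b') F a x y"
    unfolding local_eq_def k'_def[symmetric] e u' F' c using nz(2) by simp
qed

lemma local_eq_all:
  assumes b: "is_band Q \<rho> b" and b': "is_band Q \<rho> b'" and nz: "lam \<noteq> 0" "mu \<noteq> 0"
    and tw: "twisted (int (length b)) (int (length b')) lam mu F"
    and eq: "\<forall>x<length b. \<forall>y<length b'. local_eq (unroll b) (unroll b') F a (int x) (int y)"
  shows "local_eq (unroll b) (unroll b') F a x y"
proof -
  define k where "k = int (length b)"
  define k' where "k' = int (length b')"
  have k: "k > 0" "k' > 0" using band_nonempty b b' by (simp_all add: k_def k'_def)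
  have "local_eq (unroll b) (unroll b') F a (x mod k) (y mod k')"
    using eq k by (metis k'_def k_def nat_less_iff nat_0_le pos_mod_bound pos_mod_sign)
  moreover have "local_eq (unroll b) (unroll b') F a (x mod k + k * (x div k)) (y mod k') \<longleftrightarrow>
      local_eq (unroll b) (unroll b') F a (x mod k) (y mod k')"
    by (rule periodic_pred[where P = "\<lambda>x. local_eq (unroll b) (unroll b') F a x (y mod k')"])
      (simp add: local_eq_periodic(1)[OF nz tw] k_def)
  moreover have "local_eq (unroll b) (unroll b') F a x (y mod k' + k' * (y div k')) \<longleftrightarrow>
      local_eq (unroll b) (unroll b') F a x (y mod k')"
    by (rule periodic_pred[where P = "\<lambda>y. local_eq (unroll b) (unroll b') F a x y"])
      (simp add: local_eq_periodic(2)[OF nz tw] k'_def)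
  ultimately show ?thesis by simp
qed

lemma band_map_carrier:
  "v \<in> verts Q \<Longrightarrow> band_map b b' F v \<in>
    carrier_mat (rdim (band_module Q b' 1 mu) v) (rdim (band_module Q b 1 lam) v)"
  by (simp add: band_map_def rdim_band_module)

text \<open>The commutation matrices see one period in each variable; the twist spreads their
  relations to all integers. Symbols outside \<open>arcs Q\<close> do not occur on a line, so their
  relations read 0 = 0.\<close>

lemma band_map_hom_iff:
  assumes b: "is_band Q \<rho> b" and b': "is_band Q \<rho> b'" and nz: "lam \<noteq> 0" "mu \<noteq> 0"
    and vw: "vertexwise (unroll b) (unroll b') F"
    and tw: "twisted (int (length b)) (int (length b')) lam mu F"
  shows "band_map b b' F \<in> rep_hom Q (band_module Q b 1 lam) (band_module Q b' 1 mu) \<longleftrightarrow>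
    compatible (unroll b) (unroll b') F"
proof
  assume f: "band_map b b' F \<in> rep_hom Q (band_module Q b 1 lam) (band_module Q b' 1 mu)"
  have "local_eq (unroll b) (unroll b') F a x y" for a x y
  proof (cases "a \<in> arcs Q")
    case True
    then show ?thesis
      using local_eq_all[OF b b' nz tw] rep_hom_commute[OF f True]
        band_map_commute_iff[OF b b' vw tw True] by blast
  next
    case False
    then have "unroll b t \<noteq> Dir a" "unroll b t \<noteq> Inv a" "unroll b' t \<noteq> Dir a" "unroll b' t \<noteq> Inv a"
        for t
      using line_arc[OF line_unroll[OF b], of t] line_arc[OF line_unroll[OF b'], of t] by auto
    then show ?thesis by (simp add: local_eq_def)
  qed
  then show "compatible (unroll b) (unroll b') F" using vw by (simp add: compatible_def)
next
  assume c: "compatible (unroll b) (unroll b') F"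
  have "(\<lambda>v\<in>verts Q. band_map b b' F v) \<in> rep_hom Q (band_module Q b 1 lam) (band_module Q b' 1 mu)"
    using c band_map_commute_iff[OF b b' vw tw] band_map_carrier
    by (intro rep_hom_restrictI) (auto simp: compatible_def)
  moreover have "(\<lambda>v\<in>verts Q. band_map b b' F v) = band_map b b' F"
    by (auto simp: band_map_def)
  ultimately show "band_map b b' F \<in> rep_hom Q (band_module Q b 1 lam) (band_module Q b' 1 mu)"
      by simp
qed

lemma band_map_surj:
  assumes b: "is_band Q \<rho> b" and b': "is_band Q \<rho> b'" and nz: "lam \<noteq> 0" "mu \<noteq> 0"
    and f: "f \<in> rep_hom Q (band_module Q b 1 lam) (band_module Q b' 1 mu)"
  obtains F where "f = band_map b b' F" "compatible (unroll b) (unroll b') F"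
    "twisted (int (length b)) (int (length b')) lam mu F"
proof -
  define k where "k = int (length b)"
  define k' where "k' = int (length b')"
  have k: "k > 0" "k' > 0" using band_nonempty b b' by (simp_all add: k_def k'_def)
  have "\<exists>g. f v = lmat (band_positions Q b' v) (band_positions Q b v) g" if "v \<in> verts Q" for v
    using rep_hom_carrier[OF f that]
    by (metis lmat_surj distinct_band_positions mult.right_neutral rdim_band_module)
  then obtain g where g: "\<And>v. v \<in> verts Q \<Longrightarrow> f v = lmat (band_positions Q b' v)
      (band_positions Q b v) (g v)"
    by metis
  \<comment> \<open>The entries of f on one period, continued by the twist: every completed period
    contributes a factor lam in x and the inverse of mu in y.\<close>
  define F where "F x y = (if syl_src Q (unroll b x) = syl_src Q (unroll b' y)
    then lam powi (x div k) * mu powi (- (y div k')) *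
      g (syl_src Q (unroll b x)) (nat (y mod k')) (nat (x mod k)) else 0)" for x y
  have vw: "vertexwise (unroll b) (unroll b') F" by (auto simp: vertexwise_def F_def)
  have u: "unroll b (x + k) = unroll b x" for x using unroll_periodic[of b x 1] by (simp add: k_def)
  have u': "unroll b' (x + k') = unroll b' x" for x using unroll_periodic[of b' x 1]
      by (simp add: k'_def)
  have dv: "(x + k) div k = x div k + 1" "(x + k') div k' = x div k' + 1" for x using k by simp_all
  have "F (x + k) y = lam * F x y" for x y
    using nz k by (simp add: F_def u dv power_int_add)
  moreover have "mu * F x (y + k') = F x y" for x y
  proof -
    have "mu * mu powi (- (y div k' + 1)) = mu powi (- (y div k'))"
      using nz(2) power_int_add[of mu 1 "- (y div k' + 1)"] by simp
    then show ?thesis using k by (simp add: F_def u' dv)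
  qed
  ultimately have tw: "twisted k k' lam mu F" by (simp add: twisted_def)
  have "f = band_map b b' F"
  proof
    fix v show "f v = band_map b b' F v"
    proof (cases "v \<in> verts Q")
      case True
      then show ?thesis
        unfolding band_map_def restrict_apply'[OF True] g[OF True] lmat_eq_iff
        by (auto simp: set_band_positions F_def unroll_of_nat k_def k'_def)
    next
      case False
      then show ?thesis using f by (auto simp: band_map_def rep_hom_def)
    qed
  qed
  then show thesis
    using that[of F] tw band_map_hom_iff[OF b b' nz vw] f unfolding k_def k'_def by blast
qed

lemma band_map_eq_iff:
  assumes b: "is_band Q \<rho> b"
    and vw: "vertexwise (unroll b) (unroll b') F" "vertexwise (unroll b) (unroll b') H"
  shows "band_map b b' F = band_map b b' H \<longleftrightarrow>
    (\<forall>x<length b. \<forall>y<length b'. F (int x) (int y) = H (int x) (int y))"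
proof
  assume eq: "band_map b b' F = band_map b b' H"
  show "\<forall>x<length b. \<forall>y<length b'. F (int x) (int y) = H (int x) (int y)"
  proof (intro allI impI)
    fix x y assume xy: "x < length b" "y < length b'"
    show "F (int x) (int y) = H (int x) (int y)"
    proof (cases "syl_src Q (b ! x) = syl_src Q (b' ! y)")
      case True
      define v where "v = syl_src Q (b ! x)"
      have v: "v \<in> verts Q" using band_syl_src_verts[OF b, of "int x"]
          xy by (simp add: v_def unroll_of_nat)
      then show ?thesis
        using fun_cong[OF eq, of v] xy True
        unfolding band_map_def restrict_apply'[OF v] lmat_eq_iff by (auto simp: set_band_positions
            v_def)
    next
      case False
      then show ?thesis using vw xy unroll_of_nat unfolding vertexwise_def by metis
    qed
  qed
next
  assume "\<forall>x<length b. \<forall>y<length b'. F (int x) (int y) = H (int x) (int y)"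
  then show "band_map b b' F = band_map b b' H"
    unfolding band_map_def by (intro restrict_ext) (auto simp: lmat_eq_iff set_band_positions)
qed

lemma rep_zero_band_map:
  "rep_zero Q (band_module Q b 1 lam) (band_module Q b' 1 mu) = band_map b b' (\<lambda>_ _. 0)"
  unfolding rep_zero_def band_map_def by (intro restrict_ext) (simp add: rdim_band_module lmat_zero)

lemma rep_id_band_map:
  "rep_id Q (band_module Q b 1 lam) = band_map b b (\<lambda>x y. if x = y then 1 else 0)"
  unfolding rep_id_def band_map_def
  by (intro restrict_ext) (auto simp: rdim_band_module lmat_one lmat_eq_iff)

lemma band_map_comp:
  assumes vw: "vertexwise (unroll b) (unroll b') F"
  shows "rep_comp Q (band_map b' b'' H) (band_map b b' F) =
    band_map b b'' (\<lambda>x z. \<Sum>y<length b'. F x (int y) * H (int y) z)"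
  unfolding rep_comp_def band_map_def
proof (rule restrict_ext)
  fix v assume v: "v \<in> verts Q"
  have "(\<Sum>y\<in>set (band_positions Q b' v). H (int y) (int z) * F (int x) (int y)) =
      (\<Sum>y<length b'. F (int x) (int y) * H (int y) (int z))"
    if "x \<in> set (band_positions Q b v)" for x z
  proof -
    have x: "x < length b" "syl_src Q (unroll b (int x)) = v"
      using that by (auto simp: set_band_positions unroll_of_nat)
    have "F (int x) (int y) = 0" if "y < length b'" "y \<notin> set (band_positions Q b' v)" for y
      using vw[unfolded vertexwise_def, rule_format, of "int x" "int y"]
          x that unroll_of_nat[of y b']
      by (auto simp: set_band_positions)
    then show ?thesis
      by (intro sum.mono_neutral_cong_left) (auto simp: set_band_positions mult.commute)
  qed
  then show "(\<lambda>v\<in>verts Q. lmat (band_positions Q b'' v) (band_positions Q b' v) (\<lambda>y x. H (int x)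
      (int y))) v *
      (\<lambda>v\<in>verts Q. lmat (band_positions Q b' v) (band_positions Q b v) (\<lambda>y x. F (int x) (int y)))
          v =
      lmat (band_positions Q b'' v) (band_positions Q b v) (\<lambda>z x. \<Sum>y<length b'. F (int x) (int y) *
          H (int y) (int z))"
    unfolding restrict_apply'[OF v] lmat_mult[OF distinct_band_positions] lmat_eq_iff by blast
qed

section \<open>The relations act as zero on band modules\<close>

lemma band_coeff_nonzero:
  assumes b: "is_band Q \<rho> b" and "x < length b" "r < length b" "band_coeff b lam a x r \<noteq> 0"
  shows "unroll b (int x) = Dir a \<and> (\<forall>t. unroll b (int r + t) = unroll b (int x + 1 + t)) \<or>
    unroll b (int x - 1) = Inv a \<and> (\<forall>t. unroll b (int r + t) = unroll b (int x - 1 + t))"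
proof -
  have sh: "unroll b (int (Suc q mod length b) + t) = unroll b (int q + 1 + t)" for q t
  proof -
    have "(int (Suc q mod length b) + t) mod int (length b) = (int q + 1 + t) mod int (length b)"
    proof -
      have "int (Suc q mod length b) = (int q + 1) mod int (length b)"
        by (simp add: zmod_int add.commute)
      then show ?thesis by (simp only: mod_add_left_eq)
    qed
    then show ?thesis by (simp add: unroll_def)
  qed
  have "(b ! x = Dir a \<and> r = Suc x mod length b) \<or> (b ! r = Inv a \<and> x = Suc r)"
    using assms(4) unfolding band_coeff_split[OF assms(1-3)] by (auto split: if_splits)
  then show ?thesis
  proof
    assume "b ! x = Dir a \<and> r = Suc x mod length b"
    then show ?thesis using sh[of x] unroll_of_nat[OF assms(2)] by simp
  next
    assume "b ! r = Inv a \<and> x = Suc r"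
    then show ?thesis using unroll_of_nat[OF assms(3)] by simp
  qed
qed

text \<open>A path moves a basis vector along the line and cannot turn back on the way, since one
  syllable would then be both direct and inverse. So a non-zero coefficient reads the path off the
  line, directly to the right or inversely to the left.\<close>

lemma path_mat_band_module:
  fixes lam :: "'k :: field"
  assumes b: "is_band Q \<rho> b" and "awalk u p w"
  shows "\<exists>g. path_mat Q (band_module Q b 1 lam) u p = lmat (band_positions Q b w)
      (band_positions Q b u) g \<and>
    (\<forall>y x. x < length b \<longrightarrow> g y x \<noteq> 0 \<longrightarrow>
      (\<forall>i<length p. unroll b (int x + int i) = Dir (p ! i)) \<or>
      (\<forall>i<length p. unroll b (int x - 1 - int i) = Inv (p ! i)))"
  using assms(2)
proof (induction p arbitrary: u)
  case Nil
  then have "u = w" by (simp add: awalk_def)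
  have "path_mat Q (band_module Q b 1 lam) u [] = 1\<^sub>m (length (band_positions Q b u))"
    by (simp add: rdim_band_module)
  then show ?case
    using \<open>u = w\<close>
    by (intro exI[of _ "\<lambda>p q. if p = q then 1 else 0"]) (simp add: lmat_one[symmetric])
next
  case (Cons a p)
  then have a: "a \<in> arcs Q" "u = tail Q a" and p: "awalk (head Q a) p w"
      by (auto simp: awalk_Cons_iff)
  obtain g where g: "path_mat Q (band_module Q b 1 lam) (head Q a) p =
      lmat (band_positions Q b w) (band_positions Q b (head Q a)) g"
    "\<And>y x. x < length b \<Longrightarrow> g y x \<noteq> 0 \<Longrightarrow>
      (\<forall>i<length p. unroll b (int x + int i) = Dir (p ! i)) \<or>
      (\<forall>i<length p. unroll b (int x - 1 - int i) = Inv (p ! i))"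
    using Cons.IH[OF p] by blast
  define h where "h y x = (\<Sum>r\<in>set (band_positions Q b (head Q a)). g y r * band_coeff b lam a x r)"
      for y x
  have "path_mat Q (band_module Q b 1 lam) u (a # p) = lmat (band_positions Q b w)
      (band_positions Q b u) h"
  proof -
    have "path_mat Q (band_module Q b 1 lam) u (a # p) =
        lmat (band_positions Q b w) (band_positions Q b (head Q a)) g *
        lmat (band_positions Q b (head Q a)) (band_positions Q b (tail Q a))
            (\<lambda>p q. band_coeff b lam a q p)"
      using g(1) rmat_band_module_1[of Q b lam a] by (simp only: path_mat.simps)
    then show ?thesis by (simp only: lmat_mult[OF distinct_band_positions] a(2))
        (simp add: lmat_eq_iff h_def)
  qed
  moreover have "(\<forall>i<length (a # p). unroll b (int x + int i) = Dir ((a # p) ! i)) \<or>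
      (\<forall>i<length (a # p). unroll b (int x - 1 - int i) = Inv ((a # p) ! i))"
    if x: "x < length b" and nz: "h y x \<noteq> 0" for y x
  proof -
    obtain r where r: "r < length b" "g y r \<noteq> 0" "band_coeff b lam a x r \<noteq> 0"
    proof -
      obtain r where "r \<in> set (band_positions Q b (head Q a))" "g y r * band_coeff b lam a x r \<noteq> 0"
        using nz unfolding h_def by (meson sum.neutral)
      then show thesis using that by (auto simp: set_band_positions)
    qed
    from band_coeff_nonzero[OF b x r(1,3)] show ?thesis
    proof
      assume D: "unroll b (int x) = Dir a \<and> (\<forall>t. unroll b (int r + t) = unroll b (int x + 1 + t))"
      have "\<forall>i<length p. unroll b (int r + int i) = Dir (p ! i)"
        using g(2)[OF r(1,2)]
      proof
        assume I: "\<forall>i<length p. unroll b (int r - 1 - int i) = Inv (p ! i)"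
        have "length p = 0"
        proof (rule ccontr)
          assume "length p \<noteq> 0"
          then have "unroll b (int r - 1) = Inv (p ! 0)" using I by fastforce
          moreover have "unroll b (int r + (- 1)) = unroll b (int x + 1 + (- 1))" using D by blast
          ultimately show False using D by simp
        qed
        then show ?thesis by simp
      qed
      then have "unroll b (int x + int i) = Dir ((a # p) ! i)" if "i < length (a # p)" for i
        using D that by (cases i) (auto simp: algebra_simps)
      then show ?thesis by blast
    next
      assume D: "unroll b (int x - 1) = Inv a \<and> (\<forall>t. unroll b (int r + t) = unroll b (int x - 1 +
          t))"
      have I: "\<forall>i<length p. unroll b (int r - 1 - int i) = Inv (p ! i)"
        using g(2)[OF r(1,2)]
      proof
        assume I: "\<forall>i<length p. unroll b (int r + int i) = Dir (p ! i)"
        have "length p = 0"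
        proof (rule ccontr)
          assume "length p \<noteq> 0"
          then have "unroll b (int r + 0) = Dir (p ! 0)" using I by fastforce
          moreover have "unroll b (int r + 0) = unroll b (int x - 1 + 0)" using D by blast
          ultimately show False using D by simp
        qed
        then show ?thesis by simp
      qed
      have "unroll b (int x - 1 - int i) = Inv ((a # p) ! i)" if i: "i < length (a # p)" for i
      proof (cases i)
        case (Suc n)
        have "unroll b (int r + (- 1 - int n)) = unroll b (int x - 1 + (- 1 - int n))"
            using D by blast
        then show ?thesis using I Suc i by (simp add: algebra_simps)
      qed (use D in simp)
      then show ?thesis by blast
    qed
  qed
  ultimately show ?case by blast
qed

lemma cas_last: "cas u p v \<Longrightarrow> p \<noteq> [] \<Longrightarrow> v = head Q (last p)"
  by (induction p arbitrary: u) auto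

text \<open>A relation acting non-trivially would occur, itself or inverted, as a finite piece of
  the unrolled band, but all such pieces are strings.\<close>

lemma is_module_band_module:
  fixes lam :: "'k :: field"
  assumes b: "is_band Q \<rho> b"
  shows "is_module Q \<rho> (band_module Q b 1 lam)"
proof -
  have rel: "path_mat Q (band_module Q b 1 lam) (tail Q (hd r)) r =
      0\<^sub>m (rdim (band_module Q b 1 lam) (head Q (last r))) (rdim (band_module Q b 1 lam)
          (tail Q (hd r)))"
    if r: "r \<in> \<rho>" for r
  proof -
    obtain u w where "awalk u r w" "2 \<le> length r" using relation_path[OF r] by blast
    then have ne: "r \<noteq> []" and cas: "cas u r w" by (auto simp: awalk_def)
    then have ends: "u = tail Q (hd r)" "w = head Q (last r)"
      using cas_last[OF cas ne] cas_simp[OF ne, of u w] by auto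
    obtain g where g: "path_mat Q (band_module Q b 1 lam) u r = lmat (band_positions Q b w)
        (band_positions Q b u) g"
      "\<And>y x. x < length b \<Longrightarrow> g y x \<noteq> 0 \<Longrightarrow>
        (\<forall>i<length r. unroll b (int x + int i) = Dir (r ! i)) \<or>
        (\<forall>i<length r. unroll b (int x - 1 - int i) = Inv (r ! i))"
      using path_mat_band_module[OF b \<open>awalk u r w\<close>] by blast
    have "g y x = 0" if x: "x < length b" for y x
    proof (rule ccontr)
      assume "g y x \<noteq> 0"
      from g(2)[OF x this] show False
      proof
        assume D: "\<forall>i<length r. unroll b (int x + int i) = Dir (r ! i)"
        have "map (\<lambda>i. unroll b (int x + int i)) [0..<length r] = map Dir r"
          using D by (intro nth_equalityI) auto
        then have "is_string Q \<rho> (map Dir r)"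
          using line_string[OF line_unroll[OF b], of "length r" "int x"] ne by simp
        then show False using is_stringD(5)[of Q \<rho> "map Dir r" "map Dir r"] r by simp
      next
        assume D: "\<forall>i<length r. unroll b (int x - 1 - int i) = Inv (r ! i)"
        have "map (\<lambda>i. unroll b (int x - int (length r) + int i)) [0..<length r] =
            str_inv (map Dir r)"
        proof (rule nth_equalityI)
          fix i assume "i < length (map (\<lambda>i. unroll b (int x - int (length r) + int i))
              [0..<length r])"
          then have i: "i < length r" by simp
          then have e: "int x - 1 - int (length r - Suc i) = int x - int (length r) + int i"
            by (simp add: of_nat_diff)
          have "unroll b (int x - int (length r) + int i) = Inv (r ! (length r - Suc i))"
            using D[rule_format, of "length r - Suc i"] i unfolding e by simp
          then show "map (\<lambda>i. unroll b (int x - int (length r) + int i)) [0..<length r] ! i =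
              str_inv (map Dir r) ! i"
            using i by (simp add: nth_str_inv)
        qed simp
        then have "is_string Q \<rho> (str_inv (map Dir r))"
          using line_string[OF line_unroll[OF b], of "length r" "int x - int (length r)"] ne by simp
        then show False
          using is_stringD(6)[of Q \<rho> "str_inv (map Dir r)" "str_inv (map Dir r)"] r by simp
      qed
    qed
    then have "lmat (band_positions Q b w) (band_positions Q b u) g = lmat (band_positions Q b w)
        (band_positions Q b u) (\<lambda>_ _. 0)"
      unfolding lmat_eq_iff by (simp add: set_band_positions)
    then show ?thesis using g(1) ends by (simp add: rdim_band_module lmat_zero)
  qed
  show ?thesis
    unfolding is_module_def
    by (intro conjI rel ballI)
      (use rep_ok_band_module[of Q b 1 lam] in \<open>simp_all only: rep_ok_def\<close>)
qed

end

section \<open>Graph maps\<close>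

text \<open>An orientation is a sign, so that orientations multiply and position y of a line becomes
  position \<open>o' * y\<close> of the oriented one.\<close>

definition orient :: "int \<Rightarrow> (int \<Rightarrow> 'a syllable) \<Rightarrow> int \<Rightarrow> 'a syllable" where
  "orient o' s = (if o' = 1 then s else flip s)"

lemma orient_1 [simp]: "orient 1 s = s" "orient (- 1) s = flip s"
  by (simp_all add: orient_def)

lemma orient_orient: "o' \<in> {1, - 1} \<Longrightarrow> d \<in> {1, - 1} \<Longrightarrow> orient o' (orient d s) = orient (o' * d) s"
  by auto

lemma flip_eq_iff: "flip s t = Dir a \<longleftrightarrow> s (- 1 - t) = Inv a" "flip s t = Inv a \<longleftrightarrow> s (- 1 - t) = Dir a"
  by (cases "s (- 1 - t)"; simp add: flip_def)+

lemma flip_periodic: "(\<And>t. s (t + k) = s t) \<Longrightarrow> flip s (t + k) = flip s t"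
proof -
  assume p: "\<And>t. s (t + k) = s t"
  have "s (- 1 - (t + k)) = s (- 1 - (t + k) + k)" using p by metis
  also have "- 1 - (t + k) + k = - 1 - t" by simp
  finally show ?thesis by (simp add: flip_def)
qed

lemma orient_periodic: "(\<And>t. s (t + k) = s t) \<Longrightarrow> orient o' s (t + k) = orient o' s t"
  using flip_periodic[of s k] by (simp add: orient_def)

lemma diverges_periodic:
  assumes "\<And>t. s (t + k) = s t"
  shows "diverges s (x + k) s' y \<longleftrightarrow> diverges s x s' y" "diverges s' y s (x + k) \<longleftrightarrow> diverges s' y s x"
proof -
  have "s (x + k + t) = s (x + t)" for t
    using assms[of "x + t"] by (simp add: algebra_simps)
  then show "diverges s (x + k) s' y \<longleftrightarrow> diverges s x s' y" "diverges s' y s (x + k) \<longleftrightarrow>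
      diverges s' y s x"
    by (simp_all add: diverges_def)
qed

lemma diverges_cases:
  assumes "diverges s x s' y"
  obtains "is_direct (s x)" "\<not> is_direct (s' y)" | "s x = s' y"
proof -
  obtain q where q: "\<And>t. t < q \<Longrightarrow> s (x + int t) = s' (y + int t)"
    "is_direct (s (x + int q))" "\<not> is_direct (s' (y + int q))"
    using assms unfolding diverges_def by blast
  then show thesis using that q(1)[of 0] by (cases q) auto
qed

text \<open>The product k k' is a period of both lines, and adding enough multiples of it to t gives
  a non-negative number.\<close>

lemma periodic_agree:
  assumes "k > 0" "k' > 0" "\<And>t n. s (t + k * n) = s t" "\<And>t n. s' (t + k' * n) = s' t"
    and "\<And>n. s (x + int n) = s' (y + int n)"
  shows "s (x + t) = s' (y + t)"
proof -
  define n where "n = t + k * k' * \<bar>t\<bar>"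
  have "1 \<le> k * k'" using assms(1,2) by (simp add: int_one_le_iff_zero_less)
  then have "\<bar>t\<bar> \<le> k * k' * \<bar>t\<bar>" using mult_right_mono[of 1 "k * k'" "\<bar>t\<bar>"] by simp
  then have "n \<ge> 0" unfolding n_def by linarith
  have "s (x + t) = s (x + n)" using assms(3)[of "x + t" "k' * \<bar>t\<bar>"]
      by (simp add: n_def algebra_simps)
  also have "\<dots> = s' (y + n)" using assms(5)[of "nat n"] \<open>n \<ge> 0\<close> by simp
  also have "\<dots> = s' (y + t)" using assms(4)[of "y + t" "k * \<bar>t\<bar>"] by (simp add: n_def algebra_simps)
  finally show ?thesis .
qed

lemma period_multiple:
  fixes s :: "int \<Rightarrow> 'c"
  assumes "\<And>t. s (t + g) = s t"
  shows "s (t + g * n) = s t"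
  using periodic_pred[of "\<lambda>u. s u = s t" g t n] assms by simp

text \<open>By Bezout the gcd of g and the length is a period. If it were a proper divisor of the
  length, the band would be a proper power of its initial piece of that length.\<close>

lemma band_period_dvd:
  assumes b: "is_band Q \<rho> b" and per: "\<And>t. unroll b (t + g) = unroll b t"
  shows "int (length b) dvd g"
proof -
  define k where "k = length b"
  have k: "k > 0" using b by (auto simp: k_def is_band_def is_string_def)
  obtain u v where uv: "u * g + v * int k = gcd g (int k)" using bezout_int by blast
  define d where "d = nat (gcd g (int k))"
  have d: "int d = gcd g (int k)" "d > 0" using k by (simp_all add: d_def)
  have perd: "unroll b (t + int d) = unroll b t" for t
  proof -
    have "t + int d = (t + g * u) + int (length b) * v"
        using d uv by (simp add: algebra_simps k_def)
    then have "unroll b (t + int d) = unroll b (t + g * u)" by (simp only: unroll_periodic)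
    then show ?thesis using period_multiple[of "unroll b" g t u] per by simp
  qed
  have "int d dvd int k" using d(1) by simp
  then have "d dvd k" by simp
  then obtain m where m: "k = d * m" by blast
  have "b = list_power (take d b) m"
  proof (rule nth_equalityI)
    have "d \<le> length b" using m k by (cases m) (auto simp: k_def)
    then show "length b = length (list_power (take d b) m)"
        using m by (simp add: k_def mult.commute)
    fix i assume i: "i < length b"
    have "list_power (take d b) m ! i = take d b ! (i mod d)"
      using i m \<open>d \<le> length b\<close> nth_list_power[of i m "take d b"] by (simp add: k_def mult.commute)
    also have "\<dots> = unroll b (int (i mod d))"
      using d(2) \<open>d \<le> length b\<close> unroll_of_nat[of "i mod d" b] mod_less_divisor[OF d(2), of i]
          by simp
    also have "\<dots> = unroll b (int (i mod d) + int d * int (i div d))"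
      using period_multiple[of "unroll b" "int d"] perd by metis
    also have "int (i mod d) + int d * int (i div d) = int i"
      by (metis mod_mult_div_eq of_nat_add of_nat_mult)
    finally show "b ! i = list_power (take d b) m ! i" using unroll_of_nat[OF i] by simp
  qed
  then have "\<not> 2 \<le> m" using b by (auto simp: is_band_def)
  then have "m = 1" using m k by (cases m) auto
  then have "int k = gcd g (int k)" using m d(1) by simp
  then show ?thesis by (metis gcd_dvd1 k_def)
qed

text \<open>The coefficients of the shift sending \<open>e_x\<close> to \<open>e'_(x+d)\<close>: for
  y = x + d + n k one has \<open>e'_y = lam^n e'_(x+d)\<close>, whence the exponent - n.\<close>

definition monomial :: "int \<Rightarrow> int \<Rightarrow> 'k :: field \<Rightarrow> int \<Rightarrow> int \<Rightarrow> 'k" where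
  "monomial k d lam x y = (if k dvd y - x - d then lam powi (- ((y - x - d) div k)) else 0)"

text \<open>A shift by d followed by the opposite shift. If the target is read in orientation o',
  the opposite shift has displacement \<open>- o' * d\<close> and parameter
  \<open>lam powi o'\<close>.\<close>

lemma monomial_comp:
  fixes lam :: "'k :: field"
  assumes lam: "lam \<noteq> 0" and o: "o' \<in> {1, - 1 :: int}" and k: "k > 0"
    and x: "x < k" and z: "z < k"
  shows "(\<Sum>y<k. monomial (int k) d lam (int x) (o' * int y) *
      monomial (int k) (- o' * d) (lam powi o') (int y) (o' * int z)) = (if x = z then 1 else 0)"
proof -
  have oo: "o' * o' = 1" using o by auto
  have od: "int k dvd o' * w \<longleftrightarrow> int k dvd w" for w using o by auto
  \<comment> \<open>The only residue at which the first factor does not vanish.\<close>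
  define y0 where "y0 = nat ((o' * (int x + d)) mod int k)"
  have y0: "y0 < k" using k by (simp add: y0_def nat_less_iff)
  have iff: "int k dvd o' * int y - int x - d \<longleftrightarrow> y = y0" if "y < k" for y
  proof -
    have "o' * int y - int x - d = o' * (int y - o' * (int x + d))"
        using oo by (simp add: algebra_simps)
    then have "int k dvd o' * int y - int x - d \<longleftrightarrow> int k dvd int y - o' * (int x + d)"
      by (simp only: od)
    also have "\<dots> \<longleftrightarrow> int y mod int k = (o' * (int x + d)) mod int k" by (simp add: mod_eq_dvd_iff)
    also have "\<dots> \<longleftrightarrow> y = y0" using that k by (auto simp: y0_def nat_eq_iff2)
    finally show ?thesis .
  qed
  have "(\<Sum>y<k. monomial (int k) d lam (int x) (o' * int y) *
      monomial (int k) (- o' * d) (lam powi o') (int y) (o' * int z)) =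
      (\<Sum>y<k. if y = y0 then monomial (int k) d lam (int x) (o' * int y0) *
      monomial (int k) (- o' * d) (lam powi o') (int y0) (o' * int z) else 0)"
    by (rule sum.cong) (use iff in \<open>auto simp: monomial_def\<close>)
  also have "\<dots> = monomial (int k) d lam (int x) (o' * int y0) *
      monomial (int k) (- o' * d) (lam powi o') (int y0) (o' * int z)"
    using y0 by (simp add: sum.delta)
  also have "\<dots> = (if x = z then 1 else 0)"
  proof -
    obtain m where m: "o' * int y0 - int x - d = int k * m" using iff[OF y0] by (auto elim: dvdE)
    have w: "o' * int z - int y0 - - o' * d = o' * (int z - int x - int k * m)"
      unfolding m[symmetric] using oo by (simp add: algebra_simps)
    have "int k dvd o' * (int z - int x - int k * m) \<longleftrightarrow> int k dvd int z - int x - int k * m"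
      by (rule od)
    also have "\<dots> \<longleftrightarrow> int k dvd int z - int x" by (simp add: dvd_diff_left_iff)
    also have "\<dots> \<longleftrightarrow> x = z" using x z by (auto simp: mod_eq_dvd_iff[symmetric])
    finally have dz: "int k dvd o' * (int z - int x - int k * m) \<longleftrightarrow> x = z" .
    show ?thesis
    proof (cases "x = z")
      case True
      have "o' * (int z - int x - int k * m) div int k = o' * - m"
        using True k by (simp add: mult.left_commute[of o'] flip: mult_minus_right)
      then have "monomial (int k) (- o' * d) (lam powi o') (int y0) (o' * int z) = (lam powi o')
          powi (o' * m)"
        using dz True unfolding monomial_def w by simp
      also have "\<dots> = lam powi m" using oo by (simp add: power_int_mult[symmetric]
          mult.assoc[symmetric])
      finally have "monomial (int k) (- o' * d) (lam powi o') (int y0) (o' * int z) = lam powi m" .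
      moreover have "monomial (int k) d lam (int x) (o' * int y0) = lam powi (- m)"
        using k unfolding monomial_def m by simp
      ultimately show ?thesis using True lam by (simp add: power_int_minus)
    next
      case False
      then show ?thesis using dz unfolding monomial_def w by simp
    qed
  qed
  finally show ?thesis .
qed

context acyclic_string_algebra
begin

lemma twisted_monomial:
  assumes lam: "lam \<noteq> 0" and k: "k > 0"
  shows "twisted k k lam lam (monomial k d lam)"
proof -
  have "monomial k d lam (x + k) y = lam * monomial k d lam x y" for x y
  proof -
    have e: "y - (x + k) - d = (y - x - d) + (- 1) * k" by simp
    have "k dvd y - (x + k) - d \<longleftrightarrow> k dvd y - x - d"
        unfolding e by (rule dvd_add_times_triv_right_iff)
    moreover have "(y - (x + k) - d) div k = (y - x - d) div k - 1"
      using div_mult_self1[of k "y - x - d" "- 1"] k unfolding e by simp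
    moreover have "lam powi (- (n - 1)) = lam * lam powi (- n)" for n
      using lam power_int_add[of lam 1 "- n"] by simp
    ultimately show ?thesis by (simp add: monomial_def)
  qed
  moreover have "lam * monomial k d lam x (y + k) = monomial k d lam x y" for x y
  proof -
    have e: "(y + k) - x - d = (y - x - d) + 1 * k" by simp
    have "k dvd (y + k) - x - d \<longleftrightarrow> k dvd y - x - d"
        unfolding e by (rule dvd_add_times_triv_right_iff)
    moreover have "((y + k) - x - d) div k = (y - x - d) div k + 1" unfolding e using k by simp
    moreover have "lam * lam powi (- (n + 1)) = lam powi (- n)" for n
      using lam power_int_add[of lam 1 "- (n + 1)"] by simp
    ultimately show ?thesis by (simp add: monomial_def)
  qed
  ultimately show ?thesis by (simp add: twisted_def)
qed

text \<open>Reading the second line backwards reverses the direction in which its basis vectors are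
  scaled, which inverts its parameter.\<close>

lemma twisted_orient:
  assumes "mu \<noteq> 0" "o' \<in> {1, - 1 :: int}" "twisted k k' lam mu F"
  shows "twisted k k' lam (mu powi o') (\<lambda>x y. F x (o' * y))"
proof -
  have "inverse mu * F x (- y - k') = F x (- y)" for x y
  proof -
    have "mu * F x (- y - k' + k') = F x (- y - k')" using assms(3) unfolding twisted_def by blast
    then show ?thesis using assms(1) by (simp add: field_simps)
  qed
  then show ?thesis using assms(2,3) by (auto simp: twisted_def)
qed

lemma line_orient: "line s \<Longrightarrow> line (orient o' s)"
  by (simp add: orient_def line_flip)

lemma syl_src_flip: "line s \<Longrightarrow> syl_src Q (flip s t) = syl_src Q (s (- t))"
  using src_flip[of s t] by (metis fst_src fst_letter_neg)

lemma compatible_flip_right: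
  assumes "line s'" "compatible s s' F"
  shows "compatible s (flip s') (\<lambda>x y. F x (- y))"
proof -
  have "local_eq s (flip s') (\<lambda>x y. F x (- y)) a x y" for a x y
  proof -
    have "local_eq s s' F a x (- y)" using assms(2) by (simp add: compatible_def)
    moreover have "- 1 - (y - 1) = - y" "- (y - 1) = - y + 1" "- (y + 1) = - y - 1" "- 1 - y =
        - y - 1"
      by simp_all
    ultimately show ?thesis unfolding local_eq_def flip_eq_iff by (simp only: add.commute)
  qed
  then show ?thesis
    using assms syl_src_flip by (auto simp: compatible_def vertexwise_def)
qed

lemma compatible_flip_left:
  assumes "line s" "compatible s s' F"
  shows "compatible (flip s) s' (\<lambda>x y. F (- x) y)"
proof -
  have "local_eq (flip s) s' (\<lambda>x y. F (- x) y) a x y" for a x y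
  proof -
    have "local_eq s s' F a (- x) y" using assms(2) by (simp add: compatible_def)
    moreover have "- 1 - (x - 1) = - x" "- (x - 1) = - x + 1" "- (x + 1) = - x - 1" "- 1 - x =
        - x - 1"
      by simp_all
    ultimately show ?thesis unfolding local_eq_def flip_eq_iff by (simp only: add.commute)
  qed
  then show ?thesis
    using assms syl_src_flip by (auto simp: compatible_def vertexwise_def)
qed

lemma compatible_orient:
  assumes "line s'" "compatible s s' F" "o' \<in> {1, - 1}"
  shows "compatible s (orient o' s') (\<lambda>x y. F x (o' * y))"
  using assms compatible_flip_right[OF assms(1,2)] by auto

text \<open>At a common syllable the relation for its arrow has one surviving term on each side; the
  other terms would mean backtracking.\<close>

lemma compatible_step:
  assumes l: "line s" "line s'" and c: "compatible s s' F" and eq: "s x = s' y"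
  shows "F (x + 1) (y + 1) = F x y"
proof (cases "s x")
  case (Dir a)
  have "local_eq s s' F a x (y + 1)" using c by (simp add: compatible_def)
  moreover have "s (x - 1) \<noteq> Inv a" "s' (y + 1) \<noteq> Inv a"
    using line_no_backtrack[OF l(1), of "x - 1"] line_no_backtrack[OF l(2), of y] Dir eq by auto
  ultimately show ?thesis using Dir eq by (simp add: local_eq_def)
next
  case (Inv a)
  have "local_eq s s' F a (x + 1) y" using c by (simp add: compatible_def)
  moreover have "s (x + 1) \<noteq> Dir a" "s' (y - 1) \<noteq> Dir a"
    using line_no_backtrack[OF l(1), of x] line_no_backtrack[OF l(2), of "y - 1"] Inv eq by auto
  ultimately show ?thesis using Inv eq by (simp add: local_eq_def)
qed

text \<open>The wrong ending, where the first line goes up and the second goes down: the relation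
  for the arrow of the second line isolates F x y.\<close>

lemma compatible_zero:
  assumes l: "line s" "line s'" and c: "compatible s s' F" and eq: "src (s x) = src (s' y)"
    and d: "\<not> is_direct (s x)" "is_direct (s' y)"
  shows "F x y = 0"
proof -
  obtain a where a: "s' y = Dir a" using d(2) by (cases "s' y") auto
  have "local_eq s s' F a x (y + 1)" using c by (simp add: compatible_def)
  moreover have "s x \<noteq> Dir a" using d(1) by auto
  moreover have "s' (y + 1) \<noteq> Inv a" using line_no_backtrack[OF l(2), of y] a by auto
  \<comment> \<open>Here the signs decide: if the same arrow met x from the left, the letters at x
    and y would be opposite.\<close>
  moreover have "s (x - 1) \<noteq> Inv a"
  proof
    assume "s (x - 1) = Inv a"
    then have "src (s x) = tgt (syl_inv (s' y))" using line_step[OF l(1), of "x - 1"] a by simp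
    then have "src (s' y) = letter_neg (src (s' y))" using eq by simp
    then show False using letter_src_neq_neg[OF line_arc[OF l(2)]] by blast
  qed
  ultimately show ?thesis using a by (simp add: local_eq_def)
qed

lemma compatible_constant:
  assumes "line s" "line s'" "compatible s s' F" "\<And>t. t < n \<Longrightarrow> s (x + int t) = s' (y + int t)"
  shows "F (x + int n) (y + int n) = F x y"
  using assms(4)
proof (induction n)
  case (Suc n)
  then have "F (x + int n) (y + int n) = F x y" "s (x + int n) = s' (y + int n)" by auto
  then show ?case using compatible_step[OF assms(1-3), of "x + int n" "y + int n"]
      by (simp add: algebra_simps)
qed simp

text \<open>At the first difference the letters are still equal, so the directions differ. F is
  constant along the common part, hence non-zero there, and \<open>compatible_zero\<close> leaves
  only the case that is a divergence.\<close>

lemma compatible_right: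
  assumes l: "line s" "line s'" and c: "compatible s s' F" and eq: "src (s x) = src (s' y)"
    and nz: "F x y \<noteq> 0"
  shows "(\<forall>n::nat. s (x + int n) = s' (y + int n)) \<or> diverges s x s' y"
proof (cases "\<forall>n::nat. s (x + int n) = s' (y + int n)")
  case False
  define n where "n = (LEAST n::nat. s (x + int n) \<noteq> s' (y + int n))"
  have n: "s (x + int n) \<noteq> s' (y + int n)" unfolding n_def by (rule LeastI_ex) (use False in blast)
  have agree: "s (x + int t) = s' (y + int t)" if "t < n" for t
    using not_less_Least[of t "\<lambda>n. s (x + int n) \<noteq> s' (y + int n)"] that n_def by blast
  have "src (s (x + int n)) = src (s' (y + int n))"
    using agree by (intro line_agree(2)[OF l eq]) simp
  moreover have "F (x + int n) (y + int n) \<noteq> 0"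
    using compatible_constant[OF l c agree] nz by simp
  ultimately have "is_direct (s (x + int n)) \<and> \<not> is_direct (s' (y + int n))"
    using n compatible_zero[OF l c] letter_src_inj line_arc l by metis
  then show ?thesis using agree divergesI[of n s x s' y] by blast
qed blast

text \<open>Without a graph pair the agreement never ends on at least one side, and by periodicity
  agreement on one side is agreement everywhere.\<close>

lemma compatible_bands:
  assumes b: "is_band Q \<rho> b" "is_band Q \<rho> b'" and c: "compatible (unroll b) (unroll b') F"
    and eq: "src (unroll b x) = src (unroll b' y)" and nz: "F x y \<noteq> 0"
    and ng: "\<not> graph_pair (unroll b) (unroll b') x y"
  shows "unroll b (x + t) = unroll b' (y + t)"
proof -
  note l = line_unroll[OF b(1)] line_unroll[OF b(2)]
  have k: "int (length b) > 0" "int (length b') > 0" using band_nonempty b by simp_all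
  have c': "compatible (flip (unroll b)) (flip (unroll b')) (\<lambda>x y. F (- x) (- y))"
    using compatible_flip_left[OF l(1) compatible_flip_right[OF l(2) c]] .
  have "(\<forall>n::nat. flip (unroll b) (- x + int n) = flip (unroll b') (- y + int n)) \<or>
      diverges (flip (unroll b)) (- x) (flip (unroll b')) (- y)"
    using compatible_right[OF line_flip[OF l(1)] line_flip[OF l(2)] c', of "- x" "- y"] eq nz l
    by (simp add: src_flip)
  moreover have "(\<forall>n::nat. unroll b (x + int n) = unroll b' (y + int n)) \<or> diverges (unroll b)
      x (unroll b') y"
    using compatible_right[OF l c eq nz] .
  moreover have "unroll b (x + t) = unroll b' (y + t)" if "\<forall>n::nat. unroll b (x + int n) =
      unroll b' (y + int n)"
    by (rule periodic_agree[OF k]) (use that in simp_all)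
  moreover have "unroll b (x + t) = unroll b' (y + t)"
    if "\<forall>n::nat. flip (unroll b) (- x + int n) = flip (unroll b') (- y + int n)"
  proof -
    have "flip (unroll b) (t + int (length b) * n) = flip (unroll b) t"
      "flip (unroll b') (t + int (length b') * n) = flip (unroll b') t" for t n
      by (rule flip_periodic, simp)+
    then have "flip (unroll b) (- x + (- 1 - t)) = flip (unroll b') (- y + (- 1 - t))"
      using periodic_agree[OF k, of "flip (unroll b)" "flip (unroll b')" "- x" "- y" "- 1 - t"]
          that by simp
    then show ?thesis by (simp add: flip_def add.commute)
  qed
  ultimately show ?thesis using ng eq unfolding graph_pair_def by blast
qed

lemma src_eq_or_neg:
  assumes "syl_arc x \<in> arcs Q" "syl_arc y \<in> arcs Q" "syl_src Q x = syl_src Q y"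
  shows "src x = src y \<or> src x = letter_neg (src y)"
proof -
  have "syl_sgn_src \<sigma> \<epsilon> z \<in> {-1, 1}" if "syl_arc z \<in> arcs Q" for z
    using sign_values that by (cases z) auto
  from this[OF assms(1)] this[OF assms(2)] show ?thesis
    using assms(3) by (auto simp: letter_src_def letter_neg_def)
qed

definition orient_band :: "int \<Rightarrow> 'b syllable list \<Rightarrow> 'b syllable list" where
  "orient_band o' b = (if o' = 1 then b else str_inv b)"

lemma is_band_orient_band: "is_band Q \<rho> b \<Longrightarrow> is_band Q \<rho> (orient_band o' b)"
  by (simp add: orient_band_def is_band_str_inv)

lemma length_orient_band [simp]: "length (orient_band o' b) = length b"
  by (simp add: orient_band_def)

lemma unroll_orient_band: "is_band Q \<rho> b \<Longrightarrow> unroll (orient_band o' b) = orient o' (unroll b)"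
  by (simp add: orient_band_def orient_def unroll_str_inv band_nonempty)

text \<open>Positions over the same vertex have equal or opposite letters; orienting the second line
  accordingly reduces the claim to \<open>compatible_bands\<close>.\<close>

lemma compatible_imp_agree:
  assumes b: "is_band Q \<rho> b" "is_band Q \<rho> b'" and c: "compatible (unroll b) (unroll b') F"
    and nz: "F x y \<noteq> 0"
    and ng: "\<And>o' x y. o' \<in> {1, - 1} \<Longrightarrow> \<not> graph_pair (unroll b) (orient o' (unroll b')) x y"
  obtains o' where "o' \<in> {1, - 1}" "\<And>t. unroll b (x + t) = orient o' (unroll b') (o' * y + t)"
proof -
  note l = line_unroll[OF b(1)] line_unroll[OF b(2)]
  have "syl_src Q (unroll b x) = syl_src Q (unroll b' y)"
    using c nz by (auto simp: compatible_def vertexwise_def)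
  then have "src (unroll b x) = src (unroll b' y) \<or> src (unroll b x) =
      letter_neg (src (unroll b' y))"
    using src_eq_or_neg line_arc l by blast
  then obtain o' where o: "o' \<in> {1, - 1}" "src (unroll b x) = src (orient o' (unroll b') (o' * y))"
    using src_flip[OF l(2), of "- y"] that[of 1] by (metis insertI1 insertI2 minus_minus mult_1
        mult_minus1 orient_1 singletonI)
  have "unroll b (x + t) = unroll (orient_band o' b') (o' * y + t)" for t
  proof (rule compatible_bands[OF b(1) is_band_orient_band[OF b(2)]])
    show "compatible (unroll b) (unroll (orient_band o' b')) (\<lambda>x y. F x (o' * y))"
      using compatible_orient[OF l(2) c o(1)] by (simp add: unroll_orient_band[OF b(2)])
    show "F x (o' * (o' * y)) \<noteq> 0" using nz o(1) by auto
  qed (use o ng unroll_orient_band[OF b(2)] in simp_all)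
  then show thesis using that o(1) unroll_orient_band[OF b(2)] by simp
qed

text \<open>A reversal preserving the line would have a centre: a syllable equal to its own inverse,
  or a junction of two mutually inverse syllables.\<close>

lemma not_self_inverse:
  assumes "line s" "\<And>t. s (x + t) = flip s (y + t)"
  shows False
proof -
  \<comment> \<open>The reversal sends the syllable index u to c - u, so the parity of c separates
    the two kinds of centre.\<close>
  define c where "c = x - y - 1"
  have s: "s u = syl_inv (s (c - u))" for u
    using assms(2)[of "u - x"] by (simp add: flip_def c_def algebra_simps)
  show False
  proof (cases "even c")
    case True
    then obtain u where "c = u + u" by (metis evenE mult_2)
    then have "s u = syl_inv (s u)" using s[of u] by simp
    then show False by (cases "s u") auto
  next
    case False
    then obtain u where "c = u + u + 1" by (metis oddE mult_2)
    then show False using s[of u] line_no_backtrack[OF assms(1), of u] by (simp add: add.commute)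
  qed
qed

text \<open>The coefficients are supported on pairs with equal syllables and depend on y - x only,
  so the terms of each relation match in pairs.\<close>

lemma compatible_monomial:
  assumes l: "line s" "line s'" and per: "\<And>t n. s' (t + k * n) = s' t"
    and shift: "\<And>t. s' (t + d) = s t"
  shows "compatible s s' (monomial k d lam)"
proof -
  have nz: "s' y = s x" if "monomial k d lam x y \<noteq> 0" for x y
  proof -
    have "k dvd y - x - d" using that by (auto simp: monomial_def split: if_splits)
    then obtain n where "y - x - d = k * n" by blast
    then have "y = (x + d) + k * n" by simp
    then show ?thesis using per shift by metis
  qed
  have diag: "monomial k d lam (x + e) y = monomial k d lam x (y - e)" for x y e
    by (simp add: monomial_def algebra_simps)
  have "local_eq s s' (monomial k d lam) a x y" for a x y
  proof -
    have "s x = s' (y - 1) \<or> monomial k d lam (x + 1) y = 0"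
      using nz[of x "y - 1"] diag[of x 1 y] by metis
    moreover have "s (x - 1) = s' y \<or> monomial k d lam (x - 1) y = 0"
      using nz[of "x - 1" y] by metis
    moreover have "monomial k d lam x (y - 1) = monomial k d lam (x + 1) y"
      "monomial k d lam x (y + 1) = monomial k d lam (x - 1) y"
      using diag[of x 1 y] diag[of x "- 1" y] by simp_all
    ultimately show ?thesis unfolding local_eq_def by auto
  qed
  moreover have "vertexwise s s' (monomial k d lam)"
    using nz unfolding vertexwise_def by metis
  ultimately show ?thesis by (simp add: compatible_def)
qed

lemma band_map_monomial:
  assumes b: "is_band Q \<rho> b" "is_band Q \<rho> b'" and len: "length b' = length b"
    and lam: "lam \<noteq> 0" and o: "o' \<in> {1, - 1}"
    and shift: "\<And>t. orient o' (unroll b') (t + d) = unroll b t"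
  defines "F \<equiv> \<lambda>x y. monomial (int (length b)) d lam x (o' * y)"
  shows "band_map b b' F \<in> rep_hom Q (band_module Q b 1 lam) (band_module Q b' 1 (lam powi o'))"
    and "vertexwise (unroll b) (unroll b') F"
proof -
  note l = line_unroll[OF b(1)] line_unroll[OF b(2)]
  have k: "int (length b) > 0" using band_nonempty b by simp
  have c: "compatible (unroll b) (orient o' (unroll b')) (monomial (int (length b)) d lam)"
    by (rule compatible_monomial[OF l(1) line_orient[OF l(2)] _ shift])
      (rule orient_periodic, simp flip: len)
  then have "compatible (unroll b) (orient o' (orient o' (unroll b'))) F"
    unfolding F_def by (rule compatible_orient[OF line_orient[OF l(2)] _ o])
  moreover have "orient o' (orient o' (unroll b')) = unroll b'" using o by auto
  ultimately have c: "compatible (unroll b) (unroll b') F" by simp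
  then show vw: "vertexwise (unroll b) (unroll b') F" by (simp add: compatible_def)
  have "twisted (int (length b)) (int (length b')) lam (lam powi o') F"
    unfolding F_def len using twisted_orient[OF lam o twisted_monomial[OF lam k]] .
  then show "band_map b b' F \<in> rep_hom Q (band_module Q b 1 lam) (band_module Q b' 1 (lam powi o'))"
    using band_map_hom_iff[OF b lam _ vw] c lam by simp
qed

lemma vertexwise_comp:
  assumes F: "vertexwise s s' F" and H: "vertexwise s' s'' H"
  shows "vertexwise s s'' (\<lambda>x z. \<Sum>y<k. F x (int y) * H (int y) z)"
  unfolding vertexwise_def
proof (intro allI impI)
  fix x z assume "(\<Sum>y<k. F x (int y) * H (int y) z) \<noteq> 0"
  then obtain y where "F x (int y) * H (int y) z \<noteq> 0" by (meson sum.neutral)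
  then have "F x (int y) \<noteq> 0" "H (int y) z \<noteq> 0" by auto
  then show "syl_src Q (s x) = syl_src Q (s'' z)"
    using F H unfolding vertexwise_def by metis
qed

text \<open>The shift along the common line and the opposite shift are mutually inverse morphisms; a
  reversal inverts the parameter.\<close>

lemma band_module_iso:
  assumes b: "is_band Q \<rho> b" "is_band Q \<rho> b'" and len: "length b' = length b"
    and lam: "lam \<noteq> 0" and o: "o' \<in> {1, - 1}"
    and shift: "\<And>t. orient o' (unroll b') (t + d) = unroll b t"
  shows "rep_iso Q (band_module Q b 1 lam) (band_module Q b' 1 (lam powi o'))"
proof -
  define k where "k = length b"
  have k: "k > 0" using band_nonempty b by (simp add: k_def)
  have oo: "o' * o' = 1" using o by auto
  have mu: "lam powi o' \<noteq> 0" "(lam powi o') powi o' = lam"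
    using lam oo by (simp_all add: power_int_mult[symmetric])
  have shift': "orient o' (unroll b) (t + - o' * d) = unroll b' t" for t
  proof (cases "o' = 1")
    case True
    then show ?thesis using shift[of "t - d"] by simp
  next
    case False
    then have "o' = - 1" using o by simp
    then have "syl_inv (unroll b' t) = unroll b (- 1 - (d + t))"
      using shift[of "- 1 - (t + d)"] by (simp add: flip_def algebra_simps)
    then have "unroll b' t = syl_inv (unroll b (- 1 - (d + t)))" by (metis syl_inv_syl_inv)
    then show ?thesis using \<open>o' = - 1\<close> by (simp add: flip_def add.commute)
  qed
  define F where "F x y = monomial (int k) d lam x (o' * y)" for x y
  define H where "H x y = monomial (int k) (- o' * d) (lam powi o') x (o' * y)" for x y
  have F: "band_map b b' F \<in> rep_hom Q (band_module Q b 1 lam) (band_module Q b' 1 (lam powi o'))"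
    "vertexwise (unroll b) (unroll b') F"
    using band_map_monomial[OF b len lam o shift] unfolding F_def k_def by simp_all
  have H: "band_map b' b H \<in> rep_hom Q (band_module Q b' 1 (lam powi o')) (band_module Q b 1 lam)"
    "vertexwise (unroll b') (unroll b) H"
    using band_map_monomial[OF b(2,1) len[symmetric] mu(1) o shift'] unfolding H_def k_def mu(2)
        len by simp_all
  have id: "vertexwise s s (\<lambda>x y. if x = y then 1 else 0 :: 'c)"
      for s by (auto simp: vertexwise_def)
  have FH: "vertexwise (unroll b) (unroll b) (\<lambda>x z. \<Sum>y<k. F x (int y) * H (int y) z)"
    "vertexwise (unroll b') (unroll b') (\<lambda>x z. \<Sum>y<k. H x (int y) * F (int y) z)"
    using vertexwise_comp F(2) H(2) by blast+
  have "rep_comp Q (band_map b' b H) (band_map b b' F) = rep_id Q (band_module Q b 1 lam)"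
    unfolding band_map_comp[OF F(2)] rep_id_band_map len k_def[symmetric] band_map_eq_iff[OF b(1)
        FH(1) id]
    using monomial_comp[OF lam o k] unfolding F_def H_def by (simp add: k_def[symmetric])
  moreover have "rep_comp Q (band_map b b' F) (band_map b' b H) =
      rep_id Q (band_module Q b' 1 (lam powi o'))"
    unfolding band_map_comp[OF H(2)] rep_id_band_map k_def[symmetric] band_map_eq_iff[OF b(2) FH(2)
        id]
    using monomial_comp[OF mu(1) o k, of _ _ "- o' * d"] oo unfolding F_def H_def mu(2)
    by (simp add: len k_def[symmetric] mult.assoc[symmetric])
  ultimately show ?thesis unfolding rep_iso_def using F(1) H(1) by blast
qed

text \<open>A non-zero coefficient forces the lines to coincide up to shift and orientation.
  Primitivity then gives equal lengths, and following the line once around compares the parameters,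
  so that the modules would be isomorphic.\<close>

lemma hom_zero_band_modules:
  assumes b: "is_band Q \<rho> b" "is_band Q \<rho> b'" and nz: "lam \<noteq> 0" "mu \<noteq> 0"
    and ng: "\<And>o' x y. o' \<in> {1, - 1} \<Longrightarrow> \<not> graph_pair (unroll b) (orient o' (unroll b')) x y"
    and niso: "\<not> rep_iso Q (band_module Q b 1 lam) (band_module Q b' 1 mu)"
  shows "hom_zero Q (band_module Q b 1 lam) (band_module Q b' 1 mu)"
  unfolding hom_zero_def
proof
  fix f assume f: "f \<in> rep_hom Q (band_module Q b 1 lam) (band_module Q b' 1 mu)"
  note l = line_unroll[OF b(1)] line_unroll[OF b(2)]
  obtain F where F: "f = band_map b b' F" "compatible (unroll b) (unroll b') F"
    "twisted (int (length b)) (int (length b')) lam mu F"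
    using band_map_surj[OF b nz f] .
  have "F x y = 0" for x y
  proof (rule ccontr)
    assume Fxy: "F x y \<noteq> 0"
    obtain o' where o: "o' \<in> {1, - 1}" and agree: "\<And>t. unroll b (x + t) = orient o' (unroll b')
        (o' * y + t)"
      using compatible_imp_agree[OF b F(2) Fxy ng] by blast
    define b'' where "b'' = orient_band o' b'"
    have b'': "is_band Q \<rho> b''" "unroll b'' = orient o' (unroll b')" "length b'' = length b'"
      using is_band_orient_band[OF b(2)] unroll_orient_band[OF b(2)] by (simp_all add: b''_def)
    have shift: "unroll b'' (t + (o' * y - x)) = unroll b t" for t
      using agree[of "t - x"] b''(2) by (simp add: algebra_simps)
    have "int (length b) dvd int (length b'')"
    proof (rule band_period_dvd[OF b(1)])
      fix t
      have "unroll b (t + int (length b'')) = unroll b'' (t + (o' * y - x) + int (length b'') * 1)"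
        using shift[of "t + int (length b'')"] by (simp add: algebra_simps)
      then show "unroll b (t + int (length b'')) = unroll b t"
        using shift[of t] by (simp only: unroll_periodic)
    qed
    moreover have "int (length b'') dvd int (length b)"
    proof (rule band_period_dvd[OF b''(1)])
      fix t
      have "unroll b'' (t + int (length b)) = unroll b (t - (o' * y - x) + int (length b) * 1)"
        using shift[of "t - (o' * y - x) + int (length b)"] by (simp add: algebra_simps)
      then show "unroll b'' (t + int (length b)) = unroll b'' t"
        using shift[of "t - (o' * y - x)"] by (simp only: unroll_periodic) simp
    qed
    ultimately have len: "length b' = length b" using b''(3) dvd_antisym by (metis int_dvd_int_iff)
    define F' where "F' x y = F x (o' * y)" for x y
    have c': "compatible (unroll b) (orient o' (unroll b')) F'"
      unfolding F'_def using compatible_orient[OF l(2) F(2) o] .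
    have tw': "twisted (int (length b)) (int (length b)) lam (mu powi o') F'"
      unfolding F'_def using twisted_orient[OF nz(2) o F(3)] len by simp
    have F'xy: "F' x (o' * y) \<noteq> 0" using Fxy o by (auto simp: F'_def)
    \<comment> \<open>Once around the band: F' is constant along the common line, while the two
      twists together would multiply it by lam over \<open>mu powi o'\<close>.\<close>
    have "F' (x + int (length b)) (o' * y + int (length b)) = F' x (o' * y)"
      using compatible_constant[OF l(1) line_orient[OF l(2)] c'] agree by blast
    moreover have "mu powi o' * F' (x + int (length b)) (o' * y + int (length b)) = lam * F' x (o' *
        y)"
      using tw' by (simp add: twisted_def)
    ultimately have "mu powi o' = lam" using F'xy by simp
    moreover have "(mu powi o') powi o' = mu" using o by auto
    ultimately have "lam powi o' = mu" by simp
    moreover have "rep_iso Q (band_module Q b 1 lam) (band_module Q b' 1 (lam powi o'))"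
      by (rule band_module_iso[OF b len nz(1) o]) (rule shift[unfolded b''(2)])
    ultimately show False using niso by simp
  qed
  then have "F = (\<lambda>_ _. 0)" by blast
  then show "f = rep_zero Q (band_module Q b 1 lam) (band_module Q b' 1 mu)"
    using F(1) by (simp only: rep_zero_band_map)
qed

text \<open>A non-zero off-diagonal coefficient would make the line invariant under a shift that is
  no multiple of its period, or under a reversal; both are impossible. The diagonal is constant
  along the line, so every endomorphism is a scalar.\<close>

lemma is_brick_band_module:
  fixes lam :: "'k :: field"
  assumes b: "is_band Q \<rho> b" and lam: "lam \<noteq> 0"
    and ng: "\<And>o' x y. o' \<in> {1, - 1} \<Longrightarrow> \<not> graph_pair (unroll b) (orient o' (unroll b)) x y"
  shows "is_brick Q \<rho> (band_module Q b 1 lam)"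
proof -
  note l = line_unroll[OF b]
  let ?M = "band_module Q b 1 lam"
  define I :: "'k \<Rightarrow> 'a \<Rightarrow> 'k mat" where "I c = band_map b b (\<lambda>x y. if x = y then c else 0)" for c
  have vw: "vertexwise s s (\<lambda>x y. if x = y then c else 0 :: 'k)"
      for s c by (auto simp: vertexwise_def)
  have scalar: "\<exists>c. f = I c" if f: "f \<in> rep_hom Q ?M ?M" for f
  proof -
    obtain F where F: "f = band_map b b F" "compatible (unroll b) (unroll b) F"
      "twisted (int (length b)) (int (length b)) lam lam F"
      using band_map_surj[OF b b lam lam f] .
    have off: "F (int x) (int y) = 0" if "x < length b" "y < length b" "x \<noteq> y" for x y
    proof (rule ccontr)
      assume nz: "F (int x) (int y) \<noteq> 0"
      obtain o' where o: "o' \<in> {1, - 1}"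
        and agree: "\<And>t. unroll b (int x + t) = orient o' (unroll b) (o' * int y + t)"
        using compatible_imp_agree[OF b b F(2) nz ng] by blast
      show False
      proof (cases "o' = 1")
        case True
        have "unroll b (t + (int x - int y)) = unroll b t" for t
          using agree[of "t - int y"] True by (simp add: algebra_simps)
        then have "int (length b) dvd int x - int y" using band_period_dvd[OF b] by blast
        then have "int x mod int (length b) = int y mod int (length b)"
            by (simp add: mod_eq_dvd_iff)
        then show False using that by simp
      next
        case False
        then have "o' = - 1" using o by simp
        then show False using not_self_inverse[OF l, of "int x" "- int y"] agree by simp
      qed
    qed
    have "F (int x) (int x) = F 0 0" for x
      using compatible_constant[OF l l F(2), of x 0 0] by simp
    then have "f = I (F 0 0)"
      unfolding F(1) I_def using off F(2)
      by (subst band_map_eq_iff[OF b _ vw]) (auto simp: compatible_def)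
    then show ?thesis by blast
  qed
  have I_smult: "I c = (\<lambda>v\<in>verts Q. c \<cdot>\<^sub>m (1\<^sub>m (rdim ?M v)))" for c
    unfolding I_def band_map_def
    by (intro restrict_ext) (auto simp: rdim_band_module lmat_def nth_eq_iff_index_eq intro!:
        eq_matI)
  have I_hom: "I c \<in> rep_hom Q ?M ?M" for c
    unfolding I_smult
  proof (rule rep_hom_restrictI)
    fix a assume "a \<in> arcs Q"
    then have "rmat ?M a \<in> carrier_mat (rdim ?M (head Q a)) (rdim ?M (tail Q a))"
      using rep_ok_band_module[of Q b 1 lam] unfolding rep_ok_def by blast
    note R = this
    show "c \<cdot>\<^sub>m 1\<^sub>m (rdim ?M (head Q a)) * rmat ?M a = rmat ?M a * (c \<cdot>\<^sub>m 1\<^sub>m (rdim ?M (tail Q a)))"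
      unfolding mult_smult_distrib[OF R one_carrier_mat] mult_smult_assoc_mat[OF one_carrier_mat R]
        left_mult_one_mat[OF R] right_mult_one_mat[OF R] ..
  qed simp
  have I_inj: "c = c'" if "I c = I c'" for c c'
  proof -
    have "0 < length b" using band_nonempty[OF b] by simp
    then show ?thesis using that unfolding I_def band_map_eq_iff[OF b vw vw] by force
  qed
  have I_mult: "rep_comp Q (I c) (I c') = I (c * c')" for c c'
    unfolding rep_comp_def I_smult
    by (intro restrict_ext) (auto intro!: eq_matI simp: mult_smult_distrib[of _ _ _ _ _ c'])
  have I_add: "(\<lambda>v\<in>verts Q. I c v + I c' v) = I (c + c')" for c c'
    unfolding I_smult by (intro restrict_ext) (auto intro!: eq_matI simp: algebra_simps)
  have I_scale: "(\<lambda>v\<in>verts Q. d \<cdot>\<^sub>m I c v) = I (d * c)" for c d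
    unfolding I_smult by (intro restrict_ext) (auto intro!: eq_matI)
  have I_one: "I 1 = rep_id Q ?M"
    unfolding I_smult rep_id_def by (intro restrict_ext) (auto intro!: eq_matI)
  define h where "h f = (THE c. f = I c)" for f
  have h: "h (I c) = c" for c unfolding h_def using I_inj by blast
  have carrier: "rep_hom Q ?M ?M = range I" using scalar I_hom by blast
  have "h \<in> ring_iso (end_algebra Q ?M) ground_algebra"
    unfolding ring_iso_def Ring.ring_hom_def
    by (auto simp: end_algebra_def ground_algebra_def carrier[unfolded One_nat_def] h I_mult I_add
        I_one[symmetric, unfolded One_nat_def]
        bij_betw_def inj_on_def image_image)
  moreover have "\<forall>c. \<forall>x\<in>carrier (end_algebra Q ?M).
      h (c \<odot>\<^bsub>end_algebra Q ?M\<^esub> x) = c \<odot>\<^bsub>ground_algebra\<^esub> h x"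
    by (auto simp: end_algebra_def ground_algebra_def carrier[unfolded One_nat_def] h I_scale)
  ultimately show ?thesis
    unfolding is_brick_def is_alg_iso_def using is_module_band_module[OF b] by blast
qed

section \<open>Graph maps as morphisms\<close>

lemma graph_pair_periodic:
  assumes "\<And>t. s (t + k) = s t"
  shows "graph_pair s s' (x + k) y \<longleftrightarrow> graph_pair s s' x y"
    and "graph_pair s' s y (x + k) \<longleftrightarrow> graph_pair s' s y x"
proof -
  have m: "s (t + - k) = s t" for t using assms[of "t - k"] by simp
  have f: "flip s (t + - k) = flip s t" for t by (rule flip_periodic) (rule m)
  show "graph_pair s s' (x + k) y \<longleftrightarrow> graph_pair s s' x y"
    "graph_pair s' s y (x + k) \<longleftrightarrow> graph_pair s' s y x"
    using diverges_periodic[where s = "flip s" and k = "- k" and x = "- x"] f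
      diverges_periodic[where s = s and k = k and x = x] assms
    by (simp_all add: graph_pair_def)
qed

text \<open>The length of the common part to the left of (x, y). At a graph pair the minimum exists,
  because the divergence on the left provides a difference.\<close>

definition left_extent :: "(int \<Rightarrow> 'b syllable) \<Rightarrow> (int \<Rightarrow> 'b syllable) \<Rightarrow> int \<Rightarrow> int \<Rightarrow> nat" where
  "left_extent s s' x y = (LEAST p. s (x - 1 - int p) \<noteq> s' (y - 1 - int p))"

text \<open>
  The sum of all graph maps for the given orientations. The coefficient at \<open>(x, y)\<close> depends only on
  the left end of the common substring through \<open>(x, y)\<close>, so that it is constant along the substring.
\<close>

definition graph_map :: "(int \<Rightarrow> 'b syllable) \<Rightarrow> (int \<Rightarrow> 'b syllable) \<Rightarrow> int \<Rightarrow> int \<Rightarrow> 'k \<Rightarrow> 'k \<Rightarrow> int \<Rightarrow> int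
    \<Rightarrow> 'k :: field" where
  "graph_map s s' k k' lam mu x y = (if graph_pair s s' x y
    then lam powi ((x - int (left_extent s s' x y)) div k) *
      mu powi (- ((y - int (left_extent s s' x y)) div k')) else 0)"

lemma left_extent_step:
  assumes gp: "graph_pair s s' x y" and eq: "s x = s' y"
  shows "left_extent s s' (x + 1) (y + 1) = Suc (left_extent s s' x y)"
proof -
  have "diverges (flip s) (- x) (flip s') (- y)" using gp by (simp add: graph_pair_def)
  then obtain p where "is_direct (flip s (- x + int p))" "\<not> is_direct (flip s' (- y + int p))"
    unfolding diverges_def by blast
  then have "s (x - 1 - int p) \<noteq> s' (y - 1 - int p)"
    by (auto simp: flip_def algebra_simps)
  then have "s (x + 1 - 1 - int (Suc p)) \<noteq> s' (y + 1 - 1 - int (Suc p))"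
      by (simp add: algebra_simps)
  then have "left_extent s s' (x + 1) (y + 1) =
      Suc (LEAST p. s (x + 1 - 1 - int (Suc p)) \<noteq> s' (y + 1 - 1 - int (Suc p)))"
    unfolding left_extent_def by (rule Least_Suc) (use eq in simp)
  then show ?thesis by (simp add: left_extent_def algebra_simps)
qed

lemma graph_map_step:
  assumes l: "line s" "line s'" and eq: "s x = s' y"
  shows "graph_map s s' k k' lam mu (x + 1) (y + 1) = graph_map s s' k k' lam mu x y"
  using graph_pair_step[OF l, of x y] left_extent_step[of s s' x y] eq by (simp add: graph_map_def)

text \<open>The direct and the inverse terms of the relation cancel separately. Along a common
  syllable the coefficients are equal; where the syllables differ they vanish, because at the ends
  of the substring the first line goes down and the second up.\<close>

lemma compatible_graph_map:
  assumes l: "line s" "line s'"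
  shows "compatible s s' (graph_map s s' k k' lam mu)"
proof -
  let ?F = "graph_map s s' k k' lam mu"
  have nz: "graph_pair s s' x y" if "?F x y \<noteq> 0" for x y
    using that by (auto simp: graph_map_def split: if_splits)
  have right: "is_direct (s x) \<and> \<not> is_direct (s' y) \<or> s x = s' y" if "?F x y \<noteq> 0" for x y
    using nz[OF that] unfolding graph_pair_def by (metis diverges_cases)
  have left: "\<not> is_direct (s (x - 1)) \<and> is_direct (s' (y - 1)) \<or> s (x - 1) = s' (y - 1)" if
      "?F x y \<noteq> 0" for x y
  proof -
    have "diverges (flip s) (- x) (flip s') (- y)" using nz[OF that] by (simp add: graph_pair_def)
    then have "is_direct (flip s (- x)) \<and> \<not> is_direct (flip s' (- y)) \<or> flip s (- x) =
        flip s' (- y)"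
      by (metis diverges_cases)
    then show ?thesis by (simp add: flip_def)
  qed
  have "local_eq s s' ?F a x y" for a x y
  proof -
    have 1: "?F (x + 1) y = 0" if "s x = Dir a" "s' (y - 1) \<noteq> Dir a"
      using left[of "x + 1" y] that by fastforce
    have 2: "?F x (y - 1) = 0" if "s' (y - 1) = Dir a" "s x \<noteq> Dir a"
      using right[of x "y - 1"] that by fastforce
    have 3: "?F (x - 1) y = 0" if "s (x - 1) = Inv a" "s' y \<noteq> Inv a"
      using right[of "x - 1" y] that by fastforce
    have 4: "?F x (y + 1) = 0" if "s' y = Inv a" "s (x - 1) \<noteq> Inv a"
      using left[of x "y + 1"] that by fastforce
    have 5: "?F (x + 1) y = ?F x (y - 1)" if "s x = Dir a" "s' (y - 1) = Dir a"
      using graph_map_step[OF l, of x "y - 1" k k' lam mu] that by simp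
    have 6: "?F (x - 1) y = ?F x (y + 1)" if "s (x - 1) = Inv a" "s' y = Inv a"
      using graph_map_step[OF l, of "x - 1" y k k' lam mu] that by simp
    have "(if s x = Dir a then ?F (x + 1) y else 0) = (if s' (y - 1) = Dir a then ?F x (y - 1)
        else 0)"
      using 1 2 5 by auto
    moreover have "(if s (x - 1) = Inv a then ?F (x - 1) y else 0) = (if s' y = Inv a then ?F x (y +
        1) else 0)"
      using 3 4 6 by auto
    ultimately show ?thesis unfolding local_eq_def by simp
  qed
  moreover have "vertexwise s s' ?F"
    using nz unfolding vertexwise_def graph_pair_def by (metis fst_src)
  ultimately show ?thesis by (simp add: compatible_def)
qed

text \<open>A shift by a period keeps the extent and moves one left end by that period, which
  changes the corresponding quotient by one.\<close>

lemma twisted_graph_map: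
  assumes per: "\<And>t. s (t + k) = s t" "\<And>t. s' (t + k') = s' t" and nz: "lam \<noteq> 0" "mu \<noteq> 0"
    and k: "k > 0" "k' > 0"
  shows "twisted k k' lam mu (graph_map s s' k k' lam mu)"
proof -
  have e: "left_extent s s' (x + k) y = left_extent s s' x y" "left_extent s s' x (y + k') =
      left_extent s s' x y" for x y
  proof -
    have "s (x + k - 1 - int p) = s (x - 1 - int p)" "s' (y + k' - 1 - int p) = s' (y - 1 - int p)"
        for p
      using per(1)[of "x - 1 - int p"] per(2)[of "y - 1 - int p"] by (simp_all add: algebra_simps)
    then show "left_extent s s' (x + k) y = left_extent s s' x y" "left_extent s s' x (y + k') =
        left_extent s s' x y"
      by (simp_all add: left_extent_def)
  qed
  have d: "(x + k - z) div k = (x - z) div k + 1" "(x + k' - z) div k' = (x - z) div k' + 1" for x z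
  proof -
    have "x + k - z = (x - z) + k" "x + k' - z = (x - z) + k'" by simp_all
    then show "(x + k - z) div k = (x - z) div k + 1" "(x + k' - z) div k' = (x - z) div k' + 1"
      using k by (simp_all only: div_add_self2 less_imp_neq[symmetric] not_False_eq_True)
  qed
  have "graph_map s s' k k' lam mu (x + k) y = lam * graph_map s s' k k' lam mu x y" for x y
    using nz(1) graph_pair_periodic(1)[where s = s and k = k] per(1)
    by (simp add: graph_map_def e d power_int_add)
  moreover have "mu * graph_map s s' k k' lam mu x (y + k') = graph_map s s' k k' lam mu x y"
      for x y
  proof -
    have "mu * mu powi (- (n + 1)) = mu powi (- n)" for n
      using nz(2) power_int_add[of mu 1 "- (n + 1)"] by simp
    then show ?thesis
      using graph_pair_periodic(2)[where s = s' and k = k'] per(2)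
          by (simp add: graph_map_def e d mult.left_commute)
  qed
  ultimately show ?thesis by (simp add: twisted_def)
qed

text \<open>The morphism is the sum of the graph maps in orientation o', rewritten in the positions
  of b'. For the reverse orientation mu is inverted beforehand, so that
  \<open>twisted_orient\<close> restores it.\<close>

lemma graph_pair_hom:
  fixes lam mu :: "'k :: field"
  assumes b: "is_band Q \<rho> b" "is_band Q \<rho> b'" and nz: "lam \<noteq> 0" "mu \<noteq> 0" and o: "o' \<in> {1, - 1}"
    and gp: "graph_pair (unroll b) (orient o' (unroll b')) x y"
  obtains F where "band_map b b' F \<in> rep_hom Q (band_module Q b 1 lam) (band_module Q b' 1 mu)"
    "band_map b b' F \<noteq> rep_zero Q (band_module Q b 1 lam) (band_module Q b' 1 mu)"
    "\<And>x y. F x y \<noteq> 0 \<Longrightarrow> graph_pair (unroll b) (orient o' (unroll b')) x (o' * y)"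
proof -
  note l = line_unroll[OF b(1)] line_unroll[OF b(2)]
  define k where "k = int (length b)"
  define k' where "k' = int (length b')"
  have k: "k > 0" "k' > 0" using band_nonempty b by (simp_all add: k_def k'_def)
  define s where "s = unroll b"
  define s' where "s' = orient o' (unroll b')"
  have per: "s (t + k) = s t" "s' (t + k') = s' t" for t
  proof -
    show "s (t + k) = s t" using unroll_periodic[of b t 1] by (simp add: s_def k_def)
    have "unroll b' (t + k') = unroll b' t" for t using unroll_periodic[of b' t 1]
        by (simp add: k'_def)
    then show "s' (t + k') = s' t" unfolding s'_def by (rule orient_periodic)
  qed
  have nz': "mu powi o' \<noteq> 0" "(mu powi o') powi o' = mu" using nz o by auto
  define G where "G = graph_map s s' k k' lam (mu powi o')"
  have cG: "compatible s s' G" unfolding G_def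
    by (rule compatible_graph_map) (use l line_orient in \<open>simp_all add: s_def s'_def\<close>)
  have tG: "twisted k k' lam (mu powi o') G" unfolding G_def
    by (rule twisted_graph_map) (use per nz nz' k in auto)
  define F where "F x y = G x (o' * y)" for x y
  have oo: "orient o' s' = unroll b'" using o by (auto simp: s'_def)
  have c: "compatible s (unroll b') F"
    using compatible_orient[OF _ cG o] line_orient[OF l(2)] oo unfolding F_def s'_def by simp
  have t: "twisted k k' lam mu F"
    using twisted_orient[OF nz'(1) o tG] unfolding F_def nz'(2) .
  have vw: "vertexwise (unroll b) (unroll b') F" using c by (simp add: compatible_def s_def)
  have hom: "band_map b b' F \<in> rep_hom Q (band_module Q b 1 lam) (band_module Q b' 1 mu)"
    using band_map_hom_iff[OF b nz vw] t c by (simp add: k_def k'_def s_def)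
  have "F x (o' * y) \<noteq> 0"
    using gp nz nz' o by (auto simp: F_def G_def graph_map_def s_def s'_def)
  define y0 where "y0 = o' * y"
  have F0: "F x y0 \<noteq> 0" using \<open>F x (o' * y) \<noteq> 0\<close> by (simp add: y0_def)
  \<comment> \<open>Non-vanishing has to be seen within one period of each variable, where the
    matrices have their entries; the twist carries it there.\<close>
  have "F (x mod k) y0 \<noteq> 0"
    using periodic_pred[where P = "\<lambda>x. F x y0 \<noteq> 0" and k = k and x = "x mod k" and n = "x div k"]
        t nz(1) F0
    by (simp add: twisted_def)
  moreover have "F x' (y + k') \<noteq> 0 \<longleftrightarrow> F x' y \<noteq> 0" for x' y
    using t nz(2) unfolding twisted_def by (metis mult_eq_0_iff)
  ultimately have "F (x mod k) (y0 mod k') \<noteq> 0"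
    using periodic_pred[where P = "\<lambda>y. F (x mod k) y \<noteq> 0" and k = k' and x = "y0 mod k'" and n =
        "y0 div k'"]
    by simp
  then have "F (int (nat (x mod k))) (int (nat (y0 mod k'))) \<noteq> 0" using k by simp
  moreover have "nat (x mod k) < length b" "nat (y0 mod k') < length b'"
    using k by (simp_all add: nat_less_iff k_def k'_def)
  moreover have "vertexwise (unroll b) (unroll b') (\<lambda>_ _. 0 :: 'k)" by (simp add: vertexwise_def)
  ultimately have "band_map b b' F \<noteq> rep_zero Q (band_module Q b 1 lam) (band_module Q b' 1 mu)"
    unfolding rep_zero_band_map using band_map_eq_iff[OF b(1) vw] by blast
  moreover have "graph_pair (unroll b) (orient o' (unroll b')) x (o' * y)" if "F x y \<noteq> 0" for x y
    using that by (auto simp: F_def G_def graph_map_def s_def s'_def split: if_splits)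
  ultimately show thesis using that hom by blast
qed

text \<open>
  Comparing the two infinite words that start at a position of a line, one in each direction,
  lexicographically defines a strict order on positions. Graph maps strictly increase it.
\<close>

definition precedes :: "(int \<Rightarrow> 'b syllable) \<Rightarrow> int \<Rightarrow> int \<Rightarrow> bool" where
  "precedes s x y \<longleftrightarrow> (\<exists>o'\<in>{1, - 1}. graph_pair s (orient o' s) x (o' * y))"

lemma graph_pair_orient:
  assumes "line s" "line s'" "o' \<in> {1, - 1}"
  shows "graph_pair (orient o' s) (orient o' s') (o' * x) (o' * y) \<longleftrightarrow> graph_pair s s' x y"
  using assms graph_pair_flip by auto

text \<open>Reorienting both lines of the second pair by o' makes it composable with the first one,
  and the orientations multiply.\<close>

lemma precedes_trans:
  assumes l: "line s" and "precedes s x y" "precedes s y z"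
  shows "precedes s x z"
proof -
  obtain o' where o: "o' \<in> {1, - 1}" "graph_pair s (orient o' s) x (o' * y)"
    using assms(2) unfolding precedes_def by blast
  obtain d where d: "d \<in> {1, - 1}" "graph_pair s (orient d s) y (d * z)"
    using assms(3) unfolding precedes_def by blast
  have "graph_pair (orient o' s) (orient o' (orient d s)) (o' * y) (o' * (d * z))"
    using graph_pair_orient[OF l line_orient[OF l] o(1)] d(2) by blast
  then have "graph_pair s (orient (o' * d) s) x (o' * d * z)"
    using graph_pair_trans[OF o(2), of "orient (o' * d) s" "o' * (d * z)"] orient_orient[OF o(1)
        d(1), of s]
    by (simp only: mult.assoc)
  moreover have "o' * d \<in> {1, - 1}" using o(1) d(1) by auto
  ultimately show ?thesis unfolding precedes_def by blast
qed

text \<open>In the same orientation this is irreflexivity of \<open>diverges\<close>; in the reverse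
  one a letter would equal its negative.\<close>

lemma precedes_irrefl:
  assumes "line s"
  shows "\<not> precedes s x x"
proof
  assume "precedes s x x"
  then consider "graph_pair s s x x" | "graph_pair s (flip s) x (- x)"
      unfolding precedes_def by auto
  then show False
  proof cases
    case 2
    then have "src (s x) = letter_neg (src (s x))" using src_flip[OF assms, of "- x"]
        by (simp add: graph_pair_def)
    then show False using letter_src_neq_neg[OF line_arc[OF assms]] by blast
  qed simp
qed

text \<open>The height of a position is the number of positions within one period that precede it.
  The morphism built from graph maps raises it strictly, so \<open>reduced_height_raising\<close>
  would make that morphism zero.\<close>

lemma reduced_imp_no_graph_pair:
  fixes lam :: "'k :: field"
  assumes b: "is_band Q \<rho> b" and lam: "lam \<noteq> 0" and red: "reduced Q (band_module Q b 1 lam)"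
    and o: "o' \<in> {1, - 1}"
  shows "\<not> graph_pair (unroll b) (orient o' (unroll b)) x y"
proof
  assume gp: "graph_pair (unroll b) (orient o' (unroll b)) x y"
  note l = line_unroll[OF b]
  obtain F where F: "band_map b b F \<in> rep_hom Q (band_module Q b 1 lam) (band_module Q b 1 lam)"
    "band_map b b F \<noteq> rep_zero Q (band_module Q b 1 lam) (band_module Q b 1 lam)"
    "\<And>x y. F x y \<noteq> 0 \<Longrightarrow> graph_pair (unroll b) (orient o' (unroll b)) x (o' * y)"
    using graph_pair_hom[OF b b lam lam o gp] by metis
  have prec: "precedes (unroll b) x y" if "F x y \<noteq> 0" for x y
    using F(3)[OF that] o unfolding precedes_def by blast
  define h where "h x = card {z. z < length b \<and> precedes (unroll b) (int z) x}" for x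
  have h_less: "h (int x) < h y" if "precedes (unroll b) (int x) y" "x < length b" for x y
    unfolding h_def
  proof (rule psubset_card_mono)
    \<comment> \<open>The inclusion is proper, since x itself precedes y but does not precede
      x.\<close>
    show "{z. z < length b \<and> precedes (unroll b) (int z) (int x)} \<subset> {z. z < length b \<and>
        precedes (unroll b) (int z) y}"
      using that precedes_trans[OF l] precedes_irrefl[OF l] by blast
  qed simp
  have "band_map b b F = rep_zero Q (band_module Q b 1 lam) (band_module Q b 1 lam)"
  proof (rule reduced_height_raising[OF red rep_ok_band_module _ F(1)])
    fix v i
    show "h (int (band_positions Q b v ! i)) \<le> length b"
      unfolding h_def using card_mono[of "{..<length b}" "{z. z < length b \<and> precedes (unroll b)
          (int z) _}"] by auto
  next
    fix v i j
    assume v: "v \<in> verts Q" and ij: "i < rdim (band_module Q b 1 lam) v"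
        "j < rdim (band_module Q b 1 lam) v"
      and nz: "band_map b b F v $$ (i, j) \<noteq> 0"
    have "i < length (band_positions Q b v)" "j < length (band_positions Q b v)"
      using ij by (simp_all add: rdim_band_module)
    moreover from this have "F (int (band_positions Q b v ! j)) (int (band_positions Q b v ! i))
        \<noteq> 0"
      using nz v by (simp add: band_map_def lmat_def)
    moreover have "band_positions Q b v ! j < length b"
      using calculation(2) nth_mem[of j "band_positions Q b v"] by (auto simp: set_band_positions)
    ultimately show "h (int (band_positions Q b v ! j)) < h (int (band_positions Q b v ! i))"
      using prec h_less by blast
  qed
  then show False using F(2) by blast
qed

text \<open>The inverse band unrolls to the reversed line. Reversing both lines preserves graph
  pairs, so orienting the second line covers all relative orientations.\<close>

lemma weakly_perfectly_clustering_both_iff: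
  assumes "is_band Q \<rho> b" "is_band Q \<rho> b'"
  shows "weakly_perfectly_clustering Q \<rho> \<sigma> \<epsilon> (word b) (word b') \<and>
      weakly_perfectly_clustering Q \<rho> \<sigma> \<epsilon> (word b) (word (str_inv b')) \<longleftrightarrow>
    (\<forall>o'\<in>{1, - 1}. \<forall>x y. \<not> graph_pair (unroll b) (orient o' (unroll b')) x y)"
  using weakly_perfectly_clustering_iff[OF assms]
    weakly_perfectly_clustering_iff[OF assms(1) is_band_str_inv[OF assms(2)]]
    unroll_str_inv[OF band_nonempty[OF assms(2)]] by auto

end

theorem corollary8p2:
  fixes Q :: "('v, 'a) pre_digraph" and \<rho> :: "'a list set" and \<sigma> \<epsilon> :: "'a \<Rightarrow> int"
    and k :: nat and b :: "nat \<Rightarrow> 'a syllable list" and l :: "nat \<Rightarrow> nat"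
    and lam :: "nat \<Rightarrow> 'k :: alg_closed_field"
  assumes "signed_string_algebra Q \<rho> \<sigma> \<epsilon>" and "acyclic_quiver Q"
    and "\<And>i. i < k \<Longrightarrow> is_band Q \<rho> (b i)"
    and "\<And>i. i < k \<Longrightarrow> l i > 0"
    and "\<And>i. i < k \<Longrightarrow> lam i \<noteq> 0"
    and "\<And>i j. \<lbrakk>i < k; j < k; i \<noteq> j\<rbrakk> \<Longrightarrow>
      \<not> rep_iso Q (band_module Q (b i) (l i) (lam i)) (band_module Q (b j) (l j) (lam j))"
  shows "is_band_semibrick Q \<rho> (rep_sum (map (\<lambda>i. band_module Q (b i) (l i) (lam i)) [0..<k])) \<longleftrightarrow>
    (\<forall>i<k. l i = 1) \<and>
    (\<forall>i<k. \<forall>j<k.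
       weakly_perfectly_clustering Q \<rho> \<sigma> \<epsilon> (band_word Q \<sigma> \<epsilon> (b i)) (band_word Q \<sigma> \<epsilon> (b j)) \<and>
       weakly_perfectly_clustering Q \<rho> \<sigma> \<epsilon> (band_word Q \<sigma> \<epsilon> (b i)) (band_word Q \<sigma> \<epsilon> (str_inv (b j))))"
proof -
  interpret signed_string_algebra Q \<rho> \<sigma> \<epsilon> by fact
  interpret acyclic_string_algebra Q \<rho> \<sigma> \<epsilon> by unfold_locales fact
  define M where "M i = band_module Q (b i) (l i) (lam i)" for i
  define Ms where "Ms = map M [0..<k]"
  have Ms: "map (\<lambda>i. band_module Q (b i) (l i) (lam i)) [0..<k] = Ms" by (simp add: Ms_def M_def)
  have ok: "rep_ok Q (M i)" for i by (simp add: M_def rep_ok_band_module)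
  have okMs: "N \<in> set Ms \<Longrightarrow> rep_ok Q N" for N using ok by (auto simp: Ms_def)
  define NG where "NG i j \<longleftrightarrow> (\<forall>o'\<in>{1, - 1}. \<forall>x y.
    \<not> graph_pair (unroll (b i)) (orient o' (unroll (b j))) x y)" for i j
  have wpc: "weakly_perfectly_clustering Q \<rho> \<sigma> \<epsilon> (band_word Q \<sigma> \<epsilon> (b i)) (band_word Q \<sigma> \<epsilon> (b j)) \<and>
      weakly_perfectly_clustering Q \<rho> \<sigma> \<epsilon> (band_word Q \<sigma> \<epsilon> (b i)) (band_word Q \<sigma> \<epsilon> (str_inv (b j))) \<longleftrightarrow>
      NG i j" if "i < k" "j < k" for i j
    unfolding NG_def using weakly_perfectly_clustering_both_iff[OF assms(3,3)] that by blast
  have "is_band_semibrick Q \<rho> (rep_sum Ms) \<longleftrightarrow> (\<forall>i<k. l i = 1) \<and> (\<forall>i<k. \<forall>j<k. NG i j)"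
  proof
    assume "is_band_semibrick Q \<rho> (rep_sum Ms)"
    then obtain Bs where iso: "rep_iso Q (rep_sum Ms) (rep_sum Bs)"
      and bricks: "\<And>B. B \<in> set Bs \<Longrightarrow> is_brick Q \<rho> B"
      and orth: "\<And>i j. \<lbrakk>i < length Bs; j < length Bs; i \<noteq> j\<rbrakk> \<Longrightarrow> hom_zero Q (Bs ! i) (Bs ! j)"
      unfolding is_band_semibrick_def hom_zero_def by metis
    have okB: "B \<in> set Bs \<Longrightarrow> rep_ok Q B" for B
      using bricks is_module_rep_ok unfolding is_brick_def by blast
    \<comment> \<open>\<open>Bs\<close> is not known to match \<open>Ms\<close> summand by summand.
      The property is shown for the sum of \<open>Bs\<close>, carried over by the isomorphism and
      then split along \<open>Ms\<close>.\<close>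
    have "reduced Q (rep_sum Bs)"
      using reduced_rep_sum_iff[of Bs] okB orth reduced_brick bricks by blast
    then have "reduced Q (rep_sum Ms)"
      using reduced_iso[OF rep_ok_rep_sum rep_ok_rep_sum iso] okB okMs by blast
    then have red: "reduced Q (M i)" and orthM: "j < k \<Longrightarrow> i \<noteq> j \<Longrightarrow> hom_zero Q (M i) (M j)" if "i < k" for i j
      using that reduced_rep_sum_iff[of Ms] okMs by (auto simp: Ms_def)
    have l1: "l i = 1" if "i < k" for i
    proof (rule ccontr)
      assume "l i \<noteq> 1"
      then have "l i \<ge> 2" using assms(4)[OF that] by simp
      then show False using not_reduced_band_module[OF assms(3)[OF that], of "l i" "lam i"] red[OF that] by (simp add: M_def)
    qed
    \<comment> \<open>Between different summands any non-zero morphism is already a contradiction; a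
      graph map from a summand to itself needs the height argument.\<close>
    have "NG i j" if ij: "i < k" "j < k" for i j
    proof (cases "i = j")
      case True
      then show ?thesis
        using reduced_imp_no_graph_pair[OF assms(3,5)[OF ij(1)]] red[OF ij(1)] l1[OF ij(1)]
        by (simp add: NG_def M_def)
    next
      case False
      have z: "hom_zero Q (band_module Q (b i) 1 (lam i)) (band_module Q (b j) 1 (lam j))"
        using orthM[OF ij False] l1 ij by (simp add: M_def)
      have "\<not> graph_pair (unroll (b i)) (orient o' (unroll (b j))) x y" if o: "o' \<in> {1, - 1}" for o' x y
      proof
        assume "graph_pair (unroll (b i)) (orient o' (unroll (b j))) x y"
        from graph_pair_hom[OF assms(3)[OF ij(1)] assms(3)[OF ij(2)] assms(5)[OF ij(1)] assms(5)[OF ij(2)] o this]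
        show False using z unfolding hom_zero_def by metis
      qed
      then show ?thesis by (simp add: NG_def)
    qed
    then show "(\<forall>i<k. l i = 1) \<and> (\<forall>i<k. \<forall>j<k. NG i j)" using l1 by blast
  next
    assume r: "(\<forall>i<k. l i = 1) \<and> (\<forall>i<k. \<forall>j<k. NG i j)"
    then have M1: "M i = band_module Q (b i) 1 (lam i)" if "i < k" for i using that by (simp add: M_def)
    have ng: "\<not> graph_pair (unroll (b i)) (orient o' (unroll (b j))) x y"
      if "i < k" "j < k" "o' \<in> {1, - 1}" for i j o' x y
      using r that unfolding NG_def by blast
    have "is_brick Q \<rho> (M i)" if i: "i < k" for i
      unfolding M1[OF i] using is_brick_band_module[OF assms(3,5)[OF i]] ng[OF i i] by blast
    moreover have "is_band_module Q \<rho> (M i)" if i: "i < k" for i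
      unfolding is_band_module_def using assms(3-5)[OF i] rep_iso_refl[OF ok] by (metis M_def)
    \<comment> \<open>With graph pairs excluded, lines that agree everywhere are the only source of
      morphisms left; the pairwise non-isomorphism rules it out.\<close>
    moreover have "hom_zero Q (M i) (M j)" if ij: "i < k" "j < k" "i \<noteq> j" for i j
      using hom_zero_band_modules[OF assms(3)[OF ij(1)] assms(3)[OF ij(2)] assms(5)[OF ij(1)] assms(5)[OF ij(2)]]
        ng[OF ij(1,2)] assms(6)[OF ij] unfolding M_def[symmetric] M1[OF ij(1)] M1[OF ij(2)] by blast
    moreover have "rep_iso Q (rep_sum Ms) (rep_sum Ms)"
      using rep_iso_refl rep_ok_rep_sum[of Ms] okMs by blast
    ultimately show "is_band_semibrick Q \<rho> (rep_sum Ms)"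
      unfolding is_band_semibrick_def hom_zero_def[symmetric]
      by (intro exI[of _ Ms]) (auto simp: Ms_def)
  qed
  then show ?thesis unfolding Ms using wpc by blast
qed

end
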